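(* Let $p$ be a positive integer and let $R=P/Q$, where $P,Q$ are co-prime polynomials with constant coefficients. If the autonomous Schwarzian differential equation $$S(f,z)^p=R(f)=\frac{P(f)}{Q(f)}\qquad(\ast)$$ admits a transcendental meromorphic solution $f$ with a Picard exceptional value $\xi\in\hat{\mathbb{C}}$, then by some Möbius transformation $f=\gamma_1(u)$, equation $(\ast)$ reduces into either $$S(u,z)=c\,\frac{(u-\sqrt2\, i)(u+\sqrt2\, i)}{(u-1)(u+1)},$$ and the transcendental meromorphic solutions of $(\ast)$ are $f(z)=\gamma_1(\sin(\alpha z+\beta))$, where $\alpha=\sqrt{2c}$ and $\beta$ is a constant; or $$S(u,z)=c,$$ and all solutions of $(\ast)$ are $f(z)=\gamma_2(e^{\alpha z})$, where $\alpha=\sqrt{-2c}$ and $\gamma_2$ is any Möbius transformation.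
   Context: The Schwarzian derivative of a meromorphic function $f$ is $S(f,z)=\left(\frac{f''}{f'}\right)'-\frac12\left(\frac{f''}{f'}\right)^2=\frac{f'''}{f'}-\frac32\left(\frac{f''}{f'}\right)^2$. Meromorphic functions are meromorphic in the whole plane $\mathbb{C}$, and "transcendental" means not rational. $\hat{\mathbb{C}}=\mathbb{C}\cup\{\infty\}$, and a Picard exceptional value of $f$ is a point of $\hat{\mathbb{C}}$ that $f$ attains at most finitely many times. A Möbius transformation is a map $w\mapsto (aw+b)/(cw+d)$ with constant coefficients and $ad-bc\neq0$. In the claim, $c$ denotes a complex constant, the one appearing in the reduced equation. The Schwarzian derivative is unchanged when $f$ is composed with a Möbius transformation, $S(\gamma\circ f,z)=S(f,z)$; "reduces" means that after the substitution $f=\gamma_1(u)$ the equation takes the displayed form for $u$ (after a $p$-th root is extracted when $p>1$).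
   Formalization: For p>1 the constant c is taken up to a p-th root of unity ω: solutions are stated with α=√(2ωc), resp. α=√(-2ωc), ω^p=1, because with one fixed c the claim fails (S²=1 has solutions with S=1 and with S=-1); for p=1 nothing changes. *)

theory Defs
  imports "HOL-Complex_Analysis.Complex_Analysis"
begin

datatype riemann_sphere = Fin complex | Infty

text \<open>
  A meromorphic function on the plane is represented by the function \<open>f\<close> with
  \<open>f nicely_meromorphic_on UNIV\<close>: it has no removable singularities, and its poles, where the
  stored value is the dummy 0, are recognised by \<open>is_pole\<close>. Every meromorphic function has exactly
  one such representative, and \<open>sphere_val\<close> is the corresponding map into the Riemann sphere.
  Identities of meromorphic functions are stated off a discrete closed set (\<open>cosparse\<close>), because
  the pointwise values of derivatives and quotients at poles are junk.
\<close>

definition sphere_val :: "(complex \<Rightarrow> complex) \<Rightarrow> complex \<Rightarrow> riemann_sphere" where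
  "sphere_val f z = (if is_pole f z then Infty else Fin (f z))"

fun moebius :: "complex \<Rightarrow> complex \<Rightarrow> complex \<Rightarrow> complex \<Rightarrow> riemann_sphere \<Rightarrow> riemann_sphere" where
  "moebius a b c d (Fin w) = (if c * w + d = 0 then Infty else Fin ((a * w + b) / (c * w + d)))"
| "moebius a b c d Infty = (if c = 0 then Infty else Fin (a / c))"

definition is_moebius :: "(riemann_sphere \<Rightarrow> riemann_sphere) \<Rightarrow> bool" where
  "is_moebius \<gamma> \<longleftrightarrow> (\<exists>a b c d. a * d - b * c \<noteq> 0 \<and> \<gamma> = moebius a b c d)"

definition moebius_related ::
    "(complex \<Rightarrow> complex) \<Rightarrow> (riemann_sphere \<Rightarrow> riemann_sphere) \<Rightarrow> (complex \<Rightarrow> complex) \<Rightarrow> bool" where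
  "moebius_related f \<gamma> u \<longleftrightarrow> (\<forall>z. sphere_val f z = \<gamma> (sphere_val u z))"

definition transcendental :: "(complex \<Rightarrow> complex) \<Rightarrow> bool" where
  "transcendental f \<longleftrightarrow> \<not> (\<exists>A B. B \<noteq> 0 \<and> (\<forall>\<^sub>\<approx>z. f z = poly A z / poly B z))"

definition picard_exceptional :: "(complex \<Rightarrow> complex) \<Rightarrow> riemann_sphere \<Rightarrow> bool" where
  "picard_exceptional f \<xi> \<longleftrightarrow> finite {z. sphere_val f z = \<xi>}"

definition schwarzian :: "(complex \<Rightarrow> complex) \<Rightarrow> complex \<Rightarrow> complex" where
  "schwarzian f z =
     deriv (\<lambda>w. (deriv ^^ 2) f w / deriv f w) z - 1 / 2 * ((deriv ^^ 2) f z / deriv f z) ^ 2"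

text \<open>
  Meromorphic solutions of \<open>S(f,z)^p = R(f)\<close>. The Schwarzian derivative of a constant is undefined,
  so constants are not solutions.
\<close>

definition schwarz_solution ::
    "nat \<Rightarrow> (complex \<Rightarrow> complex) \<Rightarrow> (complex \<Rightarrow> complex) \<Rightarrow> bool" where
  "schwarz_solution p R f \<longleftrightarrow>
     f nicely_meromorphic_on UNIV \<and> \<not> f constant_on UNIV \<and>
     (\<forall>\<^sub>\<approx>z. schwarzian f z ^ p = R (f z))"

text \<open>
  The substitution \<open>f = \<gamma>(u)\<close> turns \<open>S(f,z)^p = R(f)\<close> into \<open>S(u,z) = T(u)\<close>. The first conjunct says
  that the substituted right-hand side is \<open>T(u)^p\<close>; the second says that, on solutions, the
  equation becomes \<open>S(u,z) = T(u)\<close> up to the choice of the \<open>p\<close>-th root, that is, up to replacing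
  \<open>T\<close> by \<open>\<omega> T\<close> for a \<open>p\<close>-th root of unity \<open>\<omega>\<close>.
\<close>

definition reduces_to ::
    "nat \<Rightarrow> (complex \<Rightarrow> complex) \<Rightarrow> (riemann_sphere \<Rightarrow> riemann_sphere) \<Rightarrow> (complex \<Rightarrow> complex) \<Rightarrow> bool"
  where
  "reduces_to p R \<gamma> T \<longleftrightarrow>
     (\<forall>\<^sub>\<approx>w. \<forall>v. \<gamma> (Fin w) = Fin v \<longrightarrow> R v = T w ^ p) \<and>
     (\<forall>f u. f nicely_meromorphic_on UNIV \<and> u nicely_meromorphic_on UNIV \<and>
            moebius_related f \<gamma> u \<longrightarrow>
        (schwarz_solution p R f \<longleftrightarrow>
           (\<exists>\<omega>. \<omega> ^ p = 1 \<and> schwarz_solution 1 (\<lambda>w. \<omega> * T w) u)))"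

definition sine_rhs :: "complex \<Rightarrow> complex \<Rightarrow> complex" where
  "sine_rhs c u =
     c * ((u - of_real (sqrt 2) * \<i>) * (u + of_real (sqrt 2) * \<i>)) / ((u - 1) * (u + 1))"

end

theory Submission
  imports Defs
begin

text \<open>
  The Schwarzian derivative is invariant under Moebius transformations of the function. Hence the exceptional value may
  be moved to infinity, and the task is to find the transcendental solutions \<open>h\<close> with finitely many poles of an
  equation \<open>S(h)^p = R(h)\<close> of the same kind.

  Growth. Maximising \<open>|h z| (\<rho> - |z|)^K\<close> over discs yields arbitrarily large points \<open>z\<close> and numbers \<open>a\<close> such that
  \<open>h (z + z t / a)\<close> is close to \<open>h z * exp t\<close> for small \<open>t\<close>, so that \<open>S(h,z)\<close> is close to \<open>- (a/z)\<^sup>2 / 2\<close>, whereas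
  \<open>|h z|\<close> exceeds prescribed powers of \<open>a\<close> and of \<open>|z|\<close> (\<open>exists_schwarzian_growth_point\<close>). This is incompatible with a
  pole of \<open>R\<close> at infinity. Consequently no exceptional value is a pole of \<open>R\<close>, and every pole is attained infinitely
  often (\<open>pole_value_attained_infinitely_often\<close>).

  Rigidity. Where a solution takes a pole \<open>a\<close> of order \<open>k\<close> of \<open>R\<close> as a value, comparing the leading terms shows that the
  multiplicity is \<open>m = 2 p / k \<ge> 2\<close> and that the leading coefficient is one of finitely many. If two germs of this kind
  with the same leading coefficient were different, the linearised equation would give \<open>j\<^sup>2 - j + 1 = m\<^sup>2\<close> for some
  \<open>j \<ge> 1\<close>, which is impossible. So the leading coefficient determines the germ (\<open>pole_germ_unique\<close>). As
  both the equation and the leading coefficient are preserved by rotations by \<open>m\<close>-th roots of unity, the solution is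
  symmetric under these rotations about each of the points. As there are infinitely many of these points and finitely many
  leading coefficients, the solution has a period (\<open>infinitely_attained_pole_imp_period\<close>).

  Identification. A period leaves no room for finitely many poles, so \<open>h\<close> is entire. It is not doubly periodic, which
  excludes \<open>m \<ge> 3\<close>; thus \<open>h\<close> is even about each of its critical points. With a minimal period \<open>t\<close>, it has the form
  \<open>h z = H (exp (2 \<pi> \<i> (z - z0) / t))\<close> with \<open>H (1/x) = H x\<close>. The growth lemma, applied to \<open>H\<close>, shows that \<open>H\<close> is a Laurent
  polynomial, and its critical points are 1 and \<open>-1\<close>, both simple. Therefore \<open>H x = A (x + 1/x) + B\<close>, and \<open>h\<close> is a cosine
  (\<open>periodic_solution_is_cosine\<close>).

  Conclusion. If \<open>R\<close> is not constant, the above turns the given solution into a sine function and the equation into the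
  first reduced equation. Any transcendental solution of the latter takes the value 1, which is a pole of the right-hand
  side, and rigidity there identifies it with a sine function (\<open>sine_equation_solutions\<close>). If \<open>R\<close> is constant, then so is
  \<open>S(f)\<close>; two functions with the same Schwarzian derivative differ by a Moebius transformation
  (\<open>schwarzian_eq_imp_moebius_related\<close>), and one such function is \<open>exp (\<alpha> z)\<close>.
\<close>

section \<open>The Schwarzian derivative\<close>

text \<open>
  The logarithmic derivative \<open>N\<close> of \<open>f'\<close>. In terms of \<open>N\<close> the Schwarzian derivative is the Riccati expression
  \<open>N' - N\<^sup>2/2\<close>, which is how its local behaviour and its uniqueness statements are obtained below.
\<close>

definition preschwarzian :: "(complex \<Rightarrow> complex) \<Rightarrow> complex \<Rightarrow> complex" where
  "preschwarzian f z = (deriv ^^ 2) f z / deriv f z"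

lemma schwarzian_altdef:
  "schwarzian f z = deriv (preschwarzian f) z - 1 / 2 * (preschwarzian f z) ^ 2"
  unfolding schwarzian_def preschwarzian_def ..

lemma eventually_nhds_deriv_eq:
  fixes f g :: "complex \<Rightarrow> complex"
  assumes "\<forall>\<^sub>F w in nhds z. f w = g w"
  shows "\<forall>\<^sub>F w in nhds z. deriv f w = deriv g w"
proof -
  have "\<forall>\<^sub>F y in nhds z. \<forall>\<^sub>F w in nhds y. f w = g w"
    using assms by (subst eventually_eventually)
  thus ?thesis by eventually_elim (auto intro: deriv_cong_ev)
qed

lemma preschwarzian_cong:
  assumes "\<forall>\<^sub>F w in nhds z. f w = g w"
  shows "\<forall>\<^sub>F w in nhds z. preschwarzian f w = preschwarzian g w"
  using eventually_nhds_deriv_eq[OF assms]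
        eventually_nhds_deriv_eq[OF eventually_nhds_deriv_eq[OF assms]]
  by eventually_elim (simp add: preschwarzian_def numeral_2_eq_2)

lemma schwarzian_cong:
  assumes "\<forall>\<^sub>F w in nhds z. f w = g w"
  shows "schwarzian f z = schwarzian g z"
  using preschwarzian_cong[OF assms] eventually_nhds_deriv_eq[OF preschwarzian_cong[OF assms]]
  unfolding schwarzian_altdef by (auto dest!: eventually_nhds_x_imp_x)

lemma eventually_analytic_nhds:
  fixes f :: "complex \<Rightarrow> complex"
  assumes "f analytic_on {z}"
  shows "\<forall>\<^sub>F w in nhds z. f analytic_on {w}"
proof -
  obtain e where e: "e > 0" "f analytic_on ball z e"
    using assms by (metis analytic_at_ball analytic_on_open open_ball)
  have "\<forall>\<^sub>F w in nhds z. w \<in> ball z e"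
    using e(1) by (intro eventually_nhds_in_open) auto
  thus ?thesis by eventually_elim (use e(2) analytic_on_analytic_at in blast)
qed

lemma analytic_higher_deriv_at:
  fixes f :: "complex \<Rightarrow> complex"
  assumes "f analytic_on {z}"
  shows "(deriv ^^ n) f analytic_on {z}"
  using assms by (rule analytic_higher_deriv)

lemma analytic_at_tendsto_nhds:
  fixes f :: "complex \<Rightarrow> complex"
  assumes "f analytic_on {z}"
  shows "(f \<longlongrightarrow> f z) (nhds z)"
  using analytic_at_imp_isCont[OF assms] by (simp add: isCont_def tendsto_at_iff_tendsto_nhds)

lemma eventually_nhds_nonzero:
  fixes f :: "complex \<Rightarrow> complex"
  assumes "f analytic_on {z}" "f z \<noteq> c"
  shows "\<forall>\<^sub>F w in nhds z. f w \<noteq> c"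
  by (rule tendsto_imp_eventually_ne[OF analytic_at_tendsto_nhds[OF assms(1)] assms(2)])

lemma preschwarzian_analytic:
  assumes "f analytic_on {z}" "deriv f z \<noteq> 0"
  shows "preschwarzian f analytic_on {z}"
  unfolding preschwarzian_def [abs_def]
  using analytic_higher_deriv_at[OF assms(1), of 2] assms
  by (intro analytic_intros) auto

lemma schwarzian_analytic:
  assumes "f analytic_on {z}" "deriv f z \<noteq> 0"
  shows "schwarzian f analytic_on {z}"
  unfolding schwarzian_altdef [abs_def]
  using preschwarzian_analytic[OF assms] by (auto intro!: analytic_intros analytic_deriv)

lemma analytic_at_has_deriv:
  fixes f :: "complex \<Rightarrow> complex"
  assumes "f analytic_on {z}"
  shows "(f has_field_derivative deriv f z) (at z)"
  using assms by (simp add: analytic_on_imp_differentiable_at DERIV_deriv_iff_field_differentiable)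

lemma schwarzian_eqI:
  assumes 1: "\<forall>\<^sub>F w in nhds z. (f has_field_derivative f1 w) (at w)"
    and 2: "\<forall>\<^sub>F w in nhds z. (f1 has_field_derivative f2 w) (at w)"
    and 3: "(f2 has_field_derivative f3) (at z)" and nz: "f1 z \<noteq> 0"
  shows "schwarzian f z = f3 / f1 z - 3 / 2 * (f2 z / f1 z) ^ 2"
proof -
  have d1: "\<forall>\<^sub>F w in nhds z. deriv f w = f1 w"
    using 1 by eventually_elim (rule DERIV_imp_deriv)
  have d2: "\<forall>\<^sub>F w in nhds z. (deriv ^^ 2) f w = f2 w"
    using eventually_nhds_deriv_eq[OF d1] 2
    by eventually_elim (simp add: numeral_2_eq_2 DERIV_imp_deriv)
  have ps: "\<forall>\<^sub>F w in nhds z. preschwarzian f w = f2 w / f1 w"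
    using d1 d2 by eventually_elim (simp add: preschwarzian_def)
  have f1: "(f1 has_field_derivative f2 z) (at z)"
    using 2 by (rule eventually_nhds_x_imp_x)
  have "((\<lambda>w. f2 w / f1 w) has_field_derivative (f3 * f1 z - f2 z * f2 z) / (f1 z * f1 z)) (at z)"
    by (rule DERIV_divide[OF 3 f1 nz])
  hence "deriv (preschwarzian f) z = (f3 * f1 z - f2 z * f2 z) / (f1 z * f1 z)"
    using deriv_cong_ev[OF ps refl] DERIV_imp_deriv by simp
  moreover have "preschwarzian f z = f2 z / f1 z"
    using ps by (rule eventually_nhds_x_imp_x)
  moreover have "(f3 * a - b * b) / (a * a) - 1 / 2 * (b / a) ^ 2 = f3 / a - 3 / 2 * (b / a) ^ 2"
    if "a \<noteq> 0" for a b
    using that by (simp add: field_simps power2_eq_square)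
  ultimately show ?thesis using nz by (simp only: schwarzian_altdef)
qed

lemma schwarzian_eq_third_deriv:
  assumes "f analytic_on {z}" "deriv f z \<noteq> 0"
  shows "schwarzian f z = (deriv ^^ 3) f z / deriv f z - 3 / 2 * ((deriv ^^ 2) f z / deriv f z) ^ 2"
proof (rule schwarzian_eqI)
  have *: "\<forall>\<^sub>F w in nhds z. ((deriv ^^ n) f has_field_derivative (deriv ^^ Suc n) f w) (at w)" for n
    using eventually_analytic_nhds[OF assms(1)]
    by eventually_elim (simp add: analytic_at_has_deriv analytic_higher_deriv_at)
  show "\<forall>\<^sub>F w in nhds z. (f has_field_derivative deriv f w) (at w)"
    using *[of 0] by simp
  show "\<forall>\<^sub>F w in nhds z. (deriv f has_field_derivative (deriv ^^ 2) f w) (at w)"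
    using *[of 1] by (simp add: numeral_2_eq_2)
  show "((deriv ^^ 2) f has_field_derivative (deriv ^^ 3) f z) (at z)"
    using eventually_nhds_x_imp_x[OF *[of 2]] by (simp add: eval_nat_numeral)
qed fact

text \<open>
  With \<open>c, e, d\<close> the first three derivatives of \<open>g\<close> at \<open>f z\<close> and \<open>f, b, a\<close> those of \<open>f\<close> at \<open>z\<close>, the left-hand side
  is the Schwarzian derivative of \<open>g \<circ> f\<close> computed by Faa di Bruno's formula.
\<close>

lemma schwarzian_chain_algebra:
  fixes a b c d e f :: complex assumes "c \<noteq> 0" "f \<noteq> 0"
  shows "(d * f ^ 3 + 3 * e * f * b + c * a) / (c * f) - 3 / 2 * ((e * f ^ 2 + c * b) / (c * f)) ^ 2
   = (d / c - 3 / 2 * (e / c)^2) * f ^ 2 + (a / f - 3 / 2 * (b / f)^2)"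
proof -
  have "(d * f ^ 3 + 3 * e * f * b + c * a) / (c * f) = d / c * f^2 + 3 * (e / c) * b + a / f"
    using assms by (simp add: field_simps power2_eq_square power3_eq_cube)
  moreover have "(e * f ^ 2 + c * b) / (c * f) = e / c * f + b / f"
    using assms by (simp add: field_simps power2_eq_square)
  moreover have "(e / c * f + b / f) ^ 2 = (e/c)^2 * f^2 + 2 * (e / c) * b + (b/f)^2"
    using assms by (simp add: field_simps power2_eq_square)
  ultimately show ?thesis by (simp only:) (simp add: algebra_simps)
qed

lemma schwarzian_compose:
  assumes f: "f analytic_on {z}" and g: "g analytic_on {f z}"
    and nz: "deriv f z \<noteq> 0" "deriv g (f z) \<noteq> 0"
  shows "schwarzian (\<lambda>w. g (f w)) z = schwarzian g (f z) * deriv f z ^ 2 + schwarzian f z"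
proof -
  have ev_f: "\<forall>\<^sub>F w in nhds z. f analytic_on {w}"
    using f by (rule eventually_analytic_nhds)
  have ev_g: "\<forall>\<^sub>F w in nhds z. g analytic_on {f w}"
    by (rule eventually_compose_filterlim[OF eventually_analytic_nhds[OF g] analytic_at_tendsto_nhds[OF f]])
  define f1 where "f1 = (\<lambda>w. deriv g (f w) * deriv f w)"
  define f2 where "f2 = (\<lambda>w. (deriv ^^ 2) g (f w) * deriv f w ^ 2 + deriv g (f w) * (deriv ^^ 2) f w)"
  define f3 where "f3 = (deriv ^^ 3) g (f z) * deriv f z ^ 3
      + 3 * (deriv ^^ 2) g (f z) * deriv f z * (deriv ^^ 2) f z + deriv g (f z) * (deriv ^^ 3) f z"
  have D: "((deriv ^^ n) h has_field_derivative (deriv ^^ Suc n) h w) (at w)"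
    if "h analytic_on {w}" for n w and h :: "complex \<Rightarrow> complex"
    using that by (simp add: analytic_at_has_deriv analytic_higher_deriv_at)
  have D': "((\<lambda>w. (deriv ^^ n) g (f w)) has_field_derivative (deriv ^^ Suc n) g (f w) * deriv f w) (at w)"
    if "f analytic_on {w}" "g analytic_on {f w}" for n w
    using DERIV_chain2[OF D[OF that(2)] analytic_at_has_deriv[OF that(1)]] .
  have "schwarzian (\<lambda>w. g (f w)) z = f3 / f1 z - 3 / 2 * (f2 z / f1 z) ^ 2"
  proof (rule schwarzian_eqI)
    show "\<forall>\<^sub>F w in nhds z. ((\<lambda>w. g (f w)) has_field_derivative f1 w) (at w)"
      using ev_f ev_g
      by eventually_elim (use D'[of _ 0] in \<open>simp add: f1_def\<close>)
    show "\<forall>\<^sub>F w in nhds z. (f1 has_field_derivative f2 w) (at w)"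
      using ev_f ev_g
    proof eventually_elim
      case (elim w)
      show ?case unfolding f1_def f2_def
        using DERIV_mult[OF D'[OF elim, of 1] D[OF elim(1), of 1]]
        by (simp add: numeral_2_eq_2 algebra_simps)
    qed
    have fz: "f analytic_on {z}" "g analytic_on {f z}" by fact+
    have g2: "((\<lambda>w. (deriv ^^ 2) g (f w)) has_field_derivative (deriv ^^ 3) g (f z) * deriv f z) (at z)"
      using D'[OF fz, of 2] by (simp add: eval_nat_numeral)
    have g1: "((\<lambda>w. deriv g (f w)) has_field_derivative (deriv ^^ 2) g (f z) * deriv f z) (at z)"
      using D'[OF fz, of 1] by (simp add: eval_nat_numeral)
    have f2': "((deriv ^^ 2) f has_field_derivative (deriv ^^ 3) f z) (at z)"
      using D[OF fz(1), of 2] by (simp add: eval_nat_numeral)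
    have f1': "(deriv f has_field_derivative (deriv ^^ 2) f z) (at z)"
      using D[OF fz(1), of 1] by (simp add: eval_nat_numeral)
    have "(f2 has_field_derivative
        ((deriv ^^ 3) g (f z) * deriv f z) * deriv f z ^ 2
         + (deriv ^^ 2) g (f z) * (2 * deriv f z * (deriv ^^ 2) f z)
         + (((deriv ^^ 2) g (f z) * deriv f z) * (deriv ^^ 2) f z + deriv g (f z) * (deriv ^^ 3) f z)) (at z)"
      unfolding f2_def
      by (rule derivative_eq_intros g2 g1 f1' f2' refl | simp add: algebra_simps)+
    thus "(f2 has_field_derivative f3) (at z)"
      unfolding f3_def by (simp add: algebra_simps power3_eq_cube power2_eq_square)
    show "f1 z \<noteq> 0" using nz by (simp add: f1_def)
  qed
  also have "\<dots> = schwarzian g (f z) * deriv f z ^ 2 + schwarzian f z"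
    unfolding schwarzian_eq_third_deriv[OF f nz(1)] schwarzian_eq_third_deriv[OF g nz(2)]
      f1_def f2_def f3_def
    by (rule schwarzian_chain_algebra[OF nz(2,1)])
  finally show ?thesis .
qed

lemma schwarzian_affine_inner:
  assumes "f analytic_on {a * z + b}" "deriv f (a * z + b) \<noteq> 0" "a \<noteq> 0"
  shows "schwarzian (\<lambda>w. f (a * w + b)) z = a ^ 2 * schwarzian f (a * z + b)"
proof -
  have d: "deriv (\<lambda>w. a * w + b) z = a"
    by (rule DERIV_imp_deriv) (auto intro!: derivative_eq_intros)
  have an: "(\<lambda>w. a * w + b) analytic_on {z}" by (intro analytic_intros)
  have s: "schwarzian (\<lambda>w. a * w + b) z = 0"
    by (subst schwarzian_eqI[where ?f1.0 = "\<lambda>_. a" and ?f2.0 = "\<lambda>_. 0" and ?f3.0 = 0])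
       (auto intro!: derivative_eq_intros always_eventually assms(3))
  show ?thesis
    using schwarzian_compose[of "\<lambda>w. a * w + b" z f] assms d s an by (simp add: mult.commute)
qed

lemma deriv_moebius:
  fixes a b c d w :: complex
  assumes "c * w + d \<noteq> 0"
  shows "((\<lambda>w. (a * w + b) / (c * w + d)) has_field_derivative (a * d - b * c) / (c * w + d) ^ 2) (at w)"
  using assms by (auto intro!: derivative_eq_intros simp: field_simps power2_eq_square)

lemma schwarzian_moebius:
  fixes a b c d w :: complex
  assumes "a * d - b * c \<noteq> 0" "c * w + d \<noteq> 0"
  shows "schwarzian (\<lambda>w. (a * w + b) / (c * w + d)) w = 0"
proof -
  have ev: "\<forall>\<^sub>F w in nhds w. c * w + d \<noteq> 0"
    by (rule eventually_nhds_nonzero) (use assms in \<open>auto intro!: analytic_intros\<close>)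
  have "schwarzian (\<lambda>w. (a * w + b) / (c * w + d)) w =
     6 * c ^ 2 * (a * d - b * c) / (c * w + d) ^ 4 / ((a * d - b * c) / (c * w + d) ^ 2)
      - 3 / 2 * (- 2 * c * (a * d - b * c) / (c * w + d) ^ 3 / ((a * d - b * c) / (c * w + d) ^ 2)) ^ 2"
  proof (rule schwarzian_eqI)
    show "\<forall>\<^sub>F w in nhds w. ((\<lambda>w. (a * w + b) / (c * w + d)) has_field_derivative
            (a * d - b * c) / (c * w + d) ^ 2) (at w)"
      using ev by eventually_elim (rule deriv_moebius)
    show "\<forall>\<^sub>F w in nhds w. ((\<lambda>w. (a * d - b * c) / (c * w + d) ^ 2) has_field_derivative
            - 2 * c * (a * d - b * c) / (c * w + d) ^ 3) (at w)"
      using ev by eventually_elim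
        (auto intro!: derivative_eq_intros simp: divide_simps power2_eq_square power3_eq_cube)
    show "((\<lambda>w. - 2 * c * (a * d - b * c) / (c * w + d) ^ 3) has_field_derivative
            6 * c ^ 2 * (a * d - b * c) / (c * w + d) ^ 4) (at w)"
      using assms by (auto intro!: derivative_eq_intros simp: divide_simps eval_nat_numeral)
  qed (use assms in auto)
  also have "\<dots> = 0"
  proof -
    have "6 * c ^ 2 * D / X ^ 4 / (D / X ^ 2) - 3 / 2 * (- 2 * c * D / X ^ 3 / (D / X ^ 2)) ^ 2 = 0"
      if "D \<noteq> 0" "X \<noteq> 0" for D X :: complex
      using that by (simp add: field_simps eval_nat_numeral)
    thus ?thesis using assms by blast
  qed
  finally show ?thesis .
qed

lemma schwarzian_moebius_compose:
  assumes f: "f analytic_on {z}" "deriv f z \<noteq> 0"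
    and m: "a * d - b * c \<noteq> 0" "c * f z + d \<noteq> 0"
  shows "schwarzian (\<lambda>w. (a * f w + b) / (c * f w + d)) z = schwarzian f z"
proof -
  have "deriv (\<lambda>w. (a * w + b) / (c * w + d)) (f z) \<noteq> 0"
    using DERIV_imp_deriv[OF deriv_moebius[OF m(2)], of a b] m by simp
  moreover have "(\<lambda>w. (a * w + b) / (c * w + d)) analytic_on {f z}"
    using m by (auto intro!: analytic_intros)
  ultimately show ?thesis
    using schwarzian_compose[OF f(1) _ f(2), of "\<lambda>w. (a * w + b) / (c * w + d)"]
      schwarzian_moebius[OF m] by simp
qed

lemma schwarzian_exp:
  assumes "\<alpha> \<noteq> 0"
  shows "schwarzian (\<lambda>z. exp (\<alpha> * z)) z = - (\<alpha> ^ 2) / 2"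
proof -
  have "schwarzian (\<lambda>z. exp (\<alpha> * z)) z =
     \<alpha> ^ 3 * exp (\<alpha> * z) / (\<alpha> * exp (\<alpha> * z)) - 3 / 2 * (\<alpha> ^ 2 * exp (\<alpha> * z) / (\<alpha> * exp (\<alpha> * z))) ^ 2"
    by (rule schwarzian_eqI)
       (use assms in \<open>auto intro!: derivative_eq_intros always_eventually simp: power2_eq_square power3_eq_cube\<close>)
  also have "\<dots> = - (\<alpha> ^ 2) / 2"
    using assms by (simp add: field_simps power2_eq_square power3_eq_cube)
  finally show ?thesis .
qed

lemma sine_rhs_eq: "sine_rhs c u = c * (u ^ 2 + 2) / (u ^ 2 - 1)"
proof -
  have "complex_of_real (sqrt 2) * complex_of_real (sqrt 2) = 2"
    by (metis of_real_mult of_real_numeral real_sqrt_mult_self abs_numeral)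
  moreover have "(u - t * \<i>) * (u + t * \<i>) = u ^ 2 + t * t" for t
    by (simp add: algebra_simps power2_eq_square)
  ultimately have "(u - of_real (sqrt 2) * \<i>) * (u + of_real (sqrt 2) * \<i>) = u ^ 2 + 2"
    by simp
  moreover have "(u - 1) * (u + 1) = u ^ 2 - 1"
    by (simp add: algebra_simps power2_eq_square)
  ultimately show ?thesis unfolding sine_rhs_def by simp
qed

lemma schwarzian_sin:
  assumes "\<alpha> \<noteq> 0" "cos (\<alpha> * z + \<beta>) \<noteq> 0"
  shows "schwarzian (\<lambda>z. sin (\<alpha> * z + \<beta>)) z = sine_rhs (\<alpha> ^ 2 / 2) (sin (\<alpha> * z + \<beta>))"
proof -
  define s where "s = sin (\<alpha> * z + \<beta>)"
  define c where "c = cos (\<alpha> * z + \<beta>)"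
  have cs: "c ^ 2 = 1 - s ^ 2" by (simp add: s_def c_def cos_squared_eq)
  have "schwarzian (\<lambda>z. sin (\<alpha> * z + \<beta>)) z =
     - (\<alpha> ^ 3) * c / (\<alpha> * cos (\<alpha> * z + \<beta>)) - 3 / 2 * (- (\<alpha> ^ 2) * sin (\<alpha> * z + \<beta>) / (\<alpha> * cos (\<alpha> * z + \<beta>))) ^ 2"
    by (rule schwarzian_eqI)
       (use assms in \<open>auto intro!: derivative_eq_intros always_eventually simp: c_def power2_eq_square power3_eq_cube\<close>)
  also have "\<dots> = - (\<alpha> ^ 2) - 3 / 2 * \<alpha> ^ 2 * s ^ 2 / c ^ 2"
  proof -
    have "- (\<alpha> ^ 3) * k / (\<alpha> * k) - 3 / 2 * (- (\<alpha> ^ 2) * s / (\<alpha> * k)) ^ 2 = - (\<alpha> ^ 2) - 3 / 2 * \<alpha> ^ 2 * s ^ 2 / k ^ 2"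
      if "k \<noteq> 0" for k
      using assms(1) that by (simp add: field_simps power2_eq_square power3_eq_cube)
    thus ?thesis using assms(2) unfolding c_def s_def by blast
  qed
  also have "\<dots> = sine_rhs (\<alpha> ^ 2 / 2) s"
  proof -
    have "c ^ 2 \<noteq> 0" using assms(2) by (simp add: c_def)
    hence nz: "1 - s ^ 2 \<noteq> 0" "s ^ 2 - 1 \<noteq> 0" using cs by auto
    have "- (\<alpha> ^ 2) - 3 / 2 * \<alpha> ^ 2 * x / (1 - x) = \<alpha> ^ 2 / 2 * (x + 2) / (x - 1)"
      if "1 - x \<noteq> 0" "x - 1 \<noteq> 0" for x
      using that by (simp add: field_simps)
    from this[OF nz] show ?thesis unfolding sine_rhs_eq cs .
  qed
  finally show ?thesis by (simp add: s_def)
qed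

section \<open>Points of exponential behaviour\<close>

text \<open>
  The first index at which an unbounded sequence exceeds both \<open>B\<close> and its initial term is a jump. It
  will be applied to the maximum modulus divided by a power of the radius.
\<close>

lemma geometric_jump:
  fixes m :: "nat \<Rightarrow> real"
  assumes "\<And>B. \<exists>n. m n > B"
  obtains n where "m (Suc n) > B" "m (Suc n) > m n"
proof -
  define B' where "B' = max B (m 0)"
  define k where "k = (LEAST n. m n > B')"
  have k: "m k > B'" unfolding k_def using assms[of B'] by (metis LeastI_ex)
  have "k \<noteq> 0" using k by (cases k) (auto simp: B'_def)
  then obtain n where n: "k = Suc n" by (cases k) auto
  have "\<not> m n > B'" using not_less_Least[of n "\<lambda>n. m n > B'"] n k_def by auto
  thus ?thesis using that[of n] k n by (auto simp: B'_def)
qed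

text \<open>
  The weight \<open>(\<rho> - |z|)^K\<close> vanishes on the circle of radius \<open>\<rho>\<close>, so the weighted modulus has its maximum
  inside. Growth faster than every power provides arbitrarily large \<open>\<rho>\<close> for which the maximum modulus grows by
  more than the factor \<open>4^K\<close> between the radii \<open>\<rho>/2\<close> and \<open>3\<rho>/4\<close>, and this pushes the maximum beyond \<open>\<rho>/2\<close>. The
  weight has radial logarithmic derivative \<open>-K/(\<rho> - |z|)\<close>; therefore \<open>a\<close> is the size that \<open>z f'(z)/f(z)\<close> must have at
  a maximum. Maximality also bounds \<open>(\<rho> - |z|)^(-K)\<close> by \<open>|f z|\<close> divided by a large maximum modulus, whence the bound
  on \<open>a^K\<close>.
\<close>

lemma exists_growth_point:
  fixes f :: "complex \<Rightarrow> complex" and K L :: nat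
  assumes r0: "r0 > 0" and hol: "f holomorphic_on {z. norm z > r0}"
    and nopoly: "\<And>C L r. \<exists>z. norm z \<ge> r \<and> norm z > r0 \<and> norm (f z) > C * norm z ^ L"
    and K: "K > 0"
  obtains z \<rho> a where "norm z \<ge> r" "norm z \<ge> 2 * (r0 + 1)" "norm z < \<rho>"
    "a = of_nat K * norm z / (\<rho> - norm z)" "a \<ge> of_nat K" "a ^ K \<le> norm (f z)" "norm z ^ L \<le> norm (f z)"
    "\<And>\<zeta>. norm \<zeta> \<ge> r0 + 1 \<Longrightarrow> norm \<zeta> \<le> \<rho> \<Longrightarrow>
        norm (f \<zeta>) * (\<rho> - norm \<zeta>) ^ K \<le> norm (f z) * (\<rho> - norm z) ^ K"
proof -
  define r1 where "r1 = r0 + 1"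
  define S where "S = (\<lambda>s. {z::complex. r1 \<le> norm z \<and> norm z \<le> s})"
  have compS: "compact (S s)" for s
  proof -
    have "S s = cball 0 s - ball 0 r1" by (auto simp: S_def)
    thus ?thesis using compact_diff[OF compact_cball open_ball] by simp
  qed
  have contf: "continuous_on (S s) f" for s
    by (rule continuous_on_subset[OF holomorphic_on_imp_continuous_on[OF hol]])
       (use r0 in \<open>auto simp: S_def r1_def\<close>)
  define M where "M = (\<lambda>s. Sup ((\<lambda>z. norm (f z)) ` S s))"
  have bdd: "bdd_above ((\<lambda>z. norm (f z)) ` S s)" for s
    using compact_imp_bounded[OF compact_continuous_image[OF continuous_on_norm[OF contf] compS]]
    by (rule bounded_imp_bdd_above)
  have M_ge: "norm (f z) \<le> M s" if "z \<in> S s" for z s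
    unfolding M_def using bdd that by (intro cSup_upper) auto
  have M_att: "\<exists>z\<in>S s. norm (f z) = M s" if "s \<ge> r1" for s
  proof -
    have ne: "S s \<noteq> {}"
    proof -
      have "complex_of_real s \<in> S s" using that r0 by (auto simp: S_def r1_def)
      thus ?thesis by blast
    qed
    obtain z where z: "z \<in> S s" "\<And>y. y \<in> S s \<Longrightarrow> norm (f y) \<le> norm (f z)"
      using continuous_attains_sup[OF compS ne continuous_on_norm[OF contf]] by blast
    have "M s = norm (f z)" unfolding M_def
      by (rule cSup_eq_maximum) (use z in auto)
    thus ?thesis using z by auto
  qed
  \<comment> \<open>Because \<open>(3/2)^4 > 4\<close>, a jump of \<open>M s / s^N\<close> from \<open>s\<close> to \<open>3 s / 2\<close> is a jump of \<open>M\<close> by more than \<open>4^K\<close>.\<close>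
  define N where "N = L + 4 * K"
  have N: "(3/2::real) ^ N \<ge> 4 ^ K"
  proof -
    have "(4::real) ^ K \<le> ((3/2) ^ 4) ^ K" by (intro power_mono) (auto simp: field_simps)
    also have "((3/2::real) ^ 4) ^ K = (3/2) ^ (4 * K)" by (simp add: power_mult)
    also have "\<dots> \<le> (3/2::real) ^ N" unfolding N_def by (intro power_increasing) auto
    finally show ?thesis .
  qed
  define s0 where "s0 = max (2 * r1) (max r 1)"
  have s0: "s0 \<ge> 2 * r1" "s0 \<ge> r" "s0 \<ge> 1" by (auto simp: s0_def)
  define s where "s = (\<lambda>n::nat. s0 * (3/2) ^ n)"
  have s_ge: "s n \<ge> s0" for n unfolding s_def using s0 by (simp add: mult_le_cancel_left1)
  have spos: "s n > 0" for n using s_ge[of n] s0 by linarith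
  have s_Suc: "s (Suc n) = 3/2 * s n" for n by (simp add: s_def)
  define m where "m = (\<lambda>n. M (s n) / s n ^ N)"
  \<comment> \<open>The two entries of \<open>B\<close> yield the lower bounds of \<open>|f z|\<close> by \<open>a^K\<close> and by \<open>|z|^L\<close>, respectively.\<close>
  define B where "B = max ((4 * real K) ^ K) (4 ^ K * 2 ^ L)"
  have unb: "\<exists>n. m n > B0" for B0
  proof -
    obtain x where x: "norm x \<ge> s 1" "norm (f x) > (\<bar>B0\<bar> * (3/2) ^ N) * norm x ^ N"
      using nopoly[of "s 1" "\<bar>B0\<bar> * (3/2) ^ N" N] by blast
    have ex: "\<exists>n. norm x \<le> s n"
    proof -
      obtain n where "norm x / s0 < (3/2::real) ^ n" using real_arch_pow[of "3/2"] by auto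
      thus ?thesis using s0 by (intro exI[of _ n]) (simp add: s_def field_simps)
    qed
    define k where "k = (LEAST n. norm x \<le> s n)"
    have k: "norm x \<le> s k" unfolding k_def using ex by (rule LeastI_ex)
    have "k \<noteq> 0" 
    proof
      assume "k = 0"
      hence "norm x \<le> s 0" using k by simp
      moreover have "s 0 < s 1" using spos[of 0] by (simp add: s_def)
      ultimately show False using x by linarith
    qed
    then obtain n where n: "k = Suc n" by (cases k) auto
    have "\<not> norm x \<le> s n" using not_less_Least[of n "\<lambda>n. norm x \<le> s n"] n k_def by auto
    hence "norm x \<ge> 2/3 * s k" using n s_Suc[of n] by simp
    hence "(3/2 * norm x) ^ N \<ge> s k ^ N" using spos[of k] by (intro power_mono) auto
    have "x \<in> S (s k)" using k x s_ge[of 1] s0 r0 by (auto simp: S_def r1_def)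
    have "\<bar>B0\<bar> * s k ^ N \<le> \<bar>B0\<bar> * (3/2 * norm x) ^ N"
      using \<open>(3/2 * norm x) ^ N \<ge> s k ^ N\<close> by (intro mult_left_mono) auto
    also have "\<dots> = (\<bar>B0\<bar> * (3/2) ^ N) * norm x ^ N"
      by (simp only: power_mult_distrib mult.assoc)
    also have "\<dots> < norm (f x)" by (rule x)
    also have "\<dots> \<le> M (s k)" using \<open>x \<in> S (s k)\<close> by (rule M_ge)
    finally have "m k > \<bar>B0\<bar>" unfolding m_def using spos[of k] by (simp add: field_simps)
    thus ?thesis by (intro exI[of _ k]) linarith
  qed
  obtain n where n: "m (Suc n) > B" "m (Suc n) > m n" using geometric_jump[of m B] unb by blast
  define \<rho> where "\<rho> = 2 * s n"
  have rho: "s n = \<rho> / 2" "s (Suc n) = 3 * \<rho> / 4" "\<rho> > 0"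
    using spos[of n] by (auto simp: \<rho>_def s_Suc)
  have rho_ge: "\<rho> / 2 \<ge> s0" using s_ge[of n] rho by simp
  define X where "X = M (3 * \<rho> / 4)"
  have "s n \<ge> r1" using s_ge[of n] s0 r0 by (simp add: r1_def)
  from M_att[OF this] have Mn_nonneg: "M (s n) \<ge> 0" by (metis norm_ge_zero)
  have jump: "X > 4 ^ K * M (\<rho> / 2)"
  proof -
    have "X / s (Suc n) ^ N > M (s n) / s n ^ N" using n(2) unfolding m_def X_def rho .
    hence "X > M (s n) * (s (Suc n) ^ N / s n ^ N)" using spos by (simp add: field_simps)
    moreover have "s (Suc n) ^ N / s n ^ N = (3/2) ^ N"
      using spos[of n] by (simp add: s_Suc power_mult_distrib power_divide)
    ultimately have "X > M (s n) * (3/2) ^ N" by simp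
    moreover have "M (s n) * (3/2) ^ N \<ge> M (s n) * 4 ^ K"
      using N Mn_nonneg by (intro mult_left_mono) auto
    ultimately show ?thesis unfolding rho by (simp add: mult.commute)
  qed
  have big: "X > B * (3 * \<rho> / 4) ^ N"
    using n(1) spos[of "Suc n"] unfolding m_def X_def rho(2) by (simp add: field_simps)
  have Bpos: "B > 0" by (simp add: B_def less_max_iff_disj)
  have rho34: "3 * \<rho> / 4 \<ge> 1" using rho_ge s0 by linarith
  have X1: "X \<ge> (4 * real K) ^ K"
  proof -
    have "(4 * real K) ^ K \<le> B * 1" by (simp add: B_def)
    also have "B * 1 \<le> B * (3 * \<rho> / 4) ^ N"
      using rho34 Bpos by (intro mult_left_mono one_le_power) auto
    finally show ?thesis using big by linarith
  qed
  have X2: "X \<ge> 4 ^ K * \<rho> ^ L"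
  proof -
    have "4 ^ K * \<rho> ^ L \<le> 4 ^ K * (2 * (3 * \<rho> / 4)) ^ L"
      using rho by (intro mult_left_mono power_mono) auto
    also have "\<dots> = (4 ^ K * 2 ^ L) * (3 * \<rho> / 4) ^ L"
      unfolding power_mult_distrib by simp
    also have "\<dots> \<le> B * (3 * \<rho> / 4) ^ N"
      using rho34 Bpos by (intro mult_mono power_increasing) (auto simp: B_def N_def)
    finally show ?thesis using big by linarith
  qed
  have Xpos: "X > 0" 
  proof -
    have "4 ^ K * \<rho> ^ L > 0" using rho by simp
    thus ?thesis using X2 by linarith
  qed
  have "r1 \<le> 3 * \<rho> / 4" "r1 \<le> \<rho>" using rho_ge s0 rho r0 by (auto simp: r1_def)
  then obtain \<zeta>0 where \<zeta>0: "\<zeta>0 \<in> S (3 * \<rho> / 4)" "norm (f \<zeta>0) = X"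
    using M_att unfolding X_def by blast
  \<comment> \<open>the weighted modulus\<close>
  define \<Phi> where "\<Phi> = (\<lambda>z. norm (f z) * (\<rho> - norm z) ^ K)"
  have "S \<rho> \<noteq> {}"
  proof -
    have "complex_of_real \<rho> \<in> S \<rho>" using \<open>r1 \<le> \<rho>\<close> rho by (auto simp: S_def)
    thus ?thesis by blast
  qed
  moreover have "continuous_on (S \<rho>) \<Phi>" unfolding \<Phi>_def
    by (intro continuous_intros contf)
  ultimately obtain z where z: "z \<in> S \<rho>" "\<And>y. y \<in> S \<rho> \<Longrightarrow> \<Phi> y \<le> \<Phi> z"
    using continuous_attains_sup[OF compS] by blast
  have \<Phi>z: "\<Phi> z \<ge> X * (\<rho> / 4) ^ K"
  proof -
    have "\<zeta>0 \<in> S \<rho>" using \<zeta>0 rho by (auto simp: S_def)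
    hence "\<Phi> z \<ge> \<Phi> \<zeta>0" by (rule z)
    moreover have "\<Phi> \<zeta>0 \<ge> X * (\<rho> / 4) ^ K"
      unfolding \<Phi>_def \<zeta>0(2) using \<zeta>0 Xpos rho by (intro mult_left_mono power_mono) (auto simp: S_def)
    ultimately show ?thesis by linarith
  qed
  have \<Phi>pos: "\<Phi> z > 0" 
  proof -
    have "X * (\<rho> / 4) ^ K > 0" using Xpos rho by simp
    thus ?thesis using \<Phi>z by linarith
  qed
  have z\<rho>: "norm z < \<rho>"
  proof (rule ccontr)
    assume "\<not> norm z < \<rho>"
    hence "norm z = \<rho>" using z(1) by (auto simp: S_def)
    thus False using \<Phi>pos K by (simp add: \<Phi>_def power_0_left)
  qed
  have zhalf: "norm z > \<rho> / 2"
  proof (rule ccontr)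
    assume "\<not> norm z > \<rho> / 2"
    hence "z \<in> S (\<rho> / 2)" using z(1) by (auto simp: S_def)
    hence "norm (f z) \<le> M (\<rho> / 2)" by (rule M_ge)
    hence "\<Phi> z \<le> M (\<rho> / 2) * \<rho> ^ K"
      unfolding \<Phi>_def using z\<rho> Mn_nonneg rho by (intro mult_mono power_mono) auto
    moreover have "M (\<rho> / 2) * \<rho> ^ K < X * (\<rho> / 4) ^ K"
      using jump rho by (simp add: power_divide field_simps)
    ultimately show False using \<Phi>z by linarith
  qed
  define a where "a = of_nat K * norm z / (\<rho> - norm z)"
  have d: "\<rho> - norm z > 0" "\<rho> - norm z \<le> norm z" "\<rho> - norm z \<le> \<rho>" using z\<rho> zhalf rho by auto
  have fz: "norm (f z) \<ge> X * (\<rho> / 4) ^ K / (\<rho> - norm z) ^ K"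
    using \<Phi>z d by (simp add: \<Phi>_def field_simps)
  show ?thesis
  proof (rule that[of z \<rho> a])
    show "norm z \<ge> r" "norm z \<ge> 2 * (r0 + 1)" using zhalf rho_ge s0 by (auto simp: r1_def)
    show "norm z < \<rho>" by fact
    show "a = of_nat K * norm z / (\<rho> - norm z)" by (rule a_def)
    show "a \<ge> of_nat K"
      using d K unfolding a_def by (simp add: le_divide_eq mult_left_mono)
    have "a ^ K = (real K) ^ K * norm z ^ K / (\<rho> - norm z) ^ K"
      by (simp add: a_def power_divide power_mult_distrib)
    also have "\<dots> \<le> (real K) ^ K * \<rho> ^ K / (\<rho> - norm z) ^ K"
      using d z\<rho> by (intro divide_right_mono mult_left_mono power_mono) auto
    also have "\<dots> = (4 * real K) ^ K * (\<rho> / 4) ^ K / (\<rho> - norm z) ^ K"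
      by (simp add: power_divide power_mult_distrib)
    also have "\<dots> \<le> X * (\<rho> / 4) ^ K / (\<rho> - norm z) ^ K"
      using d rho X1 by (intro divide_right_mono mult_right_mono) auto
    also have "\<dots> \<le> norm (f z)" by (rule fz)
    finally show "a ^ K \<le> norm (f z)" .
    have "norm z ^ L \<le> \<rho> ^ L" using z\<rho> by (intro power_mono) auto
    also have "\<rho> ^ L = 4 ^ K * \<rho> ^ L * (\<rho> / 4) ^ K / \<rho> ^ K"
      using rho by (simp add: power_divide)
    also have "\<dots> \<le> X * (\<rho> / 4) ^ K / (\<rho> - norm z) ^ K"
      using d rho X2 Xpos by (intro frac_le mult_right_mono power_mono) auto
    also have "\<dots> \<le> norm (f z)" by (rule fz)
    finally show "norm z ^ L \<le> norm (f z)" .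
    show "norm (f \<zeta>) * (\<rho> - norm \<zeta>) ^ K \<le> norm (f z) * (\<rho> - norm z) ^ K"
      if "norm \<zeta> \<ge> r0 + 1" "norm \<zeta> \<le> \<rho>" for \<zeta>
      using z(2)[of \<zeta>] that by (auto simp: S_def r1_def \<Phi>_def)
  qed
qed

text \<open>
  By the Schwarz-Pick inequality, a function whose modulus hardly exceeds its value at the centre is
  nearly constant on the smaller disc.
\<close>

lemma holomorphic_near_one:
  fixes g :: "complex \<Rightarrow> complex"
  assumes hol: "g holomorphic_on ball 0 1" and g0: "g 0 = 1"
    and M: "\<And>t. norm t < 1 \<Longrightarrow> norm (g t) < M" and t: "norm t \<le> 1 / 2"
  shows "norm (g t - 1) \<le> M - 1 / M"
proof -
  have M1: "M > 1" using M[of 0] g0 by simp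
  define h where "h = (\<lambda>t. g t / of_real M)"
  define h0 where "h0 = 1 / M"
  have h0: "0 < h0" "h0 < 1" using M1 by (auto simp: h0_def)
  have h1: "norm (h t) < 1" if "norm t < 1" for t
    using M[OF that] M1 by (simp add: h_def norm_divide)
  have hh: "h 0 = of_real h0" by (simp add: h_def g0 h0_def)
  have den: "1 - of_real h0 * h t \<noteq> 0" if "norm t < 1" for t
  proof
    assume "1 - of_real h0 * h t = 0"
    hence "norm (of_real h0 * h t) = 1" by simp
    hence "h0 * norm (h t) = 1" using h0 by (simp add: norm_mult)
    moreover have "h0 * norm (h t) \<le> h0 * 1" using h1[OF that] h0 by (intro mult_left_mono) auto
    ultimately show False using h0 by linarith
  qed
  \<comment> \<open>Composing with the automorphism of the disc that takes \<open>h 0\<close> to 0 prepares for the Schwarz lemma.\<close>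
  define q where "q = (\<lambda>t. (h t - of_real h0) / (1 - of_real h0 * h t))"
  have qhol: "q holomorphic_on ball 0 1"
    unfolding q_def h_def using hol den M1 by (intro holomorphic_intros) (auto simp: h_def)
  have q1: "norm (q t) < 1" if "norm t < 1" for t
  proof -
    define w where "w = h t"
    have w: "(norm w)^2 < 1" using h1[OF that] unfolding w_def abs_square_less_1 by simp
    have "(norm (1 - of_real h0 * w))^2 - (norm (w - of_real h0))^2 = (1 - h0^2) * (1 - (norm w)^2)"
      unfolding cmod_power2 by (simp add: algebra_simps power2_eq_square)
    moreover have "\<dots> > 0" using w h0 by (intro mult_pos_pos) (auto simp: abs_square_less_1)
    ultimately have "(norm (w - of_real h0))^2 < (norm (1 - of_real h0 * w))^2" by linarith
    hence "norm (w - of_real h0) < norm (1 - of_real h0 * w)"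
      by (rule power2_less_imp_less) simp
    thus ?thesis using den[OF that] by (simp add: q_def w_def norm_divide)
  qed
  have t1: "norm t < 1" using t by simp
  have "norm (q t) \<le> norm t"
    by (rule Schwarz_Lemma(1)[OF qhol _ q1 t1]) (auto simp: q_def hh)
  hence qt: "norm (q t) \<le> 1 / 2" using t by simp
  have "h t - of_real h0 = q t * (1 - of_real h0 * h t)"
    using den[OF t1] by (simp add: q_def)
  also have "1 - of_real h0 * h t = of_real (1 - h0^2) - of_real h0 * (h t - of_real h0)"
    by (simp add: algebra_simps power2_eq_square)
  finally have "norm (h t - of_real h0) = norm (q t) * norm (of_real (1 - h0^2) - of_real h0 * (h t - of_real h0))"
    by (metis norm_mult)
  also have "\<dots> \<le> 1 / 2 * ((1 - h0^2) + h0 * norm (h t - of_real h0))"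
  proof (intro mult_mono qt)
    have "norm (of_real (1 - h0^2) - of_real h0 * (h t - of_real h0))
        \<le> norm (complex_of_real (1 - h0^2)) + norm (of_real h0 * (h t - of_real h0))"
      by (rule norm_triangle_ineq4)
    also have "\<dots> = (1 - h0^2) + h0 * norm (h t - of_real h0)"
      using h0 by (simp only: norm_mult norm_of_real) (simp add: abs_square_le_1)
    finally show "norm (of_real (1 - h0^2) - of_real h0 * (h t - of_real h0))
        \<le> (1 - h0^2) + h0 * norm (h t - of_real h0)" .
  qed auto
  also have "h0 * norm (h t - of_real h0) \<le> 1 * norm (h t - of_real h0)"
    using h0 by (intro mult_right_mono) auto
  finally have le: "norm (h t - of_real h0) \<le> 1 - h0^2" by simp
  have "g t - 1 = of_real M * (h t - of_real h0)"
    using M1 by (simp add: h_def h0_def field_simps)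
  hence "norm (g t - 1) = M * norm (h t - of_real h0)" using M1 by (simp add: norm_mult)
  also have "\<dots> \<le> M * (1 - h0^2)" using le M1 by (intro mult_left_mono) auto
  also have "\<dots> = M - 1 / M" using M1 by (simp add: h0_def field_simps power2_eq_square)
  finally show ?thesis .
qed

lemma norm_one_plus_le:
  assumes "norm (x::complex) \<le> 1"
  shows "norm (1 + x) \<le> 1 + Re x + (norm x)^2"
proof (rule power2_le_imp_le)
  have re: "\<bar>Re x\<bar> \<le> 1" using assms abs_Re_le_cmod[of x] by linarith
  show "0 \<le> 1 + Re x + (norm x)^2" using re by (smt (verit) zero_le_power2)
  have "(1 + Re x + (norm x)^2)^2 = 1 + 2 * Re x + 2 * (norm x)^2 + (Re x + (norm x)^2)^2"
    by (simp add: power2_eq_square algebra_simps)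
  moreover have "(norm (1 + x))^2 = 1 + 2 * Re x + (norm x)^2"
    unfolding cmod_power2 by (simp add: power2_eq_square algebra_simps)
  ultimately show "(norm (1 + x))^2 \<le> (1 + Re x + (norm x)^2)^2"
    by (smt (verit) zero_le_power2)
qed

text \<open>
  A quantitative form of \<open>(1 - x/K)^K \<longlongrightarrow> exp (-x)\<close>, from \<open>ln (1 - y) \<ge> - y - y\<^sup>2\<close> for \<open>|y| \<le> 1/2\<close>.
\<close>

lemma one_minus_div_power_ge:
  fixes x :: real and K :: nat
  assumes "\<bar>x\<bar> \<le> 2" "K \<ge> 4"
  shows "exp (- x - 4 / K) \<le> (1 - x / K) ^ K" "1 - x / K > 0"
proof -
  define y where "y = x / K"
  have y: "\<bar>y\<bar> \<le> 1 / 2" using assms by (simp add: y_def abs_divide field_simps)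
  show pos: "1 - x / K > 0" using y unfolding y_def by linarith
  have *: "- y - y^2 \<le> ln (1 - y)"
  proof (cases "y \<ge> 0")
    case False
    have "ln (1 + (-y)) \<ge> (-y) - (-y)^2"
      using ln_one_plus_pos_lower_bound[of "-y"] False y by linarith
    thus ?thesis by simp
  next
    case True
    have tay: "exp (y + y^2) \<ge> 1 + (y + y^2) + (y+y^2)^2/2"
      using exp_lower_Taylor_quadratic[of "y + y^2"] True by auto
    have "y^2 \<le> (1/2)^2" "y^3 \<le> (1/2)^3" using y True by (intro power_mono; auto)+
    hence "1/2 - y/2 - y^2/2 - y^3/2 \<ge> 0" using y by (auto simp: power2_eq_square power3_eq_cube)
    hence "1 \<le> 1 + y^2 * (1/2 - y/2 - y^2/2 - y^3/2)" by simp
    also have "\<dots> = (1 + (y + y^2) + (y+y^2)^2/2) * (1 - y)"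
      by (simp add: field_simps power2_eq_square power3_eq_cube)
    also have "\<dots> \<le> exp (y + y^2) * (1 - y)"
      using y tay by (intro mult_right_mono) auto
    finally have "exp (y + y^2) * (1 - y) \<ge> 1" .
    hence "exp (- y - y^2) \<le> 1 - y" by (simp add: exp_minus exp_diff exp_add field_simps)
    hence "ln (exp (- y - y^2)) \<le> ln (1 - y)" by (subst ln_le_cancel_iff) (use pos y_def in auto)
    thus ?thesis by simp
  qed
  have "- x - 4 / K \<le> K * (- y - y^2)"
  proof -
    have "x^2 \<le> 4" using assms(1) abs_le_square_iff[of x 2] by simp
    hence "x^2 / K \<le> 4 / K" by (intro divide_right_mono) auto
    moreover have "K * (- y - y^2) = - x - x^2 / K" using assms(2)
      by (simp add: y_def field_simps power2_eq_square)
    ultimately show ?thesis by linarith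
  qed
  also have "\<dots> \<le> K * ln (1 - y)" using * by (intro mult_left_mono) auto
  also have "\<dots> = ln ((1 - x / K) ^ K)" using pos by (simp add: y_def ln_realpow)
  finally show "exp (- x - 4 / K) \<le> (1 - x / K) ^ K"
    using pos by (simp add: ln_ge_iff)
qed

text \<open>
  At a weighted maximum \<open>|f|\<close> grows at most like the inverse weight. In the scale
  \<open>\<zeta> = z + z t / a\<close> one has \<open>|\<zeta>| \<le> |z| + (|z|/a) (Re t + 1/a)\<close>, and \<open>|z|/a = (\<rho> - |z|)/K\<close>, so the quotient of the
  weights is at least \<open>(1 - x/K)^K\<close> with \<open>x = Re t + 1/K\<close>, which is nearly \<open>exp (- Re t)\<close>.
\<close>

lemma growth_point_rescaled_bound:
  fixes f :: "complex \<Rightarrow> complex" and K :: nat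
  assumes K: "K \<ge> 4" and z\<rho>: "norm z < \<rho>" and z: "norm z \<ge> 2 * (r0 + 1)" "r0 > 0"
    and a: "a = of_nat K * norm z / (\<rho> - norm z)" "a \<ge> of_nat K"
    and max: "\<And>\<zeta>. norm \<zeta> \<ge> r0 + 1 \<Longrightarrow> norm \<zeta> \<le> \<rho> \<Longrightarrow>
        norm (f \<zeta>) * (\<rho> - norm \<zeta>) ^ K \<le> norm (f z) * (\<rho> - norm z) ^ K"
    and t: "norm t < 1"
  shows "norm (z + z / of_real a * t) \<ge> r0 + 1"
    and "norm (f (z + z / of_real a * t)) \<le> norm (f z) * exp (Re t + 5 / K)"
proof -
  define \<zeta> where "\<zeta> = z + z / of_real a * t"
  have a4: "a \<ge> 4" using a K by linarith
  have \<zeta>: "\<zeta> = z * (1 + t / of_real a)" by (simp add: \<zeta>_def algebra_simps)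
  have ta: "norm (t / of_real a) \<le> 1 / a"
    using t a4 by (simp add: norm_divide divide_right_mono)
  have "norm (1 + t / of_real a) \<ge> 1 - 1 / a"
    using norm_triangle_ineq2[of 1 "- (t / of_real a)"] ta by simp
  moreover have "1 / a \<le> 1 / 4" using a4 by (intro divide_left_mono) auto
  ultimately have "norm (1 + t / of_real a) \<ge> 1 / 2" by linarith
  hence "norm \<zeta> \<ge> norm z * (1 / 2)" unfolding \<zeta> norm_mult by (intro mult_left_mono) auto
  moreover have "norm z * (1 / 2) \<ge> r0 + 1" using z(1) by simp
  ultimately have ge: "norm \<zeta> \<ge> r0 + 1" by linarith
  thus "norm (z + z / of_real a * t) \<ge> r0 + 1" by (simp add: \<zeta>_def)
  define x where "x = Re t + 1 / K"
  have "1 / real K \<le> 1 / 4" using K by (intro divide_left_mono) auto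
  moreover have "1 / real K \<ge> 0" by simp
  ultimately have x: "\<bar>x\<bar> \<le> 2" using abs_Re_le_cmod[of t] t unfolding x_def by linarith
  have D: "\<rho> - norm z > 0" using z\<rho> by simp
  have "norm (1 + t / of_real a) \<le> 1 + Re (t / of_real a) + (norm (t / of_real a))^2"
    by (rule norm_one_plus_le) (use ta \<open>1 / a \<le> 1 / 4\<close> in linarith)
  also have "\<dots> \<le> 1 + Re t / a + (1 / a)^2"
    using power_mono[OF ta, of 2] by simp
  finally have "norm \<zeta> \<le> norm z * (1 + Re t / a + (1 / a)^2)"
    unfolding \<zeta> norm_mult by (intro mult_left_mono) auto
  also have "\<dots> = norm z + (norm z / a) * (Re t + 1 / a)"
    by (simp add: algebra_simps power2_eq_square)
  also have "norm z / a = (\<rho> - norm z) / K"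
    using a K D z by (simp add: field_simps)
  also have "(\<rho> - norm z) / K * (Re t + 1 / a) \<le> (\<rho> - norm z) / K * x"
  proof -
    have "0 < a * real K" using a4 K by simp
    hence "1 / a \<le> 1 / K" using a(2) by (intro divide_left_mono) auto
    thus ?thesis unfolding x_def using D by (intro mult_left_mono add_left_mono) auto
  qed
  finally have le: "(\<rho> - norm z) * (1 - x / K) \<le> \<rho> - norm \<zeta>"
    by (simp add: algebra_simps)
  note p = one_minus_div_power_ge[OF x K]
  have pos: "(\<rho> - norm z) * (1 - x / K) > 0" using p(2) D by simp
  have "norm (f \<zeta>) * (\<rho> - norm z) ^ K * exp (- x - 4 / K) \<le> norm (f \<zeta>) * ((\<rho> - norm z) * (1 - x / K)) ^ K"
    unfolding power_mult_distrib mult.assoc using D p by (intro mult_left_mono) auto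
  also have "\<dots> \<le> norm (f \<zeta>) * (\<rho> - norm \<zeta>) ^ K"
    using le pos by (intro mult_left_mono power_mono) auto
  also have "\<dots> \<le> norm (f z) * (\<rho> - norm z) ^ K"
    by (rule max) (use ge le pos in linarith)+
  finally have "(norm (f \<zeta>) * exp (- x - 4 / K)) * (\<rho> - norm z) ^ K \<le> norm (f z) * (\<rho> - norm z) ^ K"
    by (simp add: mult_ac)
  hence "norm (f \<zeta>) * exp (- x - 4 / K) \<le> norm (f z)"
    using D by (simp add: mult_le_cancel_right)
  hence "norm (f \<zeta>) * exp (- x - 4 / K) * exp (x + 4 / K) \<le> norm (f z) * exp (x + 4 / K)"
    by (intro mult_right_mono) auto
  moreover have "norm (f \<zeta>) * exp (- x - 4 / K) * exp (x + 4 / K) = norm (f \<zeta>)"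
  proof -
    have "exp (- x - 4 / K) * exp (x + 4 / K) = 1" by (simp flip: exp_add)
    thus ?thesis unfolding mult.assoc by (simp only: mult_1_right)
  qed
  ultimately have "norm (f \<zeta>) \<le> norm (f z) * exp (x + 4 / K)" by (simp only:)
  moreover have "x + 4 / K = Re t + 5 / K" by (simp add: x_def add_divide_distrib[symmetric])
  ultimately show "norm (f (z + z / of_real a * t)) \<le> norm (f z) * exp (Re t + 5 / K)"
    by (simp only: \<zeta>_def)
qed

text \<open>
  The rescaled functions \<open>f (z + z t / a) / f z\<close>, multiplied by \<open>exp (- t)\<close>, are bounded by
  \<open>exp (6/K)\<close> on the unit disc and equal to 1 at the centre, so they tend to 1 as \<open>K\<close> grows. The rescaled functions
  themselves then tend to the exponential function together with their derivatives. The last inequality in the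
  conclusion expresses this at the level of the Schwarzian derivative, which is \<open>-1/2\<close> for the exponential function.
  At the same time \<open>|f z|\<close> is larger than a high power of \<open>a\<close>, and it is this that no algebraic equation between
  \<open>f\<close> and its Schwarzian derivative with a pole at infinity can tolerate.
\<close>

theorem exists_schwarzian_growth_point:
  fixes f :: "complex \<Rightarrow> complex" and N :: nat
  assumes r0: "r0 > 0" and hol: "f holomorphic_on {z. norm z > r0}"
    and nopoly: "\<And>C L r. \<exists>z. norm z \<ge> r \<and> norm z > r0 \<and> norm (f z) > C * norm z ^ L"
  obtains z a where "norm z \<ge> r" "norm z > r0" "a \<ge> real N" "a \<ge> 1" "a ^ N \<le> norm (f z)" "norm z ^ N \<le> norm (f z)"
    "deriv f z \<noteq> 0" "norm (schwarzian f z * (z / of_real a) ^ 2 + 1 / 2) < 1 / 4"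
proof -
  have "\<forall>n. \<exists>z \<rho> a. norm z \<ge> r \<and> norm z \<ge> 2 * (r0 + 1) \<and> norm z < \<rho> \<and>
    a = real (n + 4 + N) * norm z / (\<rho> - norm z) \<and> a \<ge> real (n + 4 + N) \<and> a ^ (n + 4 + N) \<le> norm (f z)
    \<and> norm z ^ N \<le> norm (f z) \<and>
    (\<forall>\<zeta>. norm \<zeta> \<ge> r0 + 1 \<longrightarrow> norm \<zeta> \<le> \<rho> \<longrightarrow>
        norm (f \<zeta>) * (\<rho> - norm \<zeta>) ^ (n + 4 + N) \<le> norm (f z) * (\<rho> - norm z) ^ (n + 4 + N))"
  proof
    fix n
    show "\<exists>z \<rho> a. norm z \<ge> r \<and> norm z \<ge> 2 * (r0 + 1) \<and> norm z < \<rho> \<and>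
      a = real (n + 4 + N) * norm z / (\<rho> - norm z) \<and> a \<ge> real (n + 4 + N) \<and> a ^ (n + 4 + N) \<le> norm (f z)
      \<and> norm z ^ N \<le> norm (f z) \<and>
      (\<forall>\<zeta>. norm \<zeta> \<ge> r0 + 1 \<longrightarrow> norm \<zeta> \<le> \<rho> \<longrightarrow>
          norm (f \<zeta>) * (\<rho> - norm \<zeta>) ^ (n + 4 + N) \<le> norm (f z) * (\<rho> - norm z) ^ (n + 4 + N))"
      by (rule exists_growth_point[OF r0 hol nopoly, of "n + 4 + N" r N]) (simp, blast)
  qed
  then obtain z \<rho> a where *: "\<And>n. norm (z n) \<ge> r" "\<And>n. norm (z n) \<ge> 2 * (r0 + 1)"
    "\<And>n. norm (z n) < \<rho> n"
    "\<And>n::nat. a n = real (n + 4 + N) * norm (z n) / (\<rho> n - norm (z n))"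
    "\<And>n. a n \<ge> real (n + 4 + N)" "\<And>n. a n ^ (n + 4 + N) \<le> norm (f (z n))"
    "\<And>n. norm (z n) ^ N \<le> norm (f (z n))"
    "\<And>n \<zeta>. norm \<zeta> \<ge> r0 + 1 \<Longrightarrow> norm \<zeta> \<le> \<rho> n \<Longrightarrow>
        norm (f \<zeta>) * (\<rho> n - norm \<zeta>) ^ (n + 4 + N) \<le> norm (f (z n)) * (\<rho> n - norm (z n)) ^ (n + 4 + N)"
    unfolding choice_iff by blast
  have a1: "a n \<ge> 4" for n using *(5)[of n] by simp
  have fpos: "norm (f (z n)) > 0" for n
    using *(6)[of n] a1[of n] by (smt (verit) zero_less_power)
  define g where "g = (\<lambda>n t. f (z n / of_real (a n) * t + z n) / f (z n))"
  \<comment> \<open>The exponent 6 instead of 5 makes the bound strict.\<close>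
  define M where "M = (\<lambda>n::nat. exp (6 / real (n + 4 + N)))"
  have in_dom: "norm (z n / of_real (a n) * t + z n) > r0" 
    and bound: "norm (f (z n / of_real (a n) * t + z n)) \<le> norm (f (z n)) * exp (Re t + 5 / real (n + 4 + N))"
    if "norm t < 1" for n t
  proof -
    have K4: "n + 4 + N \<ge> 4" by simp
    note b = growth_point_rescaled_bound[OF K4 *(3)[of n] *(2)[of n] r0 *(4,5)[of n] *(8)[of _ n] that]
    show "norm (z n / of_real (a n) * t + z n) > r0" using b(1) by (simp add: add.commute)
    show "norm (f (z n / of_real (a n) * t + z n)) \<le> norm (f (z n)) * exp (Re t + 5 / real (n + 4 + N))"
      using b(2) by (simp add: add.commute)
  qed
  have ghol: "g n holomorphic_on ball 0 1" for n
  proof -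
    have "(f \<circ> (\<lambda>t. z n / of_real (a n) * t + z n)) holomorphic_on ball 0 1"
      by (rule holomorphic_on_compose_gen[OF _ hol]) (use in_dom[of _ n] in \<open>auto intro!: holomorphic_intros\<close>)
    thus ?thesis unfolding g_def o_def using fpos[of n] by (intro holomorphic_intros) auto
  qed
  have g_close: "norm (g n t - exp t) \<le> exp 1 * (M n - 1 / M n)" if "norm t \<le> 1 / 2" for n t
  proof -
    have "norm (g n t * exp (- t) - 1) \<le> M n - 1 / M n"
    proof (rule holomorphic_near_one[OF _ _ _ that])
      show "(\<lambda>t. g n t * exp (- t)) holomorphic_on ball 0 1"
        using ghol by (intro holomorphic_intros)
      show "g n 0 * exp (- 0) = 1" using fpos[of n] by (auto simp: g_def)
      show "norm (g n t * exp (- t)) < M n" if "norm t < 1" for t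
      proof -
        have "norm (g n t) \<le> exp (Re t + 5 / real (n + 4 + N))"
          using bound[OF that, of n] fpos[of n] by (simp add: g_def norm_divide field_simps)
        hence "norm (g n t) * exp (- Re t) \<le> exp (Re t + 5 / real (n + 4 + N)) * exp (- Re t)"
          by (intro mult_right_mono) auto
        also have "\<dots> = exp (5 / real (n + 4 + N))" by (simp flip: exp_add)
        also have "\<dots> < M n" unfolding M_def exp_less_cancel_iff by (intro divide_strict_right_mono) auto
        finally show ?thesis by (simp add: norm_mult)
      qed
    qed
    moreover have "g n t - exp t = exp t * (g n t * exp (- t) - 1)"
      by (simp add: algebra_simps flip: exp_add)
    moreover have "norm (exp t) \<le> exp 1"
      using that abs_Re_le_cmod[of t] by simp
    ultimately show ?thesis by (simp only: norm_mult) (intro mult_mono, auto)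
  qed
  have Mlim: "(\<lambda>n. exp 1 * (M n - 1 / M n)) \<longlonglongrightarrow> 0"
  proof -
    have "(\<lambda>n. 6 / real (n + 4 + N)) \<longlonglongrightarrow> 0"
      by (intro real_tendsto_divide_at_top[OF tendsto_const])
         (rule filterlim_at_top_mono[OF filterlim_real_sequentially], simp)
    hence "M \<longlonglongrightarrow> exp 0" unfolding M_def by (rule tendsto_exp)
    hence M1: "M \<longlonglongrightarrow> 1" by simp
    have "(\<lambda>n. exp 1 * (M n - 1 / M n)) \<longlonglongrightarrow> exp 1 * (1 - 1 / 1)"
      by (intro tendsto_intros M1) auto
    thus ?thesis by simp
  qed
  have ulim: "uniform_limit (ball 0 (1/2)) g exp sequentially"
  proof (rule uniform_limitI)
    fix e :: real assume "e > 0"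
    have "\<forall>\<^sub>F n in sequentially. exp 1 * (M n - 1 / M n) < e"
      using order_tendstoD(2)[OF Mlim \<open>e > 0\<close>] .
    thus "\<forall>\<^sub>F n in sequentially. \<forall>x\<in>ball 0 (1/2). dist (g n x) (exp x) < e"
    proof eventually_elim
      case (elim n)
      show ?case
      proof
        fix x :: complex assume "x \<in> ball 0 (1/2)"
        hence "norm x \<le> 1 / 2" by simp
        from g_close[OF this, of n] elim show "dist (g n x) (exp x) < e"
          by (simp add: dist_norm)
      qed
    qed
  qed
  have derivs: "(\<lambda>n. (deriv ^^ m) (g n) 0) \<longlonglongrightarrow> 1" for m
  proof -
    have "(\<lambda>n. (deriv ^^ m) (g n) 0) \<longlonglongrightarrow> (deriv ^^ m) exp 0"
    proof (rule higher_deriv_complex_uniform_limit[OF ulim])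
      show "\<forall>\<^sub>F n in sequentially. g n holomorphic_on ball 0 (1/2)"
        by (intro always_eventually allI holomorphic_on_subset[OF ghol]) auto
    qed auto
    moreover have "(deriv ^^ m) exp = (exp :: complex \<Rightarrow> complex)"
    proof (induction m)
      case (Suc m)
      have "deriv exp = (exp :: complex \<Rightarrow> complex)"
        by (rule ext, rule DERIV_imp_deriv) (rule DERIV_exp)
      thus ?case using Suc by simp
    qed auto
    ultimately show ?thesis by simp
  qed
  have g_an: "g n analytic_on {0}" for n
    using ghol[of n] by (simp add: analytic_on_open analytic_at_ball) (metis analytic_at open_ball centre_in_ball zero_less_one)
  have lim: "(\<lambda>n. (deriv ^^ 3) (g n) 0 / (deriv ^^ 1) (g n) 0
      - 3 / 2 * ((deriv ^^ 2) (g n) 0 / (deriv ^^ 1) (g n) 0) ^ 2) \<longlonglongrightarrow> 1 / 1 - 3 / 2 * (1 / 1) ^ 2"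
    by (intro tendsto_intros derivs) auto
  have "\<forall>\<^sub>F n in sequentially. (deriv ^^ 1) (g n) 0 \<noteq> 0"
    using tendsto_imp_eventually_ne[OF derivs[of 1]] by simp
  moreover have "\<forall>\<^sub>F n in sequentially. dist ((deriv ^^ 3) (g n) 0 / (deriv ^^ 1) (g n) 0
      - 3 / 2 * ((deriv ^^ 2) (g n) 0 / (deriv ^^ 1) (g n) 0) ^ 2) (1 / 1 - 3 / 2 * (1 / 1) ^ 2) < 1 / 4"
    using tendstoD[OF lim, of "1/4"] by simp
  ultimately have "\<forall>\<^sub>F n in sequentially. deriv (g n) 0 \<noteq> 0 \<and> dist (schwarzian (g n) 0) (- 1 / 2) < 1 / 4"
    by eventually_elim (simp add: schwarzian_eq_third_deriv[OF g_an])
  then obtain n where n: "deriv (g n) 0 \<noteq> 0" "dist (schwarzian (g n) 0) (- 1 / 2) < 1 / 4"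
    by (metis (mono_tags, lifting) eventually_happens sequentially_bot)
  define b where "b = z n / of_real (a n)"
  have fan: "f analytic_on {b * 0 + z n}"
  proof -
    have "open {z::complex. norm z > r0}" by (intro open_Collect_less continuous_intros)
    moreover have "norm (z n) > r0" using *(2)[of n] r0 by simp
    ultimately show ?thesis using hol by (simp add: analytic_at) blast
  qed
  have "z n \<noteq> 0" using *(2)[of n] r0 by auto
  hence b0: "b \<noteq> 0" using a1[of n] by (simp add: b_def)
  have "g n = (\<lambda>t. (1 * f (b * t + z n) + 0) / (0 * f (b * t + z n) + f (z n)))" by (simp add: g_def b_def)
  have an2: "(\<lambda>t. f (b * t + z n)) analytic_on {0}"
  proof -
    have "(\<lambda>t. b * t + z n) analytic_on {0}" by (intro analytic_intros)
    thus ?thesis using analytic_on_compose[of "\<lambda>t. b * t + z n" "{0}" f] fan by (simp add: o_def)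
  qed
  have dg: "deriv (\<lambda>t. f (b * t + z n)) 0 = deriv f (z n) * b"
  proof (rule DERIV_imp_deriv, rule DERIV_chain2[where f = f and g = "\<lambda>t. b * t + z n"])
    show "(f has_field_derivative deriv f (z n)) (at (b * 0 + z n))"
      using analytic_at_has_deriv[OF fan] by simp
    show "((\<lambda>t. b * t + z n) has_field_derivative b) (at 0)"
      by (auto intro!: derivative_eq_intros)
  qed
  have "((\<lambda>t. f (b * t + z n) / f (z n)) has_field_derivative deriv f (z n) * b / f (z n)) (at 0)"
    using analytic_at_has_deriv[OF an2] unfolding dg by (rule DERIV_cdivide)
  hence "deriv (g n) 0 = deriv f (z n) * b / f (z n)"
    by (simp add: g_def b_def DERIV_imp_deriv)
  hence df: "deriv f (z n) \<noteq> 0" using n(1) by auto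
  have "schwarzian (g n) 0 = schwarzian (\<lambda>t. (1 * f (b * t + z n) + 0) / (0 * f (b * t + z n) + f (z n))) 0"
    by (simp add: g_def b_def)
  also have "\<dots> = schwarzian (\<lambda>t. f (b * t + z n)) 0"
    by (rule schwarzian_moebius_compose[OF an2]) (use df b0 fpos[of n] dg in auto)
  also have "\<dots> = b ^ 2 * schwarzian f (b * 0 + z n)"
    by (rule schwarzian_affine_inner[OF fan]) (use df b0 in auto)
  finally have "norm (schwarzian f (z n) * (z n / of_real (a n)) ^ 2 + 1 / 2) < 1 / 4"
    using n(2) by (simp add: dist_norm b_def mult.commute)
  moreover have "a n ^ N \<le> norm (f (z n))"
  proof -
    have "a n ^ N \<le> a n ^ (n + 4 + N)" using a1[of n] by (intro power_increasing) auto
    thus ?thesis using *(6)[of n] by linarith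
  qed
  ultimately show ?thesis
    using that[of "z n" "a n"] *(1,2,5,7)[of n] df r0 a1[of n] by simp
qed

section \<open>Meromorphic functions and Moebius transformations\<close>

lemma complex_poly_root_exists:
  fixes D :: "complex poly" assumes "degree D \<noteq> 0" obtains z where "poly D z = 0"
proof -
  have "coeff D (degree D) \<noteq> 0" using assms by (metis degree_0 leading_coeff_0_iff)
  hence ex: "coeff D 0 = 0 \<or> (\<exists>i\<in>{1..degree D}. coeff D i \<noteq> 0)"
    using assms by (intro disjI2 bexI[of _ "degree D"]) auto
  obtain z where "(\<Sum>i\<le>degree D. coeff D i * z ^ i) = 0"
    by (rule fundamental_theorem_of_algebra[OF ex])
  thus ?thesis using that[of z] by (simp add: poly_altdef)
qed

lemma finite_complex_roots:
  fixes K :: complex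
  assumes "p > 0" shows "finite {C. C ^ p = K}"
proof -
  have ne: "monom 1 p - [:K:] \<noteq> 0"
  proof
    assume "monom 1 p - [:K:] = 0"
    hence "coeff (monom 1 p - [:K:]) p = 0" by simp
    thus False using assms by (cases p) auto
  qed
  have "{C. C ^ p = K} = {C. poly (monom 1 p - [:K:]) C = 0}" by (auto simp: poly_monom)
  thus ?thesis using poly_roots_finite[OF ne] by simp
qed

lemma cosparse_UNIV_iff: "(\<forall>\<^sub>\<approx>z. P z) \<longleftrightarrow> (\<forall>z::complex. \<forall>\<^sub>F w in at z. P w)"
  by (simp add: eventually_cosparse_open_eq)

lemma cosparse_eventually_nhds:
  fixes P :: "complex \<Rightarrow> bool"
  assumes "\<forall>\<^sub>\<approx>z. P z"
  shows "\<forall>\<^sub>\<approx>z. \<forall>\<^sub>F w in nhds z. P w"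
proof -
  have "closed {z. \<not> P z}"
    using assms by (simp add: eventually_cosparse sparse_in_UNIV_imp_closed)
  hence "open {z. P z}" by (simp add: closed_def Collect_neg_eq)
  hence "\<forall>\<^sub>F w in nhds z. P w" if "P z" for z
    using that eventually_nhds_in_open[of "{z. P z}" z] by simp
  thus ?thesis using assms by (auto elim: eventually_mono)
qed

lemma cosparse_ex:
  fixes P :: "complex \<Rightarrow> bool"
  assumes "\<forall>\<^sub>\<approx>z. P z" shows "\<exists>z. P z"
proof -
  have "cosparse (UNIV :: complex set) \<noteq> bot" by simp
  thus ?thesis using eventually_happens assms by blast
qed

lemma cosparse_not_in_finite:
  fixes A :: "complex set"
  assumes "finite A" shows "\<forall>\<^sub>\<approx>z. z \<notin> A"
  using assms by (simp add: eventually_cosparse finite_imp_sparse)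

lemma nicely_meromorphic_imp_meromorphic:
  "f nicely_meromorphic_on A \<Longrightarrow> f meromorphic_on A"
  by (simp add: nicely_meromorphic_on_def)

lemma nicely_meromorphic_pole_eq_0:
  "f nicely_meromorphic_on UNIV \<Longrightarrow> is_pole f z \<Longrightarrow> f z = 0"
  by (rule is_pole_zero_at_nicely_mero) auto

lemma nicely_meromorphic_analytic_at:
  "f nicely_meromorphic_on UNIV \<Longrightarrow> \<not> is_pole f z \<Longrightarrow> f analytic_on {z}"
  by (rule nicely_meromorphic_on_imp_analytic_at) auto

lemma nicely_meromorphic_eqI:
  assumes f: "f nicely_meromorphic_on UNIV" and g: "g nicely_meromorphic_on UNIV"
    and eq: "\<forall>\<^sub>\<approx>z. f z = g z"
  shows "f = g"
proof
  fix z
  have ev: "\<forall>\<^sub>F w in at z. f w = g w" using eq by (simp add: cosparse_UNIV_iff)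
  have pole: "is_pole f z \<longleftrightarrow> is_pole g z" by (rule is_pole_cong[OF ev refl])
  show "f z = g z"
  proof (cases "is_pole f z")
    case True
    thus ?thesis using pole nicely_meromorphic_pole_eq_0 f g by metis
  next
    case False
    have "f \<midarrow>z\<rightarrow> f z"
      using nicely_meromorphic_analytic_at[OF f False] analytic_at_imp_isCont isContD by blast
    moreover have "g \<midarrow>z\<rightarrow> g z"
      using nicely_meromorphic_analytic_at[OF g] False pole analytic_at_imp_isCont isContD by blast
    ultimately show ?thesis
      using tendsto_cong[OF ev] LIM_unique by blast
  qed
qed

lemma meromorphic_eq_cosparse:
  assumes "f meromorphic_on UNIV" "g meromorphic_on UNIV" "\<exists>\<^sub>F z in at z0. f z = g z"
  shows "\<forall>\<^sub>\<approx>z. f z = g z"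
proof -
  have "(\<lambda>z. f z - g z) meromorphic_on UNIV" by (intro meromorphic_intros assms)
  hence "(\<forall>\<^sub>\<approx>z. f z - g z = 0) \<or> (\<forall>\<^sub>\<approx>z. f z - g z \<noteq> 0)"
    by (rule meromorphic_imp_constant_or_avoid) auto
  moreover have "\<not> (\<forall>\<^sub>\<approx>z. f z - g z \<noteq> 0)"
    using assms(3) by (auto simp: cosparse_UNIV_iff frequently_def)
  ultimately show ?thesis by auto
qed

lemma nicely_meromorphic_avoid:
  assumes "f nicely_meromorphic_on UNIV" "\<not> f constant_on UNIV"
  shows "\<forall>\<^sub>\<approx>z. f z \<noteq> c"
  using nicely_meromorphic_imp_constant_or_avoid[OF assms(1), of c] assms(2)
  by (auto simp: constant_on_def)

lemma nonconst_deriv_nonzero: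
  assumes f: "f nicely_meromorphic_on UNIV" "\<not> f constant_on UNIV"
  shows "\<forall>\<^sub>\<approx>z. f analytic_on {z} \<and> deriv f z \<noteq> 0"
proof -
  have m: "f meromorphic_on UNIV" using f by (simp add: nicely_meromorphic_on_def)
  have an: "\<forall>\<^sub>\<approx>z. f analytic_on {z}" by (rule meromorphic_on_imp_analytic_cosparse[OF m])
  have "deriv f meromorphic_on UNIV" by (intro meromorphic_intros m)
  hence "(\<forall>\<^sub>\<approx>z. deriv f z = 0) \<or> (\<forall>\<^sub>\<approx>z. deriv f z \<noteq> 0)"
    by (rule meromorphic_imp_constant_or_avoid) auto
  moreover have "\<not> (\<forall>\<^sub>\<approx>z. deriv f z = 0)"
  proof
    assume "\<forall>\<^sub>\<approx>z. deriv f z = 0"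
    with an have "\<forall>\<^sub>\<approx>z. f analytic_on {z} \<and> deriv f z = 0" by eventually_elim auto
    from cosparse_ex[OF cosparse_eventually_nhds[OF this]]
    obtain z where "\<forall>\<^sub>F w in nhds z. f analytic_on {w} \<and> deriv f w = 0" by blast
    then obtain e where e: "e > 0" "\<And>w. w \<in> ball z e \<Longrightarrow> f analytic_on {w} \<and> deriv f w = 0"
      by (auto simp: eventually_nhds_metric dist_commute)
    have "\<exists>c. \<forall>x\<in>ball z e. f x = c"
      using has_field_derivative_zero_constant[of "ball z e" f] e
      by (metis analytic_at_has_deriv convex_ball has_field_derivative_at_within)
    then obtain c where c: "\<And>x. x \<in> ball z e \<Longrightarrow> f x = c" by blast
    have "\<forall>\<^sub>F w in at z. w \<in> ball z e" using e(1) by (intro eventually_at_in_open') auto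
    hence "\<forall>\<^sub>F w in at z. f w = c" by eventually_elim (rule c)
    hence "\<exists>\<^sub>F w in at z. f w = c" by (intro eventually_frequently) auto
    from frequently_eq_meromorphic_imp_constant[OF this f(1)] have "f constant_on UNIV"
      by (auto simp: constant_on_def)
    thus False using f(2) by simp
  qed
  ultimately have "\<forall>\<^sub>\<approx>z. deriv f z \<noteq> 0" by blast
  with an show ?thesis by eventually_elim auto
qed

lemma meromorphic_on_poly [meromorphic_intros]:
  assumes "f meromorphic_on A" shows "(\<lambda>z. poly p (f z)) meromorphic_on A"
proof (induction p)
  case (pCons a p)
  have "(\<lambda>z. a + f z * poly p (f z)) meromorphic_on A"
    by (intro meromorphic_intros assms pCons)
  thus ?case by simp
qed (auto intro: meromorphic_intros)

lemma analytic_on_poly_compose [analytic_intros]: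
  fixes f :: "complex \<Rightarrow> complex"
  assumes "f analytic_on A" shows "(\<lambda>z. poly p (f z)) analytic_on A"
proof (induction p)
  case (pCons a p)
  have "(\<lambda>z. a + f z * poly p (f z)) analytic_on A"
    by (intro analytic_intros assms pCons)
  thus ?case by simp
qed auto

lemma schwarzian_meromorphic [meromorphic_intros]:
  assumes "f meromorphic_on A" shows "schwarzian f meromorphic_on A"
proof -
  have "(\<lambda>z. deriv (preschwarzian f) z - 1 / 2 * preschwarzian f z ^ 2) meromorphic_on A"
    unfolding preschwarzian_def [abs_def] by (intro meromorphic_intros assms)
  thus ?thesis by (simp add: schwarzian_altdef [abs_def])
qed

lemma analytic_eventually_at_eq_0:
  fixes h :: "complex \<Rightarrow> complex"
  assumes "h analytic_on {z}" "\<forall>\<^sub>F w in at z. h w = 0"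
  shows "h z = 0"
proof -
  have "h \<midarrow>z\<rightarrow> h z" using assms(1) analytic_at_imp_isCont isContD by blast
  moreover have "h \<midarrow>z\<rightarrow> 0" using assms(2) by (rule tendsto_eventually)
  ultimately show ?thesis by (rule LIM_unique)
qed

text \<open>
  A solution satisfies the equation off a discrete set only; at points where both sides are analytic,
  continuity restores it.
\<close>

lemma schwarz_solution_pointwise:
  assumes sol: "\<forall>\<^sub>F w in at z. schwarzian f w ^ p = poly P (f w) / poly Q (f w)"
    and f: "f analytic_on {z}" "deriv f z \<noteq> 0" "poly Q (f z) \<noteq> 0"
  shows "schwarzian f z ^ p = poly P (f z) / poly Q (f z)"
proof -
  have "(\<lambda>w. schwarzian f w ^ p - poly P (f w) / poly Q (f w)) analytic_on {z}"
    by (intro analytic_intros schwarzian_analytic f) (use f in auto)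
  moreover have "\<forall>\<^sub>F w in at z. schwarzian f w ^ p - poly P (f w) / poly Q (f w) = 0"
    using sol by eventually_elim simp
  ultimately show ?thesis using analytic_eventually_at_eq_0 by fastforce
qed

lemma schwarz_solutionD:
  assumes "schwarz_solution p R f"
  shows "f nicely_meromorphic_on UNIV" "\<not> f constant_on UNIV"
    "\<forall>\<^sub>F w in at z. schwarzian f w ^ p = R (f w)"
  using assms by (auto simp: schwarz_solution_def cosparse_UNIV_iff)

lemma moebius_inverse:
  assumes "a * d - b * c \<noteq> 0"
  shows "moebius d (- b) (- c) a (moebius a b c d w) = w"
proof (cases w)
  case Infty
  thus ?thesis using assms by auto
next
  case (Fin x)
  show ?thesis
  proof (cases "c * x + d = 0")
    case True
    hence d: "d = - c * x" by (simp add: add_eq_0_iff2)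
    hence "c \<noteq> 0" using assms by auto
    thus ?thesis using d Fin by simp
  next
    case False
    have "- c * ((a * x + b) / (c * x + d)) + a = (a * d - b * c) / (c * x + d)"
      using False by (simp add: field_simps)
    moreover have "d * ((a * x + b) / (c * x + d)) - b = x * (a * d - b * c) / (c * x + d)"
      using False by (simp add: field_simps)
    ultimately show ?thesis using Fin False assms by simp
  qed
qed

lemma moebius_related_sym:
  assumes "moebius_related f (moebius a b c d) u" "a * d - b * c \<noteq> 0"
  shows "moebius_related u (moebius d (- b) (- c) a) f"
  using assms moebius_inverse[OF assms(2)] by (simp add: moebius_related_def)

lemma nicely_meromorphic_not_all_poles:
  assumes "f nicely_meromorphic_on UNIV" shows "\<exists>z. \<not> is_pole f z"
  using cosparse_ex[OF meromorphic_on_imp_not_pole_cosparse[OF nicely_meromorphic_imp_meromorphic[OF assms]]] .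

lemma moebius_related_constant:
  assumes "moebius_related f \<gamma> u" "f nicely_meromorphic_on UNIV" "u constant_on UNIV"
  shows "f constant_on UNIV"
proof -
  obtain k where k: "\<And>z. u z = k" using assms(3) by (auto simp: constant_on_def)
  hence "u = (\<lambda>_. k)" by auto
  hence np: "sphere_val u z = Fin k" for z by (simp add: sphere_val_def)
  obtain z0 where "\<not> is_pole f z0" using nicely_meromorphic_not_all_poles[OF assms(2)] by blast
  hence "sphere_val f z0 = Fin (f z0)" by (simp add: sphere_val_def)
  hence "\<gamma> (Fin k) = Fin (f z0)" using assms(1) np by (simp add: moebius_related_def)
  hence "f z = f z0" for z
    using assms(1) np[of z] by (auto simp: moebius_related_def sphere_val_def split: if_splits dest: spec[of _ z])
  thus ?thesis by (auto simp: constant_on_def)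
qed

lemma moebius_related_constant_iff:
  assumes "moebius_related f (moebius a b c d) u" "a * d - b * c \<noteq> 0"
    "f nicely_meromorphic_on UNIV" "u nicely_meromorphic_on UNIV"
  shows "f constant_on UNIV \<longleftrightarrow> u constant_on UNIV"
  using moebius_related_constant assms moebius_related_sym by blast

lemma moebius_denominator_avoid:
  assumes "u nicely_meromorphic_on UNIV" "\<not> u constant_on UNIV" "a * d - b * c \<noteq> 0"
  shows "\<forall>\<^sub>\<approx>z. c * u z + d \<noteq> (0::complex)"
proof (cases "c = 0")
  case True
  thus ?thesis using assms(3) by auto
next
  case False
  from nicely_meromorphic_avoid[OF assms(1,2), of "- d / c"] show ?thesis
    by eventually_elim (use False in \<open>auto simp: field_simps add_eq_0_iff\<close>)
qed

lemma moebius_related_formula: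
  assumes rel: "moebius_related f (moebius a b c d) u" "a * d - b * c \<noteq> 0"
    and u: "u nicely_meromorphic_on UNIV" "\<not> u constant_on UNIV"
  shows "\<forall>\<^sub>\<approx>z. c * u z + d \<noteq> 0 \<and> f z = (a * u z + b) / (c * u z + d)"
  using moebius_denominator_avoid[OF u rel(2)]
    meromorphic_on_imp_not_pole_cosparse[OF nicely_meromorphic_imp_meromorphic[OF u(1)]]
proof eventually_elim
  case (elim z)
  have "sphere_val f z = moebius a b c d (sphere_val u z)" using rel by (simp add: moebius_related_def)
  thus ?case using elim by (auto simp: sphere_val_def split: if_splits)
qed

text \<open>
  Moebius invariance of the Schwarzian derivative, in the form in which it applies to functions with poles.
\<close>

lemma moebius_related_schwarzian:
  assumes rel: "moebius_related f (moebius a b c d) u" "a * d - b * c \<noteq> 0"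
    and u: "u nicely_meromorphic_on UNIV" "\<not> u constant_on UNIV"
  shows "\<forall>\<^sub>\<approx>z. schwarzian f z = schwarzian u z"
  using cosparse_eventually_nhds[OF moebius_related_formula[OF assms]] nonconst_deriv_nonzero[OF u]
proof eventually_elim
  case (elim z)
  have "schwarzian f z = schwarzian (\<lambda>w. (a * u w + b) / (c * u w + d)) z"
    by (rule schwarzian_cong) (use elim(1) in \<open>auto elim: eventually_mono\<close>)
  also have "\<dots> = schwarzian u z"
    by (rule schwarzian_moebius_compose) (use elim(2) eventually_nhds_x_imp_x[OF elim(1)] rel(2) in auto)
  finally show ?case .
qed

definition moebius_image :: "complex \<Rightarrow> complex \<Rightarrow> complex \<Rightarrow> complex \<Rightarrow> (complex \<Rightarrow> complex) \<Rightarrow> complex \<Rightarrow> complex" where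
  "moebius_image a b c d f = remove_sings (\<lambda>z. (a * f z + b) / (c * f z + d))"

lemma moebius_image_nicely_meromorphic:
  assumes "f nicely_meromorphic_on UNIV"
  shows "moebius_image a b c d f nicely_meromorphic_on UNIV"
  unfolding moebius_image_def
  by (intro remove_sings_nicely_meromorphic meromorphic_intros nicely_meromorphic_imp_meromorphic[OF assms])

lemma moebius_image_related:
  assumes f: "f nicely_meromorphic_on UNIV" "\<not> f constant_on UNIV" and det: "a * d - b * c \<noteq> 0"
  shows "moebius_related (moebius_image a b c d f) (moebius a b c d) f"
  unfolding moebius_related_def
proof
  fix z
  define h where "h = (\<lambda>z. (a * f z + b) / (c * f z + d))"
  have hm: "h meromorphic_on UNIV"
    unfolding h_def by (intro meromorphic_intros nicely_meromorphic_imp_meromorphic[OF f(1)])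
  hence hm': "isolated_singularity_at h z" "not_essential h z"
    by (simp_all add: meromorphic_on_altdef)
  have img: "moebius_image a b c d f = remove_sings h" by (simp add: moebius_image_def h_def)
  have *: "sphere_val (remove_sings h) z = Fin x" if "h \<midarrow>z\<rightarrow> x" for x
  proof -
    have "\<not> is_pole h z" using that
      by (metis at_neq_bot is_pole_def not_tendsto_and_filterlim_at_infinity)
    thus ?thesis using that hm' by (simp add: sphere_val_def remove_sings_eqI is_pole_remove_sings_iff)
  qed
  have **: "sphere_val (remove_sings h) z = Infty" if "is_pole h z"
    using that hm' by (simp add: sphere_val_def is_pole_remove_sings_iff)
  show "sphere_val (moebius_image a b c d f) z = moebius a b c d (sphere_val f z)"
    unfolding img
  proof (cases "is_pole f z")
    case True
    have inf: "filterlim f at_infinity (at z)" using True by (simp add: is_pole_def)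
    have inv: "(\<lambda>w. inverse (f w)) \<midarrow>z\<rightarrow> 0"
      using inf by (rule filterlim_compose[OF tendsto_inverse_0])
    have nz: "\<forall>\<^sub>F w in at z. f w \<noteq> 0" using non_zero_neighbour_pole[OF True] .
    have ev: "\<forall>\<^sub>F w in at z. h w = (a + b * inverse (f w)) / (c + d * inverse (f w))"
      using nz
    proof eventually_elim
      case (elim w)
      have "h w = ((a * f w + b) * inverse (f w)) / ((c * f w + d) * inverse (f w))"
        using elim by (simp add: h_def)
      also have "(a * f w + b) * inverse (f w) = a + b * inverse (f w)"
        using elim by (simp add: algebra_simps)
      also have "(c * f w + d) * inverse (f w) = c + d * inverse (f w)"
        using elim by (simp add: algebra_simps)
      finally show ?case .
    qed
    show "sphere_val (remove_sings h) z = moebius a b c d (sphere_val f z)"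
    proof (cases "c = 0")
      case False
      have "(\<lambda>w. (a + b * inverse (f w)) / (c + d * inverse (f w))) \<midarrow>z\<rightarrow> (a + b * 0) / (c + d * 0)"
        by (intro tendsto_intros inv) (use False in auto)
      hence "h \<midarrow>z\<rightarrow> a / c" using tendsto_cong[OF ev] by simp
      from *[OF this] show ?thesis using True False by (simp add: sphere_val_def)
    next
      case c0: True
      hence ad: "a \<noteq> 0" "d \<noteq> 0" using det by auto
      have "is_pole (\<lambda>w. a / d * f w) z"
        using True ad by (subst is_pole_cmult_iff) auto
      hence "is_pole (\<lambda>w. a / d * f w + b / d) z"
        using is_pole_plus_const_iff[of "\<lambda>w. a / d * f w" z "b / d"] by simp
      also have "(\<lambda>w. a / d * f w + b / d) = h" using c0 by (auto simp: h_def add_divide_distrib)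
      finally have "sphere_val (remove_sings h) z = Infty" by (rule **)
      thus ?thesis using True c0 by (simp add: sphere_val_def)
    qed
  next
    case False
    have an: "f analytic_on {z}" using nicely_meromorphic_analytic_at[OF f(1) False] .
    hence lim: "f \<midarrow>z\<rightarrow> f z" using analytic_at_imp_isCont isContD by blast
    show "sphere_val (remove_sings h) z = moebius a b c d (sphere_val f z)"
    proof (cases "c * f z + d = 0")
      case nz: False
      have "h \<midarrow>z\<rightarrow> (a * f z + b) / (c * f z + d)"
        unfolding h_def by (intro tendsto_intros lim nz)
      from *[OF this] show ?thesis using False nz by (simp add: sphere_val_def)
    next
      case True
      have num: "a * f z + b \<noteq> 0"
      proof
        assume n: "a * f z + b = 0"
        have "(a * d - b * c) = a * (c * f z + d) - c * (a * f z + b)" by (simp add: algebra_simps)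
        thus False using n True det by simp
      qed
      have "\<forall>\<^sub>F w in at z. c * f w + d \<noteq> 0"
        using moebius_denominator_avoid[OF f det] by (simp add: cosparse_UNIV_iff)
      moreover have "(\<lambda>w. c * f w + d) \<midarrow>z\<rightarrow> c * f z + d" by (intro tendsto_intros lim)
      ultimately have "filterlim (\<lambda>w. c * f w + d) (at 0) (at z)"
        using True by (simp add: filterlim_at)
      moreover have "(\<lambda>w. a * f w + b) \<midarrow>z\<rightarrow> a * f z + b" by (intro tendsto_intros lim)
      ultimately have "is_pole h z"
        unfolding is_pole_def h_def using num by (intro filterlim_divide_at_infinity) auto
      from **[OF this] show ?thesis using False True by (simp add: sphere_val_def)
    qed
  qed
qed

section \<open>Solutions at a pole of the right-hand side\<close>

lemma analytic_local_factor:
  fixes f :: "complex \<Rightarrow> complex"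
  assumes f: "f analytic_on {0}" and nc: "\<not> (\<forall>\<^sub>F z in at 0. f z = f 0)"
  obtains m g where "m \<ge> 1" "g analytic_on {0}" "g 0 \<noteq> 0" "\<forall>\<^sub>F z in nhds 0. f z = f 0 + z ^ m * g z"
proof -
  obtain e where e: "e > 0" "f holomorphic_on ball 0 e"
    using f by (metis analytic_at_ball analytic_imp_holomorphic)
  define h where "h = (\<lambda>z. f z - f 0)"
  have hol: "h holomorphic_on ball 0 e" unfolding h_def by (intro holomorphic_intros e)
  have ex: "\<exists>w\<in>ball 0 e. h w \<noteq> 0"
  proof (rule ccontr)
    assume "\<not> ?thesis"
    hence *: "\<And>w. w \<in> ball 0 e \<Longrightarrow> f w = f 0" by (auto simp: h_def)
    have "\<forall>\<^sub>F z in at 0. z \<in> ball 0 e" using e(1) by (intro eventually_at_in_open') auto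
    hence "\<forall>\<^sub>F z in at 0. f z = f 0" by eventually_elim (rule *)
    thus False using nc by simp
  qed
  have h0: "h 0 = 0" and in0: "0 \<in> ball (0::complex) e" using e(1) by (auto simp: h_def)
  have nc': "\<not> h constant_on ball 0 e"
  proof
    assume "h constant_on ball 0 e"
    then obtain c where c: "\<And>w. w \<in> ball 0 e \<Longrightarrow> h w = c" unfolding constant_on_def by blast
    have "c = 0" using c[OF in0] h0 by simp
    thus False using c ex by simp
  qed
  obtain g r n where r: "0 < n" "0 < r" "ball (0::complex) r \<subseteq> ball 0 e" "g holomorphic_on ball 0 r"
    "\<And>w. w \<in> ball 0 r \<Longrightarrow> h w = (w - 0) ^ n * g w" "\<And>w. w \<in> ball 0 r \<Longrightarrow> g w \<noteq> 0"
    by (rule holomorphic_factor_zero_nonconstant[OF hol open_ball connected_ball in0 h0 nc']) (rule that; assumption)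
  show ?thesis
  proof (rule that)
    show "n \<ge> 1" using r(1) by simp
    show "g analytic_on {0}" using r(2,4) by (simp add: analytic_at) (use centre_in_ball open_ball in blast)
    show "g 0 \<noteq> 0" using r(6)[of 0] r(2) by simp
    have "\<forall>\<^sub>F z in nhds 0. z \<in> ball 0 r" using r(2) by (intro eventually_nhds_in_open) auto
    thus "\<forall>\<^sub>F z in nhds 0. f z = f 0 + z ^ n * g z"
      by eventually_elim (use r(5) in \<open>simp add: h_def algebra_simps\<close>)
  qed
qed

lemma tendsto_at_0_of_analytic:
  fixes g :: "complex \<Rightarrow> complex"
  assumes "g analytic_on {0}" shows "(g \<longlongrightarrow> g 0) (at 0)"
  using analytic_at_imp_isCont[OF assms] by (simp add: isCont_def)

lemma eventually_eq_limits_eq: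
  fixes f g :: "complex \<Rightarrow> complex"
  assumes "\<forall>\<^sub>F z in at x. f z = g z" "(f \<longlongrightarrow> a) (at x)" "(g \<longlongrightarrow> b) (at x)"
  shows "a = b"
  using tendsto_cong[OF assms(1), of a] assms(2,3) LIM_unique by blast

lemma preschwarzian_local:
  assumes d: "\<forall>\<^sub>F z in nhds 0. deriv f z = z ^ e * u z" and u: "u analytic_on {0}" "u 0 \<noteq> 0"
  shows "\<forall>\<^sub>F z in at 0. preschwarzian f z = of_nat e / z + deriv u z / u z"
proof -
  have nz: "\<forall>\<^sub>F z in at 0. z \<noteq> (0::complex)" by (rule eventually_neq_at_within)
  have "\<forall>\<^sub>F z in nhds 0. u z \<noteq> 0" by (rule eventually_nhds_nonzero[OF u])
  hence uz: "\<forall>\<^sub>F z in at 0. u z \<noteq> 0" using eventually_nhds_conv_at by auto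
  have ua: "\<forall>\<^sub>F z in at 0. u analytic_on {z}"
    using eventually_analytic_nhds[OF u(1)] eventually_nhds_conv_at by auto
  have d1: "\<forall>\<^sub>F z in at 0. deriv f z = z ^ e * u z"
    using d eventually_nhds_conv_at by auto
  have d2: "\<forall>\<^sub>F z in at 0. deriv (deriv f) z = deriv (\<lambda>z. z ^ e * u z) z"
    using eventually_nhds_deriv_eq[OF d] eventually_nhds_conv_at by auto
  show ?thesis using nz uz ua d1 d2
  proof eventually_elim
    case (elim z)
    have "((\<lambda>z. z ^ e * u z) has_field_derivative (of_nat e * z ^ (e - 1)) * u z + z ^ e * deriv u z) (at z)"
      using analytic_at_has_deriv[OF elim(3)] by (auto intro!: derivative_eq_intros)
    hence "deriv (deriv f) z = (of_nat e * z ^ (e - 1)) * u z + z ^ e * deriv u z"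
      using elim(5) DERIV_imp_deriv by simp
    also have "of_nat e * z ^ (e - 1) = of_nat e * z ^ e / z"
      using elim(1) by (cases e) auto
    finally show ?case using elim(1,2,4)
      by (simp add: preschwarzian_def numeral_2_eq_2 field_simps)
  qed
qed

lemma eventually_at_imp_punctured_nhds:
  fixes a :: "'a :: t1_space"
  assumes "\<forall>\<^sub>F z in at a. P z"
  shows "\<forall>\<^sub>F z in at a. \<forall>\<^sub>F w in nhds z. P w"
proof -
  obtain S where S: "open S" "a \<in> S" "\<And>z. z \<in> S \<Longrightarrow> z \<noteq> a \<Longrightarrow> P z"
    using assms by (auto simp: eventually_at_topological)
  have "\<forall>\<^sub>F z in at a. z \<in> S - {a}" using S by (intro eventually_at_in_open) auto
  thus ?thesis
  proof eventually_elim
    case (elim z)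
    have "\<forall>\<^sub>F w in nhds z. w \<in> S - {a}" using S elim by (intro eventually_nhds_in_open) auto
    thus ?case by eventually_elim (use S in auto)
  qed
qed

lemma schwarzian_local:
  assumes d: "\<forall>\<^sub>F z in nhds 0. deriv f z = z ^ e * u z" and u: "u analytic_on {0}" "u 0 \<noteq> 0"
  defines "n \<equiv> (\<lambda>z. deriv u z / u z)"
  shows "\<forall>\<^sub>F z in at 0. schwarzian f z = - of_nat e / z ^ 2 + deriv n z - 1 / 2 * (of_nat e / z + n z) ^ 2"
proof -
  have na: "n analytic_on {0}" unfolding n_def by (intro analytic_intros analytic_deriv u)  (use u in auto)
  have na': "\<forall>\<^sub>F z in at 0. n analytic_on {z}"
    using eventually_analytic_nhds[OF na] eventually_nhds_conv_at by auto
  have ps: "\<forall>\<^sub>F z in at 0. preschwarzian f z = of_nat e / z + n z"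
    unfolding n_def by (rule preschwarzian_local[OF d u])
  show ?thesis using ps eventually_at_imp_punctured_nhds[OF ps] na' eventually_neq_at_within[of 0 0 UNIV]
  proof eventually_elim
    case (elim z)
    have "deriv (preschwarzian f) z = deriv (\<lambda>z. of_nat e / z + n z) z"
      by (rule deriv_cong_ev[OF elim(2) refl])
    also have "\<dots> = - of_nat e / z ^ 2 + deriv n z"
      by (rule DERIV_imp_deriv)
         (use analytic_at_has_deriv[OF elim(3)] elim(4) in \<open>auto intro!: derivative_eq_intros simp: power2_eq_square\<close>)
    finally show ?case by (simp add: schwarzian_altdef elim(1))
  qed
qed

text \<open>
  Here \<open>f''/f' = e/z + \<close> an analytic function, so the double pole of the Schwarzian derivative has
  coefficient \<open>- e - e\<^sup>2/2\<close>. For a point of multiplicity \<open>m = e + 1\<close> this is \<open>(1 - m\<^sup>2)/2\<close>.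
\<close>

lemma schwarzian_leading_coefficient:
  assumes d: "\<forall>\<^sub>F z in nhds 0. deriv f z = z ^ e * u z" and u: "u analytic_on {0}" "u 0 \<noteq> 0"
  shows "((\<lambda>z. z ^ 2 * schwarzian f z) \<longlongrightarrow> - (of_nat e * (of_nat e + 2)) / 2) (at 0)"
proof -
  define n where "n = (\<lambda>z. deriv u z / u z)"
  have na: "n analytic_on {0}" unfolding n_def by (intro analytic_intros analytic_deriv u)  (use u in auto)
  have lim: "((\<lambda>z. - of_nat e + z ^ 2 * deriv n z - 1 / 2 * (of_nat e + z * n z) ^ 2) \<longlongrightarrow>
      - of_nat e + 0 ^ 2 * deriv n 0 - 1 / 2 * (of_nat e + 0 * n 0) ^ 2) (at 0)"
    by (intro tendsto_intros tendsto_at_0_of_analytic na analytic_deriv)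
  have "\<forall>\<^sub>F z in at 0. z ^ 2 * schwarzian f z =
      - of_nat e + z ^ 2 * deriv n z - 1 / 2 * (of_nat e + z * n z) ^ 2"
    using schwarzian_local[OF d u] eventually_neq_at_within[of 0 0 UNIV]
  proof eventually_elim
    case (elim z)
    have "(of_nat e + z * n z) ^ 2 = z ^ 2 * (of_nat e / z + n z) ^ 2"
      using elim(2) by (simp add: field_simps power2_eq_square)
    moreover have "z ^ 2 * (- E / z ^ 2 + D - 1 / 2 * Y) = - E + z ^ 2 * D - 1 / 2 * (z ^ 2 * Y)" for E D Y
      using elim(2) by (simp add: field_simps)
    ultimately show ?case using elim unfolding n_def by simp
  qed
  note ev = this
  have *: "- E + 0 ^ 2 * deriv n 0 - 1 / 2 * (E + 0 * n 0) ^ 2 = - (E * (E + 2)) / 2" for E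
    by (simp add: power2_eq_square field_simps)
  show ?thesis using lim unfolding * tendsto_cong[OF ev] .
qed

lemma ramified_leading_coefficient_nonzero:
  assumes "m \<ge> 2"
  shows "- (of_nat (m - 1) * (of_nat (m - 1) + 2)) / 2 \<noteq> (0::complex)"
proof -
  have "of_nat (m - 1) * (of_nat (m - 1) + 2 :: complex) = of_nat ((m - 1) * (m - 1 + 2))"
    by (simp only: of_nat_mult of_nat_add of_nat_numeral)
  moreover have "(m - 1) * (m - 1 + 2) \<noteq> 0" using assms by simp
  ultimately show ?thesis
    by (metis divide_eq_0_iff neg_equal_0_iff_equal of_nat_eq_0_iff zero_neq_numeral)
qed

lemma deriv_local_form:
  assumes f: "\<forall>\<^sub>F z in nhds 0. f z = a + z ^ m * g z" and g: "g analytic_on {0}" and m: "m \<ge> 1"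
  shows "\<forall>\<^sub>F z in nhds 0. deriv f z = z ^ (m - 1) * (of_nat m * g z + z * deriv g z)"
  using eventually_nhds_deriv_eq[OF f] eventually_analytic_nhds[OF g]
proof eventually_elim
  case (elim z)
  have "((\<lambda>z. a + z ^ m * g z) has_field_derivative (of_nat m * z ^ (m - 1)) * g z + z ^ m * deriv g z) (at z)"
    using analytic_at_has_deriv[OF elim(2)] by (auto intro!: derivative_eq_intros)
  hence "deriv f z = (of_nat m * z ^ (m - 1)) * g z + z ^ m * deriv g z"
    using elim(1) DERIV_imp_deriv by simp
  also have "z ^ m = z ^ (m - 1) * z" using m by (cases m) auto
  finally show ?case by (simp add: algebra_simps)
qed

lemma poly_factor_at:
  fixes a x :: complex
  assumes Q: "Q = [:- a, 1:] ^ k * q"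
  shows "poly Q (a + x) = x ^ k * poly q (a + x)"
proof -
  have "- a + (a + x) = x" by simp
  thus ?thesis by (simp add: Q poly_power)
qed

text \<open>
  If \<open>f\<close> takes the value \<open>a\<close> with multiplicity \<open>m\<close>, then \<open>R(f)\<close> has a pole of order \<open>m k\<close>, while the \<open>p\<close>-th power of
  the Schwarzian derivative has a pole of order \<open>2 p\<close> if \<open>m \<ge> 2\<close> and none if \<open>m = 1\<close>. Comparing the leading
  coefficients restricts the leading coefficient \<open>g 0\<close> to the \<open>k\<close>-th roots of a constant that depends on the
  equation only.
\<close>

lemma ramification_at_pole:
  fixes f g :: "complex \<Rightarrow> complex"
  assumes Q: "Q = [:- a, 1:] ^ k * q" "poly q a \<noteq> 0" and P: "poly P a \<noteq> 0" and k: "k \<ge> 1" and p: "p \<ge> 1"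
    and f: "\<forall>\<^sub>F z in nhds 0. f z = a + z ^ m * g z" and g: "g analytic_on {0}" "g 0 \<noteq> 0" and m: "m \<ge> 1"
    and sol: "\<forall>\<^sub>F z in at 0. schwarzian f z ^ p = poly P (f z) / poly Q (f z)"
  shows "m * k = 2 * p" "m \<ge> 2"
    "g 0 ^ k * poly q a * (- (of_nat (m - 1) * (of_nat (m - 1) + 2)) / 2) ^ p = poly P a"
proof -
  define u where "u = (\<lambda>z. of_nat m * g z + z * deriv g z)"
  have u: "u analytic_on {0}" "u 0 \<noteq> 0"
    unfolding u_def using g m by (auto intro!: analytic_intros analytic_deriv)
  have d: "\<forall>\<^sub>F z in nhds 0. deriv f z = z ^ (m - 1) * u z"
    unfolding u_def by (rule deriv_local_form[OF f g(1) m])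
  define s0 :: complex where "s0 = - (of_nat (m - 1) * (of_nat (m - 1) + 2)) / 2"
  have s0: "((\<lambda>z. z ^ 2 * schwarzian f z) \<longlongrightarrow> s0) (at 0)"
    unfolding s0_def by (rule schwarzian_leading_coefficient[OF d u])
  define F where "F = (\<lambda>z. a + z ^ m * g z)"
  have Fa: "F analytic_on {0}" "F 0 = a" unfolding F_def using m g by (auto intro!: analytic_intros)
  have PF: "((\<lambda>z. poly P (F z)) \<longlongrightarrow> poly P a) (at 0)"
    using tendsto_at_0_of_analytic[OF analytic_on_poly_compose[OF Fa(1), of P]] Fa(2) by simp
  have qF: "((\<lambda>z. poly q (F z)) \<longlongrightarrow> poly q a) (at 0)"
    using tendsto_at_0_of_analytic[OF analytic_on_poly_compose[OF Fa(1), of q]] Fa(2) by simp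
  have gl: "(g \<longlongrightarrow> g 0) (at 0)" by (rule tendsto_at_0_of_analytic[OF g(1)])
  have fF: "\<forall>\<^sub>F z in at 0. f z = F z" using f unfolding F_def by (simp add: eventually_nhds_conv_at)
  have g_nz: "\<forall>\<^sub>F z in at 0. g z \<noteq> 0" 
    using eventually_nhds_nonzero[OF g] by (simp add: eventually_nhds_conv_at)
  have q_nz: "\<forall>\<^sub>F z in at 0. poly q (F z) \<noteq> 0"
    using tendsto_imp_eventually_ne[OF qF Q(2)] .
  have eq: "\<forall>\<^sub>F z in at 0. z ^ (m * k) * (g z ^ k * poly q (F z) * schwarzian f z ^ p) = poly P (F z)"
    using sol fF g_nz q_nz eventually_neq_at_within[of 0 0 UNIV]
  proof eventually_elim
    case (elim z)
    have "poly Q (F z) = z ^ (m * k) * (g z ^ k * poly q (F z))"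
      unfolding F_def poly_factor_at[OF Q(1)] by (simp add: power_mult_distrib power_mult)
    moreover have "z ^ (m * k) * (g z ^ k * poly q (F z)) \<noteq> 0" using elim by simp
    ultimately show ?case using elim by (simp add: field_simps)
  qed
  show m2: "m \<ge> 2"
  proof (rule ccontr)
    assume "\<not> m \<ge> 2"
    hence m1: "m = 1" using m by simp
    have fa: "f analytic_on {0}" using Fa(1) analytic_at_cong[OF f refl] by (simp add: F_def[abs_def])
    have "deriv f 0 \<noteq> 0" using eventually_nhds_x_imp_x[OF d] m1 u by simp
    hence Sl: "(schwarzian f \<longlongrightarrow> schwarzian f 0) (at 0)"
      using tendsto_at_0_of_analytic schwarzian_analytic fa by blast
    have "((\<lambda>z. z ^ (m * k) * (g z ^ k * poly q (F z) * schwarzian f z ^ p)) \<longlongrightarrow>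
        0 ^ (m * k) * (g 0 ^ k * poly q a * schwarzian f 0 ^ p)) (at 0)"
      by (intro tendsto_intros gl qF Sl)
    hence "((\<lambda>z. poly P (F z)) \<longlongrightarrow> 0 ^ (m * k) * (g 0 ^ k * poly q a * schwarzian f 0 ^ p)) (at 0)"
      using tendsto_cong[OF eq] by blast
    with PF have "poly P a = 0 ^ (m * k) * (g 0 ^ k * poly q a * schwarzian f 0 ^ p)"
      using LIM_unique by blast
    thus False using P m k by (simp add: power_0_left)
  qed
  have s0nz: "s0 \<noteq> 0" unfolding s0_def by (rule ramified_leading_coefficient_nonzero[OF m2])
  have lim: "((\<lambda>z. g z ^ k * poly q (F z) * (z ^ 2 * schwarzian f z) ^ p) \<longlongrightarrow> g 0 ^ k * poly q a * s0 ^ p) (at 0)"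
    by (intro tendsto_intros gl qF s0)
  have eq2: "\<forall>\<^sub>F z in at 0. z ^ (m * k) * (g z ^ k * poly q (F z) * (z ^ 2 * schwarzian f z) ^ p)
      = z ^ (2 * p) * poly P (F z)"
    using eq
  proof eventually_elim
    case (elim z)
    have "(z ^ 2 * schwarzian f z) ^ p = z ^ (2 * p) * schwarzian f z ^ p"
      by (simp only: power_mult_distrib power_mult)
    thus ?case unfolding elim[symmetric] by (simp only: mult_ac)
  qed
  have lnz: "g 0 ^ k * poly q a * s0 ^ p \<noteq> 0" using g Q s0nz by simp
  show mk: "m * k = 2 * p"
  proof (rule linorder_cases)
    assume lt: "m * k < 2 * p"
    have "\<forall>\<^sub>F z in at 0. g z ^ k * poly q (F z) * (z ^ 2 * schwarzian f z) ^ p = z ^ (2 * p - m * k) * poly P (F z)"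
      using eq2 eventually_neq_at_within[of 0 0 UNIV]
    proof eventually_elim
      case (elim z)
      have "z ^ (2 * p) = z ^ (m * k) * z ^ (2 * p - m * k)" using lt by (simp flip: power_add)
      thus ?case using elim by (simp add: mult.assoc)
    qed
    moreover note lim
    moreover have "((\<lambda>z. z ^ (2 * p - m * k) * poly P (F z)) \<longlongrightarrow> 0 ^ (2 * p - m * k) * poly P a) (at 0)"
      by (intro tendsto_intros PF)
    ultimately have "g 0 ^ k * poly q a * s0 ^ p = 0 ^ (2 * p - m * k) * poly P a"
      by (rule eventually_eq_limits_eq)
    thus ?thesis using lnz lt by (simp add: power_0_left)
  next
    assume gt: "m * k > 2 * p"
    have "\<forall>\<^sub>F z in at 0. z ^ (m * k - 2 * p) * (g z ^ k * poly q (F z) * (z ^ 2 * schwarzian f z) ^ p) = poly P (F z)"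
      using eq2 eventually_neq_at_within[of 0 0 UNIV]
    proof eventually_elim
      case (elim z)
      have "z ^ (m * k) = z ^ (2 * p) * z ^ (m * k - 2 * p)" using gt by (simp flip: power_add)
      thus ?case using elim by (simp add: mult.assoc)
    qed
    moreover have "((\<lambda>z. z ^ (m * k - 2 * p) * (g z ^ k * poly q (F z) * (z ^ 2 * schwarzian f z) ^ p)) \<longlongrightarrow>
        0 ^ (m * k - 2 * p) * (g 0 ^ k * poly q a * s0 ^ p)) (at 0)"
      by (intro tendsto_intros lim)
    moreover note PF
    ultimately have "0 ^ (m * k - 2 * p) * (g 0 ^ k * poly q a * s0 ^ p) = poly P a"
      by (rule eventually_eq_limits_eq)
    thus ?thesis using P gt by (simp add: power_0_left)
  qed
  have "\<forall>\<^sub>F z in at 0. g z ^ k * poly q (F z) * (z ^ 2 * schwarzian f z) ^ p = poly P (F z)"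
    using eq2 eventually_neq_at_within[of 0 0 UNIV] by eventually_elim (simp add: mk)
  from eventually_eq_limits_eq[OF this lim PF] have "g 0 ^ k * poly q a * s0 ^ p = poly P a" .
  thus "g 0 ^ k * poly q a * (- (of_nat (m - 1) * (of_nat (m - 1) + 2)) / 2) ^ p = poly P a"
    by (simp add: s0_def)
qed

section \<open>Rigidity of the ramified germs\<close>

text \<open>
  The difference of the two sides is \<open>(j + 1) (j\<^sup>2 - j + 1 - m\<^sup>2)\<close>, so equality would mean
  \<open>(2 m)\<^sup>2 - (2 j - 1)\<^sup>2 = 3\<close> and hence \<open>m = 1\<close>. This is the indicial equation of the linearised problem at a
  ramified point; the absence of admissible roots makes the germs rigid. The proof compares sizes.
\<close>

lemma resonance_impossible:
  fixes j m :: int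
  assumes "j \<ge> 1" "m \<ge> 2"
  shows "(j - m) * j * (m + j) \<noteq> (m - 1) * (m + 1)"
proof (cases "j \<le> m")
  case True
  have "(j - m) * (j * (m + j)) \<le> 0" using True assms by (intro mult_nonpos_nonneg) auto
  moreover have "(m - 1) * (m + 1) > 0" using assms by (intro mult_pos_pos) auto
  ultimately show ?thesis by (simp add: mult.assoc)
next
  case False
  have "(m - 1) * (m + 1) < (m + 1) * (m + 1)" using assms by (intro mult_strict_right_mono) auto
  also have "\<dots> \<le> j * (m + j)" using False assms by (intro mult_mono) auto
  also have "\<dots> \<le> (j - m) * (j * (m + j))"
  proof -
    have "1 * (j * (m + j)) \<le> (j - m) * (j * (m + j))"
      using False assms by (intro mult_right_mono) auto
    thus ?thesis by simp
  qed
  finally show ?thesis by (simp add: mult.assoc)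
qed

lemma poly_difference_factor:
  fixes f1 f2 :: "complex \<Rightarrow> complex"
  assumes "f1 analytic_on A" "f2 analytic_on A"
  shows "\<exists>s. s analytic_on A \<and> (\<forall>z. poly P (f2 z) - poly P (f1 z) = (f2 z - f1 z) * s z)"
proof (induction P)
  case 0
  show ?case by (intro exI[of _ "\<lambda>_. 0"]) auto
next
  case (pCons a P)
  then obtain s where s: "s analytic_on A" "\<And>z. poly P (f2 z) - poly P (f1 z) = (f2 z - f1 z) * s z" by blast
  show ?case
  proof (intro exI[of _ "\<lambda>z. poly P (f2 z) + f1 z * s z"] conjI allI)
    show "(\<lambda>z. poly P (f2 z) + f1 z * s z) analytic_on A" by (intro analytic_intros assms s)
    fix z
    have "poly (pCons a P) (f2 z) - poly (pCons a P) (f1 z)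
        = (f2 z - f1 z) * poly P (f2 z) + f1 z * (poly P (f2 z) - poly P (f1 z))"
      by (simp add: algebra_simps)
    thus "poly (pCons a P) (f2 z) - poly (pCons a P) (f1 z) = (f2 z - f1 z) * (poly P (f2 z) + f1 z * s z)"
      unfolding s(2) by (simp add: algebra_simps)
  qed
qed

lemma eventually_nhds_imp_at:
  fixes x :: complex
  shows "\<forall>\<^sub>F z in nhds x. P z \<Longrightarrow> \<forall>\<^sub>F z in at x. P z"
  by (simp add: eventually_nhds_conv_at)

text \<open>
  The linearisation of the Schwarzian derivative at a function with a critical point of order \<open>e\<close>.
  If the derivatives are \<open>z^e u\<^sub>1\<close> and \<open>z^e (u\<^sub>1 + z^j v)\<close>, then the logarithmic derivatives of these differ by
  \<open>z^(j - 1) k\<close> with \<open>k 0 = j v(0) / u\<^sub>1(0)\<close>; differentiating this and subtracting its product with the common term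
  \<open>e/z\<close> leaves the factor \<open>j - 1 - e\<close>.
\<close>

lemma schwarzian_difference_local:
  fixes f1 f2 u1 u2 v :: "complex \<Rightarrow> complex"
  assumes d1: "\<forall>\<^sub>F z in nhds 0. deriv f1 z = z ^ e * u1 z" and u1: "u1 analytic_on {0}" "u1 0 \<noteq> 0"
    and d2: "\<forall>\<^sub>F z in nhds 0. deriv f2 z = z ^ e * u2 z" and u2: "u2 analytic_on {0}" "u2 0 \<noteq> 0"
    and v: "v analytic_on {0}" and uv: "\<forall>\<^sub>F z in nhds 0. u2 z = u1 z + z ^ j * v z" and j: "j \<ge> 1"
  obtains \<kappa> where "(\<kappa> \<longlongrightarrow> (of_nat j - 1 - of_nat e) * (of_nat j * v 0 / u1 0)) (at 0)"
    "\<forall>\<^sub>F z in at 0. z ^ 2 * schwarzian f2 z - z ^ 2 * schwarzian f1 z = z ^ j * \<kappa> z"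
proof -
  have u20: "u2 0 = u1 0" using eventually_nhds_x_imp_x[OF uv] j by simp
  define n1 where "n1 = (\<lambda>z. deriv u1 z / u1 z)"
  define n2 where "n2 = (\<lambda>z. deriv u2 z / u2 z)"
  define k where "k = (\<lambda>z. ((of_nat j * v z + z * deriv v z) * u1 z - z * deriv u1 z * v z) / (u1 z * u2 z))"
  have an: "n1 analytic_on {0}" "n2 analytic_on {0}" "k analytic_on {0}"
    unfolding n1_def n2_def k_def using u1 u2 v by (auto intro!: analytic_intros analytic_deriv)
  have k0: "k 0 = of_nat j * v 0 / u1 0" using u1 u20 by (simp add: k_def)
  have \<theta>: "\<forall>\<^sub>F z in nhds 0. n2 z - n1 z = z ^ (j - 1) * k z"
    using uv eventually_nhds_deriv_eq[OF uv] eventually_nhds_nonzero[OF u1] eventually_nhds_nonzero[OF u2]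
      eventually_analytic_nhds[OF u1(1)] eventually_analytic_nhds[OF v]
  proof eventually_elim
    case (elim z)
    have "((\<lambda>z. u1 z + z ^ j * v z) has_field_derivative
        deriv u1 z + ((of_nat j * z ^ (j - 1)) * v z + z ^ j * deriv v z)) (at z)"
      using analytic_at_has_deriv[OF elim(5)] analytic_at_has_deriv[OF elim(6)]
      by (auto intro!: derivative_eq_intros)
    hence du: "deriv u2 z = deriv u1 z + ((of_nat j * z ^ (j - 1)) * v z + z ^ j * deriv v z)"
      using elim(2) DERIV_imp_deriv by simp
    have zj: "z ^ j = z ^ (j - 1) * z" using j by (cases j) auto
    have "n2 z - n1 z = (deriv u2 z * u1 z - deriv u1 z * u2 z) / (u1 z * u2 z)"
      unfolding n1_def n2_def using elim(3,4) by (simp add: field_simps)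
    also have "deriv u2 z * u1 z - deriv u1 z * u2 z =
        z ^ (j - 1) * ((of_nat j * v z + z * deriv v z) * u1 z - z * deriv u1 z * v z)"
      unfolding du unfolding elim(1) zj by (simp add: algebra_simps)
    finally show ?case by (simp add: k_def)
  qed
  define \<kappa> where "\<kappa> = (\<lambda>z. (of_nat j - 1 - of_nat e) * k z + z * deriv k z - 1 / 2 * z * (n1 z + n2 z) * k z)"
  show ?thesis
  proof (rule that)
    have "(\<kappa> \<longlongrightarrow> (of_nat j - 1 - of_nat e) * k 0 + 0 * deriv k 0 - 1 / 2 * 0 * (n1 0 + n2 0) * k 0) (at 0)"
      unfolding \<kappa>_def by (intro tendsto_intros tendsto_at_0_of_analytic an analytic_deriv)
    thus "(\<kappa> \<longlongrightarrow> (of_nat j - 1 - of_nat e) * (of_nat j * v 0 / u1 0)) (at 0)" by (simp add: k0)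
    show "\<forall>\<^sub>F z in at 0. z ^ 2 * schwarzian f2 z - z ^ 2 * schwarzian f1 z = z ^ j * \<kappa> z"
      using schwarzian_local[OF d1 u1] schwarzian_local[OF d2 u2] eventually_nhds_imp_at[OF \<theta>]
        eventually_nhds_imp_at[OF eventually_nhds_deriv_eq[OF \<theta>]] eventually_neq_at_within[of 0 0 UNIV]
        eventually_nhds_imp_at[OF eventually_analytic_nhds[OF an(1)]]
        eventually_nhds_imp_at[OF eventually_analytic_nhds[OF an(2)]]
        eventually_nhds_imp_at[OF eventually_analytic_nhds[OF an(3)]]
    proof eventually_elim
      case (elim z)
      have S1: "schwarzian f1 z = - of_nat e / z ^ 2 + deriv n1 z - 1 / 2 * (of_nat e / z + n1 z) ^ 2"
        using elim(1) by (simp add: n1_def)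
      have S2: "schwarzian f2 z = - of_nat e / z ^ 2 + deriv n2 z - 1 / 2 * (of_nat e / z + n2 z) ^ 2"
        using elim(2) by (simp add: n2_def)
      have "((\<lambda>z. z ^ (j - 1) * k z) has_field_derivative (of_nat (j - 1) * z ^ (j - 1 - 1)) * k z + z ^ (j - 1) * deriv k z) (at z)"
        using analytic_at_has_deriv[OF elim(8)] by (auto intro!: derivative_eq_intros)
      moreover have "((\<lambda>z. n2 z - n1 z) has_field_derivative (deriv n2 z - deriv n1 z)) (at z)"
        using analytic_at_has_deriv[OF elim(7)] analytic_at_has_deriv[OF elim(6)] by (rule DERIV_diff)
      ultimately have dd: "deriv n2 z - deriv n1 z = (of_nat (j - 1) * z ^ (j - 1 - 1)) * k z + z ^ (j - 1) * deriv k z"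
        using elim(4) DERIV_imp_deriv by metis
      have pw: "of_nat (j - 1) * z ^ (j - 1 - 1) * z = (of_nat j - 1) * z ^ (j - 1)"
      proof (cases "j - 1")
        case 0
        hence "j = 1" using j by simp
        thus ?thesis by simp
      next
        case (Suc i)
        hence "j = Suc (Suc i)" by simp
        thus ?thesis by simp
      qed
      have zj: "z ^ j = z * z ^ (j - 1)" using j by (cases j) auto
      define E where "E = (of_nat e :: complex)"
      define D where "D = deriv n2 z - deriv n1 z"
      have n2: "n2 z = n1 z + z ^ (j - 1) * k z" using elim(3) by (simp add: algebra_simps)
      have "z ^ 2 * schwarzian f2 z - z ^ 2 * schwarzian f1 z
        = z ^ 2 * (D - 1 / 2 * ((E / z + n2 z) ^ 2 - (E / z + n1 z) ^ 2))"
        unfolding S1 S2 D_def E_def by (simp add: algebra_simps)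
      also have "(E / z + n2 z) ^ 2 - (E / z + n1 z) ^ 2 = (n2 z - n1 z) * (2 * E / z + n1 z + n2 z)"
      proof -
        have "(y + b) ^ 2 - (y + a) ^ 2 = (b - a) * (2 * y + a + b)" for y a b :: complex
          by (simp add: power2_eq_square algebra_simps)
        from this[of "E / z"] show ?thesis by simp
      qed
      also have "\<dots> = (z ^ (j - 1) * k z) * (2 * E / z + n1 z + n2 z)" unfolding elim(3) ..
      also have "z ^ 2 * (D - 1 / 2 * ((z ^ (j - 1) * k z) * (2 * E / z + n1 z + n2 z)))
         = z * (z * D) - z * z ^ (j - 1) * (E * k z + 1 / 2 * z * (n1 z + n2 z) * k z)"
        using elim(5) by (simp add: field_simps power2_eq_square)
      also have "z * D = (of_nat (j - 1) * z ^ (j - 1 - 1) * z) * k z + z * z ^ (j - 1) * deriv k z"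
        unfolding D_def dd by (simp add: algebra_simps)
      also have "\<dots> = z ^ (j - 1) * ((of_nat j - 1) * k z + z * deriv k z)"
        unfolding pw by (simp add: algebra_simps)
      finally show ?case unfolding \<kappa>_def zj E_def by (simp add: algebra_simps)
    qed
  qed
qed

text \<open>
  The linearisation of the right-hand side at its pole. Changing \<open>g\<close> by \<open>z^j d\<close> changes \<open>a + z^m g\<close> only by
  terms of order \<open>m + j\<close>, so to order \<open>j\<close> only the factor \<open>g^(-k)\<close> coming from the pole is affected.
\<close>

lemma rational_difference_local:
  fixes g1 g2 d :: "complex \<Rightarrow> complex"
  assumes g: "g1 analytic_on {0}" "g2 analytic_on {0}" "d analytic_on {0}"
    and C: "g1 0 = C" "g2 0 = C" "C \<noteq> 0"
    and gd: "\<forall>\<^sub>F z in nhds 0. g2 z - g1 z = z ^ j * d z"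
    and q: "poly q a \<noteq> 0" and m: "m \<ge> 1" and k: "k \<ge> 1"
  obtains \<mu> where "(\<mu> \<longlongrightarrow> - (of_nat k * d 0 * (poly P a / (C ^ k * poly q a)) / C)) (at 0)"
    "\<forall>\<^sub>F z in at 0. poly P (a + z ^ m * g2 z) / (g2 z ^ k * poly q (a + z ^ m * g2 z))
       - poly P (a + z ^ m * g1 z) / (g1 z ^ k * poly q (a + z ^ m * g1 z)) = z ^ j * \<mu> z"
proof -
  define F1 where "F1 = (\<lambda>z. a + z ^ m * g1 z)"
  define F2 where "F2 = (\<lambda>z. a + z ^ m * g2 z)"
  have F: "F1 analytic_on {0}" "F2 analytic_on {0}" "F1 0 = a" "F2 0 = a"
    unfolding F1_def F2_def using g m by (auto intro!: analytic_intros)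
  obtain A where A: "A analytic_on {0}" "\<And>z. poly P (F2 z) - poly P (F1 z) = (F2 z - F1 z) * A z"
    using poly_difference_factor[OF F(1,2)] by blast
  obtain B where B: "B analytic_on {0}" "\<And>z. poly q (F2 z) - poly q (F1 z) = (F2 z - F1 z) * B z"
    using poly_difference_factor[OF F(1,2)] by blast
  define G where "G = (\<lambda>z. d z * (\<Sum>i<k. g1 z ^ (k - Suc i) * g2 z ^ i))"
  have Ga: "G analytic_on {0}" unfolding G_def by (intro analytic_intros g)
  have "(\<Sum>i<k. C ^ (k - Suc i) * C ^ i) = of_nat k * C ^ (k - 1)"
  proof -
    have "(\<Sum>i<k. C ^ (k - Suc i) * C ^ i) = (\<Sum>i<k. C ^ (k - 1))"
      by (intro sum.cong refl) (auto simp flip: power_add)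
    thus ?thesis by simp
  qed
  hence G0: "G 0 = d 0 * (of_nat k * C ^ (k - 1))" by (simp add: G_def C)
  define N where "N = (\<lambda>z. z ^ m * d z * A z * g1 z ^ k * poly q (F1 z)
      - poly P (F1 z) * (G z * poly q (F1 z) + g1 z ^ k * (z ^ m * d z * B z) + G z * (z ^ j * (z ^ m * d z * B z))))"
  define M where "M = (\<lambda>z. (g1 z ^ k * poly q (F1 z)) * (g2 z ^ k * poly q (F2 z)))"
  have NM: "N analytic_on {0}" "M analytic_on {0}"
    unfolding N_def M_def by (intro analytic_intros g F A(1) B(1) Ga)+
  have M0: "M 0 = (C ^ k * poly q a) * (C ^ k * poly q a)" by (simp add: M_def C F)
  have M0nz: "M 0 \<noteq> 0" using C q by (simp add: M0)
  have N0: "N 0 = - poly P a * (G 0 * poly q a)"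
    using m by (simp add: N_def F power_0_left)
  have pk: "C ^ k = C ^ (k - 1) * C" using k by (cases k) auto
  show ?thesis
  proof (rule that)
    have "((\<lambda>z. N z / M z) \<longlongrightarrow> N 0 / M 0) (at 0)"
      by (intro tendsto_intros tendsto_at_0_of_analytic NM M0nz)
    also have "N 0 / M 0 = - (of_nat k * d 0 * (poly P a / (C ^ k * poly q a)) / C)"
      unfolding N0 M0 G0 pk using C q by (simp add: field_simps)
    finally show "((\<lambda>z. N z / M z) \<longlongrightarrow> - (of_nat k * d 0 * (poly P a / (C ^ k * poly q a)) / C)) (at 0)" .
    have "\<forall>\<^sub>F z in nhds 0. M z \<noteq> 0" by (rule eventually_nhds_nonzero[OF NM(2) M0nz])
    hence "\<forall>\<^sub>F z in nhds 0. poly P (F2 z) / (g2 z ^ k * poly q (F2 z))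
       - poly P (F1 z) / (g1 z ^ k * poly q (F1 z)) = z ^ j * (N z / M z)"
      using gd
    proof eventually_elim
      case (elim z)
      have FF: "F2 z - F1 z = z ^ j * (z ^ m * d z)"
      proof -
        have "F2 z - F1 z = z ^ m * (g2 z - g1 z)" by (simp add: F1_def F2_def algebra_simps)
        thus ?thesis unfolding elim(2) by (simp add: algebra_simps)
      qed
      have P2: "poly P (F2 z) = poly P (F1 z) + z ^ j * (z ^ m * d z) * A z" using A(2)[of z] unfolding FF by (simp add: algebra_simps)
      have q2: "poly q (F2 z) = poly q (F1 z) + z ^ j * (z ^ m * d z) * B z" using B(2)[of z] unfolding FF by (simp add: algebra_simps)
      have "g2 z ^ k - g1 z ^ k = (g2 z - g1 z) * (\<Sum>i<k. g1 z ^ (k - Suc i) * g2 z ^ i)"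
        by (rule power_diff_sumr2)
      hence gk: "g2 z ^ k = g1 z ^ k + z ^ j * G z" unfolding elim(2) G_def by (simp add: algebra_simps)
      have nz: "g1 z ^ k * poly q (F1 z) \<noteq> 0" "g2 z ^ k * poly q (F2 z) \<noteq> 0"
        using elim(1) unfolding M_def by auto
      have "poly P (F2 z) / (g2 z ^ k * poly q (F2 z)) - poly P (F1 z) / (g1 z ^ k * poly q (F1 z))
        = (poly P (F2 z) * (g1 z ^ k * poly q (F1 z)) - poly P (F1 z) * (g2 z ^ k * poly q (F2 z))) / M z"
        unfolding M_def using nz by (simp add: diff_frac_eq mult.commute)
      also have "poly P (F2 z) * (g1 z ^ k * poly q (F1 z)) - poly P (F1 z) * (g2 z ^ k * poly q (F2 z)) = z ^ j * N z"
        unfolding P2 q2 gk N_def by (simp add: algebra_simps)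
      finally show ?case by simp
    qed
    thus "\<forall>\<^sub>F z in at 0. poly P (a + z ^ m * g2 z) / (g2 z ^ k * poly q (a + z ^ m * g2 z))
       - poly P (a + z ^ m * g1 z) / (g1 z ^ k * poly q (a + z ^ m * g1 z)) = z ^ j * (N z / M z)"
      unfolding F1_def F2_def by (rule eventually_nhds_imp_at)
  qed
qed

text \<open>
  Suppose that two germs with the same leading coefficient first differ at relative order \<open>j\<close>. The equation,
  linearised on both sides, equates two multiples of the first differing coefficient, and cancelling it leaves the
  equation \<open>(j - m) j (m + j) = (m - 1) (m + 1)\<close>, which has no solution with \<open>j \<ge> 1\<close> and \<open>m \<ge> 2\<close>. Thus a solution
  is determined near a ramified point by its leading coefficient there, although the equation has order three.
\<close>

lemma pole_germ_unique:
  fixes f1 f2 g1 g2 :: "complex \<Rightarrow> complex"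
  assumes Q: "Q = [:- a, 1:] ^ k * q" "poly q a \<noteq> 0" and P: "poly P a \<noteq> 0" and k: "k \<ge> 1" and p: "p \<ge> 1"
    and f1: "\<forall>\<^sub>F z in nhds 0. f1 z = a + z ^ m * g1 z" and g1: "g1 analytic_on {0}"
    and f2: "\<forall>\<^sub>F z in nhds 0. f2 z = a + z ^ m * g2 z" and g2: "g2 analytic_on {0}"
    and C: "g1 0 = C" "g2 0 = C" "C \<noteq> 0" and m: "m \<ge> 1"
    and sol1: "\<forall>\<^sub>F z in at 0. schwarzian f1 z ^ p = poly P (f1 z) / poly Q (f1 z)"
    and sol2: "\<forall>\<^sub>F z in at 0. schwarzian f2 z ^ p = poly P (f2 z) / poly Q (f2 z)"
  shows "\<forall>\<^sub>F z in nhds 0. f1 z = f2 z"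
proof (rule ccontr)
  assume neq: "\<not> (\<forall>\<^sub>F z in nhds 0. f1 z = f2 z)"
  have gnz: "g1 0 \<noteq> 0" "g2 0 \<noteq> 0" using C by auto
  note R1 = ramification_at_pole[OF Q P k p f1 g1 gnz(1) m sol1]
  note R2 = ramification_at_pole[OF Q P k p f2 g2 gnz(2) m sol2]
  define h where "h = (\<lambda>z. g2 z - g1 z)"
  have ha: "h analytic_on {0}" unfolding h_def by (intro analytic_intros g1 g2)
  have h0: "h 0 = 0" by (simp add: h_def C)
  have hn: "\<not> (\<forall>\<^sub>F z in at 0. h z = h 0)"
  proof
    assume "\<forall>\<^sub>F z in at 0. h z = h 0"
    hence "\<forall>\<^sub>F z in nhds 0. h z = 0" using h0 by (simp add: eventually_nhds_conv_at)
    with f1 f2 have "\<forall>\<^sub>F z in nhds 0. f1 z = f2 z" by eventually_elim (simp add: h_def)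
    thus False using neq by simp
  qed
  obtain j d where j: "j \<ge> 1" and d: "d analytic_on {0}" "d 0 \<noteq> 0"
    and hd: "\<forall>\<^sub>F z in nhds 0. h z = h 0 + z ^ j * d z"
    by (rule analytic_local_factor[OF ha hn])
  have gd: "\<forall>\<^sub>F z in nhds 0. g2 z - g1 z = z ^ j * d z"
    using hd by eventually_elim (simp add: h_def C)
  define e where "e = m - 1"
  have em: "of_nat e = (of_nat m :: complex) - 1" using m by (simp add: e_def of_nat_diff)
  define s0 :: complex where "s0 = - (of_nat e * (of_nat e + 2)) / 2"
  define u1 where "u1 = (\<lambda>z. of_nat m * g1 z + z * deriv g1 z)"
  define u2 where "u2 = (\<lambda>z. of_nat m * g2 z + z * deriv g2 z)"
  define v where "v = (\<lambda>z. of_nat (m + j) * d z + z * deriv d z)"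
  have ua: "u1 analytic_on {0}" "u2 analytic_on {0}" "v analytic_on {0}"
    unfolding u1_def u2_def v_def by (intro analytic_intros analytic_deriv g1 g2 d)+
  have u0: "u1 0 = of_nat m * C" "u2 0 = of_nat m * C" by (simp_all add: u1_def u2_def C)
  hence unz: "u1 0 \<noteq> 0" "u2 0 \<noteq> 0" using m C by auto
  have d1: "\<forall>\<^sub>F z in nhds 0. deriv f1 z = z ^ e * u1 z"
    unfolding e_def u1_def by (rule deriv_local_form[OF f1 g1 m])
  have d2: "\<forall>\<^sub>F z in nhds 0. deriv f2 z = z ^ e * u2 z"
    unfolding e_def u2_def by (rule deriv_local_form[OF f2 g2 m])
  have uv: "\<forall>\<^sub>F z in nhds 0. u2 z = u1 z + z ^ j * v z"
    using gd eventually_nhds_deriv_eq[OF gd] eventually_analytic_nhds[OF g1]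
      eventually_analytic_nhds[OF g2] eventually_analytic_nhds[OF d(1)]
  proof eventually_elim
    case (elim z)
    have "((\<lambda>z. z ^ j * d z) has_field_derivative (of_nat j * z ^ (j - 1)) * d z + z ^ j * deriv d z) (at z)"
      using analytic_at_has_deriv[OF elim(5)] by (auto intro!: derivative_eq_intros)
    moreover have "((\<lambda>z. g2 z - g1 z) has_field_derivative (deriv g2 z - deriv g1 z)) (at z)"
      using analytic_at_has_deriv[OF elim(4)] analytic_at_has_deriv[OF elim(3)] by (rule DERIV_diff)
    ultimately have dd: "deriv g2 z - deriv g1 z = (of_nat j * z ^ (j - 1)) * d z + z ^ j * deriv d z"
      using elim(2) DERIV_imp_deriv by metis
    have zj: "z * z ^ (j - 1) = z ^ j" using j by (cases j) auto
    have "u2 z - u1 z = of_nat m * (g2 z - g1 z) + z * (deriv g2 z - deriv g1 z)"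
      by (simp add: u1_def u2_def algebra_simps)
    also have "\<dots> = of_nat m * (z ^ j * d z) + (of_nat j * (z * z ^ (j - 1)) * d z + z * z ^ j * deriv d z)"
      unfolding dd elim(1) by (simp add: algebra_simps)
    also have "\<dots> = z ^ j * v z" unfolding zj v_def by (simp add: algebra_simps)
    finally show ?case by (simp add: algebra_simps)
  qed
  obtain \<kappa> where \<kappa>: "(\<kappa> \<longlongrightarrow> (of_nat j - 1 - of_nat e) * (of_nat j * v 0 / u1 0)) (at 0)"
    "\<forall>\<^sub>F z in at 0. z ^ 2 * schwarzian f2 z - z ^ 2 * schwarzian f1 z = z ^ j * \<kappa> z"
    by (rule schwarzian_difference_local[OF d1 ua(1) unz(1) d2 ua(2) unz(2) ua(3) uv j])
  obtain \<mu> where \<mu>: "(\<mu> \<longlongrightarrow> - (of_nat k * d 0 * (poly P a / (C ^ k * poly q a)) / C)) (at 0)"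
    "\<forall>\<^sub>F z in at 0. poly P (a + z ^ m * g2 z) / (g2 z ^ k * poly q (a + z ^ m * g2 z))
       - poly P (a + z ^ m * g1 z) / (g1 z ^ k * poly q (a + z ^ m * g1 z)) = z ^ j * \<mu> z"
    by (rule rational_difference_local[OF g1 g2 d(1) C gd Q(2) m k])
  have rhs: "\<forall>\<^sub>F z in at 0. (z ^ 2 * schwarzian f z) ^ p = poly P (a + z ^ m * g z) / (g z ^ k * poly q (a + z ^ m * g z))"
    if f: "\<forall>\<^sub>F z in nhds 0. f z = a + z ^ m * g z"
      and sol: "\<forall>\<^sub>F z in at 0. schwarzian f z ^ p = poly P (f z) / poly Q (f z)" for f g
    using eventually_nhds_imp_at[OF f] sol eventually_neq_at_within[of 0 0 UNIV]
  proof eventually_elim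
    case (elim z)
    have "poly Q (a + z ^ m * g z) = z ^ (m * k) * (g z ^ k * poly q (a + z ^ m * g z))"
      unfolding poly_factor_at[OF Q(1)] by (simp add: power_mult_distrib power_mult)
    moreover have "(z ^ 2 * schwarzian f z) ^ p = z ^ (m * k) * schwarzian f z ^ p"
      unfolding R1(1) by (simp only: power_mult_distrib power_mult)
    ultimately show ?case using elim by simp
  qed
  define X1 where "X1 = (\<lambda>z. z ^ 2 * schwarzian f1 z)"
  define X2 where "X2 = (\<lambda>z. z ^ 2 * schwarzian f2 z)"
  have X: "(X1 \<longlongrightarrow> s0) (at 0)" "(X2 \<longlongrightarrow> s0) (at 0)"
    unfolding X1_def X2_def s0_def
    by (rule schwarzian_leading_coefficient[OF d1 ua(1) unz(1)] schwarzian_leading_coefficient[OF d2 ua(2) unz(2)])+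
  define \<Sigma> where "\<Sigma> = (\<lambda>z. \<Sum>i<p. X1 z ^ (p - Suc i) * X2 z ^ i)"
  have "(\<Sigma> \<longlongrightarrow> (\<Sum>i<p. s0 ^ (p - Suc i) * s0 ^ i)) (at 0)"
    unfolding \<Sigma>_def by (intro tendsto_intros X)
  also have "(\<Sum>i<p. s0 ^ (p - Suc i) * s0 ^ i) = (\<Sum>i<p. s0 ^ (p - 1))"
    by (intro sum.cong refl) (auto simp flip: power_add)
  finally have \<Sigma>: "(\<Sigma> \<longlongrightarrow> of_nat p * s0 ^ (p - 1)) (at 0)" by simp
  have "\<forall>\<^sub>F z in at 0. \<kappa> z * \<Sigma> z = \<mu> z"
    using rhs[OF f1 sol1] rhs[OF f2 sol2] \<kappa>(2) \<mu>(2) eventually_neq_at_within[of 0 0 UNIV]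
  proof eventually_elim
    case (elim z)
    have "z ^ j * \<mu> z = X2 z ^ p - X1 z ^ p" using elim(1,2,4) by (simp add: X1_def X2_def)
    also have "\<dots> = (X2 z - X1 z) * \<Sigma> z" unfolding \<Sigma>_def by (rule power_diff_sumr2)
    also have "X2 z - X1 z = z ^ j * \<kappa> z" using elim(3) by (simp add: X1_def X2_def)
    finally show ?case using elim(5) by simp
  qed
  \<comment> \<open>The coefficients of \<open>z^j\<close> in the two linearisations are compared.\<close>
  from eventually_eq_limits_eq[OF this tendsto_mult[OF \<kappa>(1) \<Sigma>] \<mu>(1)]
  have E1: "(of_nat j - 1 - of_nat e) * (of_nat j * v 0 / u1 0) * (of_nat p * s0 ^ (p - 1))
      = - (of_nat k * d 0 * (poly P a / (C ^ k * poly q a)) / C)" .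
  have Ps: "poly P a / (C ^ k * poly q a) = s0 ^ p"
  proof -
    have "C ^ k * poly q a * s0 ^ p = poly P a" using R1(3) C(1) by (simp add: s0_def e_def)
    thus ?thesis using C Q by (simp add: field_simps)
  qed
  have s0nz: "s0 \<noteq> 0" using Ps P C Q p by (auto simp: power_0_left)
  have sp: "s0 ^ p = s0 ^ (p - 1) * s0" using p by (cases p) auto
  have mn: "of_nat m \<noteq> (0::complex)" using m by simp
  have "C * (((of_nat j - of_nat m) * of_nat j * of_nat (m + j) * of_nat p) * (d 0 * s0 ^ (p - 1)))
       = C * ((- (of_nat (m * k) * s0)) * (d 0 * s0 ^ (p - 1)))"
    using E1 C(3) mn unfolding Ps sp u0 v_def em by (simp add: field_simps)
  note cancel = this
  have "(of_nat j - of_nat m) * of_nat j * of_nat (m + j) * of_nat p = - (of_nat (m * k) * s0)"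
  proof -
    have "C * (A * (d 0 * s0 ^ (p - 1))) = C * (B * (d 0 * s0 ^ (p - 1))) \<Longrightarrow> A = B" for A B
      using d(2) s0nz C(3) by simp
    from this[OF cancel] show ?thesis .
  qed
  also have "\<dots> = of_nat p * (of_nat e * (of_nat e + 2))" unfolding R1(1) s0_def by simp
  finally have "((of_nat j - of_nat m) * of_nat j * of_nat (m + j)) * of_nat p = (of_nat e * (of_nat e + 2)) * (of_nat p :: complex)"
    by (simp add: mult.commute)
  hence "(of_nat j - of_nat m) * of_nat j * of_nat (m + j) = (of_nat e * (of_nat e + 2) :: complex)"
    using p by simp
  hence "of_int ((int j - int m) * int j * (int m + int j)) = (of_int ((int m - 1) * (int m + 1)) :: complex)"
    unfolding em by (simp add: algebra_simps)
  hence "(int j - int m) * int j * (int m + int j) = (int m - 1) * (int m + 1)"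
    by (simp only: of_int_eq_iff)
  thus False using resonance_impossible[of "int j" "int m"] j R1(2) by simp
qed

section \<open>Poles of the right-hand side are not exceptional\<close>

lemma poly_growth_bound:
  fixes p :: "complex poly"
  shows "\<exists>B N. B \<ge> 0 \<and> (\<forall>z. norm z \<ge> 1 \<longrightarrow> norm (poly p z) \<le> B * norm z ^ N)"
proof (induction p)
  case 0
  show ?case by (intro exI[of _ 0]) auto
next
  case (pCons a p)
  then obtain B N where BN: "B \<ge> 0" "\<And>z. norm z \<ge> 1 \<Longrightarrow> norm (poly p z) \<le> B * norm z ^ N" by blast
  show ?case
  proof (intro exI[of _ "norm a + B"] exI[of _ "Suc N"] conjI allI impI)
    fix z :: complex assume z: "norm z \<ge> 1"
    have "norm (poly (pCons a p) z) \<le> norm a + norm z * norm (poly p z)"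
      using norm_triangle_ineq[of a "z * poly p z"] by (simp add: norm_mult)
    also have "\<dots> \<le> norm a * norm z ^ Suc N + norm z * (B * norm z ^ N)"
    proof (intro add_mono mult_left_mono BN z)
      have "norm z ^ Suc N \<ge> 1" using z by (rule one_le_power)
      thus "norm a \<le> norm a * norm z ^ Suc N" by (simp add: mult_le_cancel_left1)
    qed auto
    finally show "norm (poly (pCons a p) z) \<le> (norm a + B) * norm z ^ Suc N" by (simp add: algebra_simps)
  qed (use BN in auto)
qed

lemma pole_cleared_by_power:
  assumes f: "f nicely_meromorphic_on UNIV" and s: "is_pole f s"
  shows "\<exists>n l. ((\<lambda>z. (z - s) ^ n * f z) \<longlongrightarrow> l) (at s)"
proof -
  have m: "f meromorphic_on UNIV" using f by (rule nicely_meromorphic_imp_meromorphic)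
  hence "isolated_singularity_at f s" "not_essential f s" by (simp_all add: meromorphic_on_altdef)
  moreover have "\<exists>\<^sub>F w in at s. f w \<noteq> 0"
    using non_zero_neighbour_pole[OF s] by (intro eventually_frequently) auto
  ultimately obtain r where r: "r > 0" "zor_poly f s holomorphic_on cball s r"
    "\<And>w. w \<in> cball s r - {s} \<Longrightarrow> f w = zor_poly f s w * (w - s) powi (zorder f s)"
    using zorder_exist[of f s] by blast
  define g where "g = zor_poly f s"
  define n where "n = nat (- zorder f s)"
  have g: "(g \<longlongrightarrow> g s) (at s)"
  proof -
    have "continuous_on (ball s r) g"
      unfolding g_def by (rule holomorphic_on_imp_continuous_on[OF holomorphic_on_subset[OF r(2)]]) auto
    hence "isCont g s" using r(1) by (simp add: continuous_on_eq_continuous_at)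
    thus ?thesis by (simp add: isCont_def)
  qed
  have "\<forall>\<^sub>F w in at s. w \<in> ball s r - {s}" using r(1) by (intro eventually_at_in_open) auto
  hence ev: "\<forall>\<^sub>F w in at s. (w - s) ^ n * f w = (w - s) ^ (nat (zorder f s)) * g w"
  proof eventually_elim
    case (elim w)
    have nz: "w - s \<noteq> 0" using elim by simp
    have "f w = g w * (w - s) powi (zorder f s)" using r(3)[of w] elim by (auto simp: g_def)
    moreover have "(w - s) ^ n * (w - s) powi (zorder f s) = (w - s) ^ (nat (zorder f s))"
    proof (cases "zorder f s \<ge> 0")
      case True
      thus ?thesis by (simp add: n_def power_int_def)
    next
      case False
      thus ?thesis using nz by (simp add: n_def power_int_def flip: power_mult_distrib)
    qed
    ultimately show ?case by (simp add: mult.left_commute mult.commute)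
  qed
  have "((\<lambda>w. (w - s) ^ (nat (zorder f s)) * g w) \<longlongrightarrow> (s - s) ^ (nat (zorder f s)) * g s) (at s)"
    by (intro tendsto_intros g)
  hence "((\<lambda>w. (w - s) ^ n * f w) \<longlongrightarrow> (s - s) ^ (nat (zorder f s)) * g s) (at s)"
    using tendsto_cong[OF ev] by simp
  thus ?thesis by blast
qed

lemma transcendental_nonconstant:
  assumes "transcendental f" shows "\<not> f constant_on UNIV"
proof
  assume "f constant_on UNIV"
  then obtain c where "\<And>z. f z = c" by (auto simp: constant_on_def)
  hence "\<forall>\<^sub>\<approx>z. f z = poly [:c:] z / poly 1 z" by simp
  thus False using assms unfolding transcendental_def by (metis one_neq_zero)
qed

lemma poly_roots_cosparse:
  assumes "(B :: complex poly) \<noteq> 0" shows "\<forall>\<^sub>\<approx>z. poly B z \<noteq> 0"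
  using cosparse_not_in_finite[OF poly_roots_finite[OF assms]] by simp

text \<open>
  A polynomial that clears the finitely many poles turns \<open>f\<close> into an entire function; if \<open>f\<close> were
  polynomially bounded, Liouville's theorem would make this a polynomial and \<open>f\<close> rational.
\<close>

lemma transcendental_not_polynomially_bounded:
  assumes f: "f nicely_meromorphic_on UNIV" and tr: "transcendental f" and fin: "finite {z. is_pole f z}"
  shows "\<exists>z. norm z \<ge> r \<and> norm (f z) > C * norm z ^ L"
proof (rule ccontr)
  assume "\<not> ?thesis"
  hence bd: "\<And>z. norm z \<ge> r \<Longrightarrow> norm (f z) \<le> C * norm z ^ L" by (meson not_le)
  have "\<forall>s\<in>{z. is_pole f z}. \<exists>n l. ((\<lambda>z. (z - s) ^ n * f z) \<longlongrightarrow> l) (at s)"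
    using pole_cleared_by_power[OF f] by blast
  from bchoice[OF this] obtain n
    where n: "\<And>s. is_pole f s \<Longrightarrow> \<exists>l. ((\<lambda>z. (z - s) ^ n s * f z) \<longlongrightarrow> l) (at s)" by auto
  \<comment> \<open>\<open>W\<close> clears all poles of \<open>f\<close>.\<close>
  define W where "W = (\<Prod>s\<in>{z. is_pole f z}. [:- s, 1:] ^ n s)"
  have W0: "W \<noteq> 0" using fin by (simp add: W_def)
  define k where "k = (\<lambda>z. poly W z * f z)"
  have km: "k meromorphic_on UNIV"
    unfolding k_def by (intro meromorphic_intros nicely_meromorphic_imp_meromorphic[OF f])
  have lim: "\<exists>l. (k \<longlongrightarrow> l) (at s)" for s
  proof (cases "is_pole f s")
    case False
    have "(\<lambda>z. poly W (id z) * f z) analytic_on {s}"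
      by (intro analytic_intros nicely_meromorphic_analytic_at[OF f False])
    hence "k analytic_on {s}" by (simp add: k_def)
    thus ?thesis using analytic_at_imp_isCont isContD by blast
  next
    case True
    define V where "V = (\<Prod>s'\<in>{z. is_pole f z} - {s}. [:- s', 1:] ^ n s')"
    have W: "W = [:- s, 1:] ^ n s * V"
      unfolding W_def V_def using fin True by (subst prod.remove[of _ s]) auto
    obtain l where l: "((\<lambda>z. (z - s) ^ n s * f z) \<longlongrightarrow> l) (at s)" using n[OF True] by blast
    have "((\<lambda>z. poly V z * ((z - s) ^ n s * f z)) \<longlongrightarrow> poly V s * l) (at s)"
      by (intro tendsto_intros l)
    also have "(\<lambda>z. poly V z * ((z - s) ^ n s * f z)) = k"
      by (auto simp: k_def W poly_power algebra_simps)
    finally show ?thesis by blast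
  qed
  define K where "K = remove_sings k"
  have Knm: "K nicely_meromorphic_on UNIV" unfolding K_def by (rule remove_sings_nicely_meromorphic[OF km])
  have Kk: "\<forall>\<^sub>\<approx>z. K z = k z" unfolding K_def by (rule eventually_remove_sings_eq[OF km])
  have "\<not> is_pole K s" for s
  proof -
    obtain l where l: "(k \<longlongrightarrow> l) (at s)" using lim by blast
    have "isolated_singularity_at k s" using km by (simp add: meromorphic_on_altdef)
    hence "(K \<longlongrightarrow> l) (at s)" unfolding K_def using l by (simp add: tendsto_remove_sings_iff)
    thus ?thesis by (metis at_neq_bot is_pole_def not_tendsto_and_filterlim_at_infinity)
  qed
  hence "K analytic_on UNIV" using Knm by (intro nicely_meromorphic_without_singularities) auto
  hence Khol: "K holomorphic_on UNIV" by (rule analytic_imp_holomorphic)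
  obtain B N where BN: "B \<ge> 0" "\<And>z. norm z \<ge> 1 \<Longrightarrow> norm (poly W z) \<le> B * norm z ^ N"
    using poly_growth_bound by blast
  obtain b where b: "\<And>z. z \<in> {z. is_pole f z} \<Longrightarrow> norm z \<le> b"
    using finite_imp_bounded[OF fin] by (auto simp: bounded_iff)
  define A where "A = max (max r 1) (b + 1)"
  have Kb: "norm (K z) \<le> (B * C) * norm z ^ (N + L)" if z: "A \<le> norm z" for z
  proof -
    have z': "norm z \<ge> r" "norm z \<ge> 1" "\<not> is_pole f z" using z b[of z] by (auto simp: A_def)
    have "(\<lambda>z. poly W (id z) * f z) analytic_on {z}"
      by (intro analytic_intros nicely_meromorphic_analytic_at[OF f z'(3)])
    hence "k analytic_on {z}" by (simp add: k_def)
    hence "K z = k z" by (simp add: K_def)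
    hence "norm (K z) = norm (poly W z) * norm (f z)" by (simp add: k_def norm_mult)
    also have "\<dots> \<le> (B * norm z ^ N) * (C * norm z ^ L)"
      using BN z' bd[OF z'(1)] by (intro mult_mono) auto
    finally show ?thesis by (simp add: power_add algebra_simps)
  qed
  define P where "P = (\<Sum>k\<le>N + L. monom ((deriv ^^ k) K 0 / fact k) k)"
  have KP: "K z = poly P z" for z
    using Liouville_polynomial[OF Khol Kb] by (simp add: P_def poly_sum poly_monom)
  have "\<forall>\<^sub>\<approx>z. f z = poly P z / poly W z"
    using Kk poly_roots_cosparse[OF W0]
    by eventually_elim (auto simp: KP k_def field_simps)
  thus False using tr W0 unfolding transcendental_def by blast
qed

lemma moebius_related_transcendental:
  assumes rel: "moebius_related h (moebius a b c d) f" "a * d - b * c \<noteq> 0"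
    and f: "f nicely_meromorphic_on UNIV" and h: "h nicely_meromorphic_on UNIV" and tr: "transcendental f"
  shows "transcendental h"
proof (rule ccontr)
  assume "\<not> transcendental h"
  then obtain A B where AB: "B \<noteq> 0" "\<forall>\<^sub>\<approx>z. h z = poly A z / poly B z"
    by (auto simp: transcendental_def)
  have nc: "\<not> h constant_on UNIV"
    using transcendental_nonconstant[OF tr] moebius_related_constant_iff[OF rel h f] by simp
  have det: "d * a - (- b) * (- c) \<noteq> 0" using rel(2) by (simp add: mult.commute)
  have "\<forall>\<^sub>\<approx>z. (- c) * h z + a \<noteq> 0 \<and> f z = (d * h z + (- b)) / ((- c) * h z + a)"
    by (rule moebius_related_formula[OF moebius_related_sym[OF rel] det h nc])
  hence *: "\<forall>\<^sub>\<approx>z. poly (smult a B - smult c A) z \<noteq> 0 \<and>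
      f z = poly (smult d A - smult b B) z / poly (smult a B - smult c A) z"
    using AB(2) poly_roots_cosparse[OF AB(1)]
  proof eventually_elim
    case (elim z)
    have "poly B z * ((- c) * h z + a) = poly (smult a B - smult c A) z"
      using elim by (simp add: field_simps)
    moreover have "poly B z * (d * h z + (- b)) = poly (smult d A - smult b B) z"
      using elim by (simp add: field_simps)
    moreover have "f z = (poly B z * (d * h z + (- b))) / (poly B z * ((- c) * h z + a))"
      using elim by simp
    ultimately show ?case using elim by (metis mult_eq_0_iff)
  qed
  obtain z where "poly (smult a B - smult c A) z \<noteq> 0" using cosparse_ex[OF *] by blast
  hence "smult a B - smult c A \<noteq> 0" by (metis poly_0)
  moreover have "\<forall>\<^sub>\<approx>z. f z = poly (smult d A - smult b B) z / poly (smult a B - smult c A) z"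
    using * by eventually_elim simp
  ultimately show False using tr unfolding transcendental_def by blast
qed

text \<open>
  At the points where \<open>f\<close> looks like an exponential function the Schwarzian derivative has modulus at
  most \<open>a\<^sup>2\<close>, while \<open>|f|\<close> is at least \<open>a^(2 p + 2)\<close>; so the \<open>p\<close>-th power of the Schwarzian derivative is too small to be
  comparable with \<open>f\<close>.
\<close>

theorem superlinear_rhs_impossible:
  assumes f: "f nicely_meromorphic_on UNIV" and tr: "transcendental f" and fin: "finite {z. is_pole f z}"
    and sol: "\<forall>\<^sub>\<approx>z. schwarzian f z ^ p = R (f z)"
    and R: "\<And>w. norm w \<ge> R0 \<Longrightarrow> R analytic_on {w} \<and> norm (R w) \<ge> c * norm w" and c: "c > 0"
  shows False
proof -
  obtain b where b: "\<And>z. z \<in> {z. is_pole f z} \<Longrightarrow> norm z \<le> b"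
    using finite_imp_bounded[OF fin] by (auto simp: bounded_iff)
  define r0 where "r0 = max b 1"
  have an: "f analytic_on {z}" if "norm z > r0" for z
    using nicely_meromorphic_analytic_at[OF f, of z] b[of z] that by (auto simp: r0_def)
  have hol: "f holomorphic_on {z. norm z > r0}"
    by (rule analytic_imp_holomorphic, subst analytic_on_analytic_at) (use an in auto)
  have nopoly: "\<exists>z. norm z \<ge> r \<and> norm z > r0 \<and> norm (f z) > C * norm z ^ L" for C L r
    using transcendental_not_polynomially_bounded[OF f tr fin, of "max r (r0 + 1)" C L] by auto
  obtain n where n: "1 / c < real n" using reals_Archimedean2 by blast
  \<comment> \<open>With this exponent \<open>|f z|\<close> exceeds \<open>a^(2 p)\<close> by the factor \<open>a\<^sup>2\<close>, and \<open>a \<ge> n\<close> makes \<open>c a\<^sup>2 > 1\<close>.\<close>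
  define N where "N = max n (2 * p + 2)"
  obtain z a where z: "norm z \<ge> max R0 1" "norm z > r0" "a \<ge> real N" "a \<ge> 1" "a ^ N \<le> norm (f z)"
    "norm z ^ N \<le> norm (f z)" "deriv f z \<noteq> 0"
    "norm (schwarzian f z * (z / of_real a) ^ 2 + 1 / 2) < 1 / 4"
    by (rule exists_schwarzian_growth_point[OF _ hol nopoly, of "max R0 1" N]) (auto simp: r0_def)
  have z1: "norm z \<ge> 1" using z by simp
  have "norm z ^ 1 \<le> norm z ^ N" using z1 by (intro power_increasing) (auto simp: N_def)
  hence fz: "norm (f z) \<ge> R0" using z(1,6) by simp
  have eq: "schwarzian f z ^ p = R (f z)"
  proof -
    have "(R \<circ> f) analytic_on {z}"
      by (rule analytic_on_compose[OF an[OF z(2)]]) (use R[OF fz] in simp)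
    hence "(\<lambda>w. schwarzian f w ^ p - R (f w)) analytic_on {z}"
      by (intro analytic_intros schwarzian_analytic an z) (simp add: o_def)
    moreover have "\<forall>\<^sub>F w in at z. schwarzian f w ^ p - R (f w) = 0"
      using sol by (simp add: cosparse_UNIV_iff)
    ultimately show ?thesis using analytic_eventually_at_eq_0 by fastforce
  qed
  have "norm (schwarzian f z * (z / of_real a) ^ 2) \<le> 1"
    using z(8) norm_triangle_ineq2[of "schwarzian f z * (z / of_real a) ^ 2" "- 1 / 2"] by simp
  hence "norm (schwarzian f z) * (norm z ^ 2 / a ^ 2) \<le> 1"
    using z(4) by (simp add: norm_mult norm_power norm_divide power_divide)
  hence "norm (schwarzian f z) * norm z ^ 2 \<le> a ^ 2" using z(4) by (simp add: field_simps)
  moreover have "norm (schwarzian f z) * 1 \<le> norm (schwarzian f z) * norm z ^ 2"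
    using z1 by (intro mult_left_mono one_le_power) auto
  ultimately have "norm (schwarzian f z) \<le> a ^ 2" by simp
  hence "norm (schwarzian f z) ^ p \<le> (a ^ 2) ^ p" by (intro power_mono) auto
  hence le: "norm (R (f z)) \<le> a ^ (2 * p)" using eq by (metis norm_power power_mult)
  have "c * a ^ (2 * p + 2) \<le> c * norm (f z)"
  proof -
    have "a ^ (2 * p + 2) \<le> a ^ N" using z(4) by (intro power_increasing) (auto simp: N_def)
    thus ?thesis using z(5) c by (intro mult_left_mono) auto
  qed
  also have "\<dots> \<le> a ^ (2 * p)" using R[OF fz] le by linarith
  finally have "(c * a ^ 2) * a ^ (2 * p) \<le> 1 * a ^ (2 * p)"
    by (simp add: power_add power2_eq_square mult_ac)
  moreover have "a ^ (2 * p) > 0" using z(4) by simp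
  ultimately have "c * a ^ 2 \<le> 1" by (simp only: mult_le_cancel_right)
  moreover have "a \<le> a ^ 2" using z(4) by (simp add: power2_eq_square mult_le_cancel_left1)
  moreover have "c * a > 1"
  proof -
    have "real n \<le> a" using z(3) unfolding N_def by linarith
    hence "c * a \<ge> c * real n" using c by (intro mult_left_mono) auto
    moreover have "c * real n > 1" using n c by (simp add: field_simps)
    ultimately show ?thesis by linarith
  qed
  ultimately show False using c by (smt (verit) mult_left_mono)
qed

text \<open>
  The same for a right-hand side with a pole of order \<open>k\<close> at infinity, described by the local parameter
  \<open>1/w\<close> in which \<open>h\<close> is analytic.
\<close>

lemma rhs_pole_at_infinity_impossible:
  assumes f: "f nicely_meromorphic_on UNIV" and tr: "transcendental f" and fin: "finite {z. is_pole f z}"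
    and sol: "\<forall>\<^sub>\<approx>z. schwarzian f z ^ p = f z ^ k * h (1 / f z)"
    and h: "h analytic_on {0}" "h 0 \<noteq> 0" and k: "k \<ge> 1"
  shows False
proof -
  have "((\<lambda>v. norm (h v)) \<longlongrightarrow> norm (h 0)) (nhds 0)"
    by (intro tendsto_norm analytic_at_tendsto_nhds h)
  hence "\<forall>\<^sub>F v in nhds 0. norm (h v) > norm (h 0) / 2"
    by (rule order_tendstoD) (use h in auto)
  hence "\<forall>\<^sub>F v in nhds 0. norm (h v) > norm (h 0) / 2 \<and> h analytic_on {v}"
    using eventually_analytic_nhds[OF h(1)] by eventually_elim auto
  then obtain \<delta> where \<delta>: "\<delta> > 0" "\<And>v. norm v < \<delta> \<Longrightarrow> norm (h v) > norm (h 0) / 2 \<and> h analytic_on {v}"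
    by (auto simp: eventually_nhds_metric dist_norm)
  define R0 where "R0 = max 1 (2 / \<delta>)"
  show False
  proof (rule superlinear_rhs_impossible[OF f tr fin, where R = "\<lambda>w. w ^ k * h (1 / w)"])
    show "\<forall>\<^sub>\<approx>z. schwarzian f z ^ p = f z ^ k * h (1 / f z)" by (rule sol)
    show "norm (h 0) / 2 > 0" using h by simp
    fix w :: complex assume w: "norm w \<ge> R0"
    have w1: "norm w \<ge> 1" "w \<noteq> 0" using w by (auto simp: R0_def)
    have "1 / norm w \<le> 1 / (2 / \<delta>)" using w \<delta>(1) w1 by (intro divide_left_mono) (auto simp: R0_def)
    hence v: "norm (1 / w) < \<delta>" using \<delta>(1) by (simp add: norm_divide)
    have "(\<lambda>w. 1 / w) analytic_on {w}" using w1 by (intro analytic_intros) auto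
    from analytic_on_compose[OF this, of h] \<delta>(2)[OF v] have "(\<lambda>w. h (1 / w)) analytic_on {w}"
      by (simp add: o_def)
    hence "(\<lambda>w. w ^ k * h (1 / w)) analytic_on {w}" by (intro analytic_intros)
    moreover have "norm (w ^ k * h (1 / w)) \<ge> norm (h 0) / 2 * norm w"
    proof -
      have "norm w ^ 1 \<le> norm w ^ k" using w1 k by (intro power_increasing) auto
      hence "norm w * (norm (h 0) / 2) \<le> norm w ^ k * norm (h (1 / w))"
        using \<delta>(2)[OF v] by (intro mult_mono) auto
      thus ?thesis by (simp add: norm_mult norm_power mult.commute)
    qed
    ultimately show "(\<lambda>w. w ^ k * h (1 / w)) analytic_on {w} \<and> norm (w ^ k * h (1 / w)) \<ge> norm (h 0) / 2 * norm w"
      by simp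
  qed
qed

lemma poly_eq_reflect:
  fixes P :: "complex poly"
  assumes "w \<noteq> 0" shows "poly P w = w ^ degree P * poly (reflect_poly P) (1 / w)"
  using poly_reflect_poly_nz[of "1 / w" P] assms by (simp add: field_simps)

lemma exceptional_infinity_degree_le:
  assumes sol: "schwarz_solution p (\<lambda>w. poly P w / poly Q w) f" and Q: "Q \<noteq> 0"
    and tr: "transcendental f" and fin: "finite {z. is_pole f z}"
  shows "degree P \<le> degree Q"
proof (rule ccontr)
  assume gt: "\<not> degree P \<le> degree Q"
  hence P: "P \<noteq> 0" by auto
  note S = schwarz_solutionD[OF sol]
  define h where "h = (\<lambda>v. poly (reflect_poly P) v / poly (reflect_poly Q) v)"
  have q0: "poly (reflect_poly Q) 0 \<noteq> 0" using Q by simp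
  have "(\<lambda>v. poly (reflect_poly P) (id v) / poly (reflect_poly Q) (id v)) analytic_on {0}"
    using q0 by (intro analytic_intros) auto
  hence h: "h analytic_on {0}" "h 0 \<noteq> 0" using P Q by (auto simp: h_def)
  have R: "poly P w / poly Q w = w ^ (degree P - degree Q) * h (1 / w)" if "w \<noteq> 0" for w
  proof -
    have "w ^ degree P = w ^ degree Q * w ^ (degree P - degree Q)" using gt by (simp flip: power_add)
    thus ?thesis using that unfolding h_def poly_eq_reflect[OF that, of P] poly_eq_reflect[OF that, of Q] by simp
  qed
  have "\<forall>\<^sub>\<approx>z. schwarzian f z ^ p = poly P (f z) / poly Q (f z)"
    using sol by (simp add: schwarz_solution_def)
  hence "\<forall>\<^sub>\<approx>z. schwarzian f z ^ p = f z ^ (degree P - degree Q) * h (1 / f z)"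
    using nicely_meromorphic_avoid[OF S(1,2), of 0] by eventually_elim (simp add: R)
  from rhs_pole_at_infinity_impossible[OF S(1) tr fin this h] gt show False by linarith
qed

lemma root_factorization:
  fixes Q :: "complex poly"
  assumes "Q \<noteq> 0" "poly Q a = 0"
  obtains k q where "k \<ge> 1" "Q = [:- a, 1:] ^ k * q" "poly q a \<noteq> 0"
proof -
  obtain q where q: "Q = [:- a, 1:] ^ order a Q * q" "\<not> [:- a, 1:] dvd q"
    using order_decomp[OF assms(1), of a] by blast
  moreover have "order a Q \<noteq> 0" using assms order_root by blast
  ultimately show ?thesis using that[of "order a Q" q] by (simp add: poly_eq_0_iff_dvd)
qed

lemma coprime_poly_root_nonzero:
  fixes P Q :: "complex poly"
  assumes "coprime P Q" "poly Q a = 0" shows "poly P a \<noteq> 0"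
  using assms by (metis coprime_poly_0)

text \<open>
  If a pole \<open>a\<close> of the right-hand side were attained only finitely often, then \<open>1/(f - a)\<close> would
  have finitely many poles and solve an equation whose right-hand side has a pole at infinity.
\<close>

lemma pole_value_attained_infinitely_often:
  assumes sol: "schwarz_solution p (\<lambda>w. poly P w / poly Q w) f" and Q: "Q \<noteq> 0" "poly Q a = 0"
    and cop: "coprime P Q" and tr: "transcendental f"
  shows "infinite {z. sphere_val f z = Fin a}"
proof
  assume fin: "finite {z. sphere_val f z = Fin a}"
  note S = schwarz_solutionD[OF sol]
  obtain k q where k: "k \<ge> 1" "Q = [:- a, 1:] ^ k * q" "poly q a \<noteq> 0" by (rule root_factorization[OF Q])
  have Pa: "poly P a \<noteq> 0" by (rule coprime_poly_root_nonzero[OF cop Q(2)])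
  define u where "u = moebius_image 0 1 1 (- a) f"
  have det: "0 * (- a) - 1 * 1 \<noteq> (0::complex)" by simp
  have u: "u nicely_meromorphic_on UNIV" unfolding u_def by (rule moebius_image_nicely_meromorphic[OF S(1)])
  have rel: "moebius_related u (moebius 0 1 1 (- a)) f"
    unfolding u_def by (rule moebius_image_related[OF S(1,2) det])
  have tu: "transcendental u" by (rule moebius_related_transcendental[OF rel det S(1) u tr])
  have "is_pole u z \<Longrightarrow> sphere_val f z = Fin a" for z
  proof -
    assume "is_pole u z"
    hence "sphere_val u z = Infty" by (simp add: sphere_val_def)
    hence "moebius 0 1 1 (- a) (sphere_val f z) = Infty" using rel by (simp add: moebius_related_def)
    thus "sphere_val f z = Fin a" by (cases "sphere_val f z") (auto split: if_splits simp: add_eq_0_iff)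
  qed
  hence finu: "finite {z. is_pole u z}" by (intro finite_subset[OF _ fin]) auto
  define h where "h = (\<lambda>v. poly P (a + v) / poly q (a + v))"
  have h: "h analytic_on {0}" "h 0 \<noteq> 0" unfolding h_def using k Pa by (auto intro!: analytic_intros)
  have "\<forall>\<^sub>\<approx>z. schwarzian f z ^ p = poly P (f z) / poly Q (f z)"
    using sol by (simp add: schwarz_solution_def)
  hence "\<forall>\<^sub>\<approx>z. schwarzian u z ^ p = u z ^ k * h (1 / u z)"
    using moebius_related_formula[OF rel det S(1,2)] moebius_related_schwarzian[OF rel det S(1,2)]
  proof eventually_elim
    case (elim z)
    have nz: "f z - a \<noteq> 0" and uz: "u z = 1 / (f z - a)" using elim(2) by simp_all
    have f: "f z = a + 1 / u z" using uz by simp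
    have "poly Q (f z) = (1 / u z) ^ k * poly q (a + 1 / u z)"
      unfolding f by (rule poly_factor_at[OF k(2)])
    hence "poly P (f z) / poly Q (f z) = u z ^ k * h (1 / u z)"
      using nz uz unfolding h_def f by (simp add: power_divide)
    thus ?case using elim by simp
  qed
  from rhs_pole_at_infinity_impossible[OF u tu finu this h k(1)] show False .
qed

section \<open>Rotations and periods of solutions\<close>

lemma nicely_meromorphic_affine:
  assumes f: "f nicely_meromorphic_on UNIV" and \<alpha>: "\<alpha> \<noteq> 0"
  shows "(\<lambda>z. f (\<alpha> * z + b)) nicely_meromorphic_on UNIV"
  unfolding nicely_meromorphic_on_def
proof (intro conjI ballI)
  have an: "(\<lambda>z. \<alpha> * z + b) analytic_on A" for A by (intro analytic_intros)
  show "(\<lambda>z. f (\<alpha> * z + b)) meromorphic_on UNIV"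
    by (rule meromorphic_on_compose[OF nicely_meromorphic_imp_meromorphic[OF f] an]) auto
  fix z
  show "is_pole (\<lambda>z. f (\<alpha> * z + b)) z \<and> f (\<alpha> * z + b) = 0 \<or> (\<lambda>z. f (\<alpha> * z + b)) \<midarrow>z\<rightarrow> f (\<alpha> * z + b)"
  proof (cases "is_pole f (\<alpha> * z + b)")
    case True
    have "filterlim (\<lambda>z. \<alpha> * z + b) (at (\<alpha> * z + b)) (at z)"
    proof (rule filterlim_atI)
      show "((\<lambda>z. \<alpha> * z + b) \<longlongrightarrow> \<alpha> * z + b) (at z)" by (intro tendsto_intros)
      show "\<forall>\<^sub>F x in at z. \<alpha> * x + b \<noteq> \<alpha> * z + b"
        using eventually_neq_at_within[of z z UNIV] by eventually_elim (use \<alpha> in auto)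
    qed
    hence "is_pole (\<lambda>z. f (\<alpha> * z + b)) z"
      using True unfolding is_pole_def by (rule filterlim_compose[rotated])
    thus ?thesis using nicely_meromorphic_pole_eq_0[OF f True] by simp
  next
    case False
    have "(f \<circ> (\<lambda>z. \<alpha> * z + b)) analytic_on {z}"
      by (rule analytic_on_compose[OF an]) (use nicely_meromorphic_analytic_at[OF f False] in simp)
    thus ?thesis using analytic_at_imp_isCont isContD unfolding o_def by blast
  qed
qed

lemma filterlim_affine_at:
  assumes "\<alpha> \<noteq> (0::complex)"
  shows "filterlim (\<lambda>z. \<alpha> * z + b) (at b) (at 0)"
proof (rule filterlim_atI)
  have "((\<lambda>z. \<alpha> * z + b) \<longlongrightarrow> \<alpha> * 0 + b) (at 0)" by (intro tendsto_intros)
  thus "((\<lambda>z. \<alpha> * z + b) \<longlongrightarrow> b) (at 0)" by simp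
  show "\<forall>\<^sub>F x in at 0. \<alpha> * x + b \<noteq> b"
    using eventually_neq_at_within[of 0 0 UNIV] by eventually_elim (use assms in auto)
qed

text \<open>
  The substitution multiplies the Schwarzian derivative by \<open>\<alpha>\<^sup>2\<close>, which its \<open>p\<close>-th power does not notice if
  \<open>\<alpha>^(2 p) = 1\<close>.
\<close>

lemma solution_affine_local:
  assumes sol: "schwarz_solution p R f" and \<alpha>: "\<alpha> ^ (2 * p) = 1" "\<alpha> \<noteq> 0"
  shows "\<forall>\<^sub>F z in at 0. schwarzian (\<lambda>z. f (\<alpha> * z + b)) z ^ p = R (f (\<alpha> * z + b))"
proof -
  note S = schwarz_solutionD[OF sol]
  have "\<forall>\<^sub>\<approx>z. schwarzian f z ^ p = R (f z)" using sol by (simp add: schwarz_solution_def)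
  hence "\<forall>\<^sub>\<approx>z. schwarzian f z ^ p = R (f z) \<and> f analytic_on {z} \<and> deriv f z \<noteq> 0"
    using nonconst_deriv_nonzero[OF S(1,2)] by eventually_elim auto
  hence "\<forall>\<^sub>F z in at b. schwarzian f z ^ p = R (f z) \<and> f analytic_on {z} \<and> deriv f z \<noteq> 0"
    by (simp add: cosparse_UNIV_iff)
  from eventually_compose_filterlim[OF this filterlim_affine_at[OF \<alpha>(2)]]
  show ?thesis
  proof eventually_elim
    case (elim z)
    have "schwarzian (\<lambda>z. f (\<alpha> * z + b)) z = \<alpha> ^ 2 * schwarzian f (\<alpha> * z + b)"
      by (rule schwarzian_affine_inner) (use elim \<alpha> in auto)
    hence "schwarzian (\<lambda>z. f (\<alpha> * z + b)) z ^ p = \<alpha> ^ (2 * p) * schwarzian f (\<alpha> * z + b) ^ p"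
      by (simp only: power_mult_distrib power_mult)
    thus ?case using elim \<alpha> by simp
  qed
qed

lemma nonconstant_germ:
  assumes f: "f nicely_meromorphic_on UNIV" "\<not> f constant_on UNIV"
  shows "\<not> (\<forall>\<^sub>F z in at 0. f (1 * z + z0) = f z0)"
proof
  assume eq: "\<forall>\<^sub>F z in at 0. f (1 * z + z0) = f z0"
  have "\<forall>\<^sub>F z in at z0. f z \<noteq> f z0" using nicely_meromorphic_avoid[OF f] by (simp add: cosparse_UNIV_iff)
  from eventually_conj[OF eventually_compose_filterlim[OF this filterlim_affine_at[of 1 z0]] eq]
  have "\<forall>\<^sub>F z in at (0::complex). False" by (simp add: eventually_mono)
  thus False by simp
qed

lemma pole_point_germ:
  assumes sol: "schwarz_solution p (\<lambda>w. poly P w / poly Q w) f" and p: "p \<ge> 1"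
    and Q: "Q = [:- a, 1:] ^ k * q" "poly q a \<noteq> 0" and k: "k \<ge> 1" and P: "poly P a \<noteq> 0"
    and z0: "sphere_val f z0 = Fin a"
  obtains m g where "m * k = 2 * p" "m \<ge> 2" "g analytic_on {0}" "g 0 \<noteq> 0"
    "\<forall>\<^sub>F z in nhds 0. f (z + z0) = a + z ^ m * g z"
    "g 0 ^ k * poly q a * (- (of_nat (m - 1) * (of_nat (m - 1) + 2)) / 2) ^ p = poly P a"
proof -
  note S = schwarz_solutionD[OF sol]
  have fz0: "\<not> is_pole f z0" "f z0 = a" using z0 by (auto simp: sphere_val_def split: if_splits)
  define F where "F = (\<lambda>z. f (1 * z + z0))"
  have "(f \<circ> (\<lambda>z. 1 * z + z0)) analytic_on {0}"
    by (rule analytic_on_compose) (use nicely_meromorphic_analytic_at[OF S(1) fz0(1)] in \<open>auto intro!: analytic_intros\<close>)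
  hence Fa: "F analytic_on {0}" by (simp add: F_def o_def)
  have F0: "F 0 = a" by (simp add: F_def fz0)
  have nc: "\<not> (\<forall>\<^sub>F z in at 0. F z = F 0)"
    using nonconstant_germ[OF S(1,2), of z0] by (simp add: F_def)
  obtain m g where mg: "m \<ge> 1" "g analytic_on {0}" "g 0 \<noteq> 0" "\<forall>\<^sub>F z in nhds 0. F z = F 0 + z ^ m * g z"
    by (rule analytic_local_factor[OF Fa nc])
  have Fl: "\<forall>\<^sub>F z in nhds 0. F z = a + z ^ m * g z" using mg(4) by (simp add: F0)
  have "\<forall>\<^sub>F z in at 0. schwarzian F z ^ p = poly P (F z) / poly Q (F z)"
    unfolding F_def using solution_affine_local[OF sol, of 1 z0] by simp
  note R = ramification_at_pole[OF Q P k p Fl mg(2,3,1) this]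
  show ?thesis
    by (rule that[of m g]) (use R mg Fl in \<open>auto simp: F_def\<close>)
qed

text \<open>
  Two germs of the same solution over the same pole with equal leading coefficients agree up to a rotation
  by an \<open>m\<close>-th root of unity: such a rotation preserves the leading coefficient, and it preserves the equation because
  \<open>\<alpha>^(2 p) = \<alpha>^(m k) = 1\<close>. By analytic continuation the local symmetry is global.
\<close>

lemma pole_points_symmetry:
  assumes sol: "schwarz_solution p (\<lambda>w. poly P w / poly Q w) f" and p: "p \<ge> 1"
    and Q: "Q = [:- a, 1:] ^ k * q" "poly q a \<noteq> 0" and k: "k \<ge> 1" and P: "poly P a \<noteq> 0"
    and g0: "g0 analytic_on {0}" "\<forall>\<^sub>F z in nhds 0. f (z + z0) = a + z ^ m * g0 z"
    and g1: "g1 analytic_on {0}" "\<forall>\<^sub>F z in nhds 0. f (z + z1) = a + z ^ m * g1 z"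
    and C: "g0 0 = C" "g1 0 = C" "C \<noteq> 0" and \<alpha>: "\<alpha> ^ m = 1" and m: "m \<ge> 1" "m * k = 2 * p"
  shows "f (\<alpha> * z + z1) = f (z + z0)"
proof -
  note S = schwarz_solutionD[OF sol]
  have \<alpha>0: "\<alpha> \<noteq> 0" using \<alpha> m by (auto simp: power_0_left)
  have \<alpha>p: "\<alpha> ^ (2 * p) = 1" unfolding m(2)[symmetric] by (simp add: power_mult \<alpha>)
  define F0 where "F0 = (\<lambda>z. f (1 * z + z0))"
  define F1 where "F1 = (\<lambda>z. f (\<alpha> * z + z1))"
  have F0: "\<forall>\<^sub>F z in nhds 0. F0 z = a + z ^ m * g0 z" using g0(2) by (simp add: F0_def)
  have lim: "((\<lambda>z. \<alpha> * z) \<longlongrightarrow> \<alpha> * 0) (nhds 0)"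
    by (rule analytic_at_tendsto_nhds) (intro analytic_intros)
  have F1: "\<forall>\<^sub>F z in nhds 0. F1 z = a + z ^ m * g1 (\<alpha> * z)"
    using eventually_compose_filterlim[OF g1(2), of "\<lambda>z. \<alpha> * z" "nhds 0"] lim
    by (auto simp: F1_def power_mult_distrib \<alpha>)
  have "(g1 \<circ> (\<lambda>z. \<alpha> * z)) analytic_on {0}"
    by (rule analytic_on_compose) (use g1 in \<open>auto intro!: analytic_intros\<close>)
  hence g1': "(\<lambda>z. g1 (\<alpha> * z)) analytic_on {0}" by (simp add: o_def)
  have s0: "\<forall>\<^sub>F z in at 0. schwarzian F0 z ^ p = poly P (F0 z) / poly Q (F0 z)"
    unfolding F0_def by (rule solution_affine_local[OF sol]) auto
  have s1: "\<forall>\<^sub>F z in at 0. schwarzian F1 z ^ p = poly P (F1 z) / poly Q (F1 z)"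
    unfolding F1_def by (rule solution_affine_local[OF sol \<alpha>p \<alpha>0])
  have "g1 (\<alpha> * 0) = C" using C by simp
  from pole_germ_unique[OF Q P k p F0 g0(1) F1 g1' C(1) this C(3) m(1) s0 s1]
  have "\<forall>\<^sub>F z in at 0. F0 z = F1 z" by (rule eventually_nhds_imp_at)
  hence fr: "\<exists>\<^sub>F z in at 0. F1 z = F0 z" by (intro eventually_frequently) (auto elim: eventually_mono)
  have nm: "F0 nicely_meromorphic_on UNIV" "F1 nicely_meromorphic_on UNIV"
    unfolding F0_def F1_def by (rule nicely_meromorphic_affine[OF S(1)]; use \<alpha>0 in simp)+
  have "F1 = F0"
    by (rule nicely_meromorphic_eqI[OF nm(2,1) meromorphic_eq_cosparse[OF _ _ fr]])
       (use nm nicely_meromorphic_imp_meromorphic in auto)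
  from fun_cong[OF this, of z] show ?thesis by (simp add: F0_def F1_def)
qed

lemma pole_point_rotation:
  assumes sol: "schwarz_solution p (\<lambda>w. poly P w / poly Q w) f" and p: "p \<ge> 1"
    and cop: "coprime P Q" and Q0: "Q \<noteq> 0" and z0: "sphere_val f z0 = Fin a" and a: "poly Q a = 0"
  obtains m g where "m \<ge> 2" "g analytic_on {0}" "g 0 \<noteq> 0" "\<forall>\<^sub>F z in nhds 0. f (z + z0) = a + z ^ m * g z"
    "\<And>\<alpha> z. \<alpha> ^ m = 1 \<Longrightarrow> f (\<alpha> * z + z0) = f (z + z0)"
proof -
  obtain k q where k: "k \<ge> 1" and Q: "Q = [:- a, 1:] ^ k * q" "poly q a \<noteq> 0"
    by (rule root_factorization[OF Q0 a])
  have Pa: "poly P a \<noteq> 0" by (rule coprime_poly_root_nonzero[OF cop a])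
  obtain m g where mg: "m * k = 2 * p" "m \<ge> 2" "g analytic_on {0}" "g 0 \<noteq> 0"
    "\<forall>\<^sub>F z in nhds 0. f (z + z0) = a + z ^ m * g z"
    by (rule pole_point_germ[OF sol p Q k Pa z0])
  have "f (\<alpha> * z + z0) = f (z + z0)" if "\<alpha> ^ m = 1" for \<alpha> z
    by (rule pole_points_symmetry[OF sol p Q k Pa mg(3,5,3,5) refl refl mg(4) that _ mg(1)]) (use mg in simp)
  thus ?thesis using that mg by blast
qed

text \<open>
  The leading coefficients at the \<open>a\<close>-points of \<open>f\<close> are \<open>k\<close>-th roots of one constant. Among
  infinitely many points two must have the same, and the translation that takes one to the other is a period.
\<close>

lemma infinitely_attained_pole_imp_period:
  assumes sol: "schwarz_solution p (\<lambda>w. poly P w / poly Q w) f" and p: "p \<ge> 1"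
    and cop: "coprime P Q" and Q0: "Q \<noteq> 0" and a: "poly Q a = 0"
    and inf: "infinite {z. sphere_val f z = Fin a}"
  obtains t where "t \<noteq> 0" "\<And>z. f (z + t) = f z"
proof -
  obtain k q where k: "k \<ge> 1" and Q: "Q = [:- a, 1:] ^ k * q" "poly q a \<noteq> 0"
    by (rule root_factorization[OF Q0 a])
  have Pa: "poly P a \<noteq> 0" by (rule coprime_poly_root_nonzero[OF cop a])
  define m where "m = 2 * p div k"
  \<comment> \<open>the common \<open>k\<close>-th power of all leading coefficients\<close>
  define K where "K = poly P a / (poly q a * (- (of_nat (m - 1) * (of_nat (m - 1) + 2)) / 2) ^ p)"
  define Germ where "Germ = (\<lambda>z0 g. m * k = 2 * p \<and> m \<ge> 2 \<and> g analytic_on {0} \<and> g 0 \<noteq> 0 \<and>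
      (\<forall>\<^sub>F z in nhds 0. f (z + z0) = a + z ^ m * g z) \<and> g 0 ^ k = K)"
  have "\<exists>g. Germ z0 g" if z0: "sphere_val f z0 = Fin a" for z0
  proof -
    obtain m' g where mg: "m' * k = 2 * p" "m' \<ge> 2" "g analytic_on {0}" "g 0 \<noteq> 0"
      "\<forall>\<^sub>F z in nhds 0. f (z + z0) = a + z ^ m' * g z"
      "g 0 ^ k * poly q a * (- (of_nat (m' - 1) * (of_nat (m' - 1) + 2)) / 2) ^ p = poly P a"
      by (rule pole_point_germ[OF sol p Q k Pa z0])
    have m': "m' = m" using mg(1) k by (simp add: m_def flip: mg(1))
    have "poly q a * (- (of_nat (m - 1) * (of_nat (m - 1) + 2)) / 2) ^ p \<noteq> 0"
      using mg(6) Pa unfolding m' by (metis mult.assoc mult_zero_right)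
    hence "g 0 ^ k = K" using mg(6) unfolding m' K_def by (simp add: field_simps)
    thus ?thesis using mg unfolding m' Germ_def by blast
  qed
  hence "\<forall>z0\<in>{z. sphere_val f z = Fin a}. \<exists>g. Germ z0 g" by simp
  from bchoice[OF this] obtain g where g': "\<And>z0. sphere_val f z0 = Fin a \<Longrightarrow> Germ z0 (g z0)" by auto
  note g = g'[unfolded Germ_def]
  have "finite {C::complex. C ^ k = K}" using finite_complex_roots k by simp
  moreover have "(\<lambda>z0. g z0 0) ` {z. sphere_val f z = Fin a} \<subseteq> {C. C ^ k = K}" using g by auto
  ultimately have "\<not> inj_on (\<lambda>z0. g z0 0) {z. sphere_val f z = Fin a}"
    using inf by (meson finite_imageD finite_subset)
  then obtain z0 z1 where z: "sphere_val f z0 = Fin a" "sphere_val f z1 = Fin a" "z0 \<noteq> z1" "g z0 0 = g z1 0"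
    by (auto simp: inj_on_def)
  have eq: "f (1 * z + z1) = f (z + z0)" for z
    by (rule pole_points_symmetry[OF sol p Q k Pa _ _ _ _ refl _ _ _ _, where ?g0.0 = "g z0" and ?g1.0 = "g z1" and m = m])
       (use g[OF z(1)] g[OF z(2)] z in auto)
  show ?thesis
  proof (rule that[of "z1 - z0"])
    show "z1 - z0 \<noteq> 0" using z by simp
    show "f (z + (z1 - z0)) = f z" for z using eq[of "z - z0"] by (simp add: algebra_simps)
  qed
qed

section \<open>Periodic entire functions\<close>

lemma period_int_multiple:
  fixes f :: "complex \<Rightarrow> 'a"
  assumes per: "\<And>z. f (z + \<tau>) = f z"
  shows "f (z + of_int n * \<tau>) = f z"
proof (induction n rule: int_induct[where k = 0])
  case (step1 i)
  have "f (z + of_int (i + 1) * \<tau>) = f ((z + of_int i * \<tau>) + \<tau>)" by (simp add: algebra_simps)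
  thus ?case using step1 per by simp
next
  case (step2 i)
  have "f (z + of_int i * \<tau>) = f ((z + of_int (i - 1) * \<tau>) + \<tau>)" by (simp add: algebra_simps)
  thus ?case using step2 per by simp
qed simp

lemma doubly_periodic_entire_constant:
  fixes f :: "complex \<Rightarrow> complex"
  assumes hol: "f holomorphic_on UNIV" and t: "\<And>z. f (z + t) = f z" and t': "\<And>z. f (z + \<omega> * t) = f z"
    and t0: "t \<noteq> 0" and im: "Im \<omega> \<noteq> 0"
  shows "f constant_on UNIV"
proof -
  define g where "g = (\<lambda>p::real \<times> real. of_real (fst p) * t + of_real (snd p) * (\<omega> * t))"
  define S where "S = g ` ({0..1} \<times> {0..1})"
  have "compact S" unfolding S_def g_def
    by (intro compact_continuous_image continuous_intros compact_Times compact_Icc)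
  moreover have "continuous_on S f"
    using holomorphic_on_imp_continuous_on[OF hol] continuous_on_subset by blast
  ultimately have bd: "bounded (f ` S)" by (intro compact_imp_bounded compact_continuous_image)
  have "f z \<in> f ` S" for z
  proof -
    define y where "y = Im (z / t) / Im \<omega>"
    define x where "x = Re (z / t) - y * Re \<omega>"
    have "z / t = of_real x + of_real y * \<omega>"
      using im by (simp add: complex_eq_iff x_def y_def)
    hence z: "z = of_real x * t + of_real y * (\<omega> * t)" using t0 by (simp add: field_simps)
    have "z = g (frac x, frac y) + of_int \<lfloor>y\<rfloor> * (\<omega> * t) + of_int \<lfloor>x\<rfloor> * t"
      unfolding z g_def by (simp add: frac_def algebra_simps)
    hence "f z = f (g (frac x, frac y))" using period_int_multiple[of f, OF t] period_int_multiple[of f, OF t'] by simp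
    moreover have "g (frac x, frac y) \<in> S" unfolding S_def
      by (intro imageI) (auto simp: frac_ge_0 less_imp_le[OF frac_lt_1])
    ultimately show ?thesis by blast
  qed
  hence "range f \<subseteq> f ` S" by blast
  hence "bounded (range f)" using bd bounded_subset by blast
  thus ?thesis using Liouville_theorem[OF hol] by (auto simp: constant_on_def)
qed

text \<open>
  The periods form a closed set, and the nonzero ones stay away from 0 because the values of \<open>f\<close> are isolated;
  so there is one of least modulus. Every other period is a real multiple of it, for otherwise \<open>f\<close> would be doubly
  periodic, and the fractional part of the multiple would give a shorter period.
\<close>

lemma minimal_period_exists:
  fixes f :: "complex \<Rightarrow> complex"
  assumes hol: "f holomorphic_on UNIV" and nc: "\<not> f constant_on UNIV"
    and t: "t0 \<noteq> 0" "\<And>z. f (z + t0) = f z"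
  obtains t where "t \<noteq> 0" "\<And>z. f (z + t) = f z"
    "\<And>\<tau>. (\<And>z. f (z + \<tau>) = f z) \<Longrightarrow> \<exists>n::int. \<tau> = of_int n * t"
proof -
  define \<Lambda> where "\<Lambda> = {t. \<forall>z. f (z + t) = f z}"
  have cont: "continuous_on UNIV f" by (rule holomorphic_on_imp_continuous_on[OF hol])
  have cl: "closed \<Lambda>"
  proof -
    have "\<Lambda> = (\<Inter>z. {t. f (z + t) = f z})" by (auto simp: \<Lambda>_def)
    moreover have "closed {t. f (z + t) = f z}" for z
      by (intro closed_Collect_eq continuous_intros continuous_on_compose2[OF cont]) auto
    ultimately show ?thesis by auto
  qed
  have "f nicely_meromorphic_on UNIV"
    using hol by (intro analytic_on_imp_nicely_meromorphic_on) (simp add: analytic_on_open)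
  hence "\<forall>\<^sub>F z in at 0. f z \<noteq> f 0" using nicely_meromorphic_avoid[OF _ nc] by (simp add: cosparse_UNIV_iff)
  then obtain \<delta> where \<delta>: "\<delta> > 0" "\<And>z. z \<noteq> 0 \<Longrightarrow> norm z < \<delta> \<Longrightarrow> f z \<noteq> f 0"
    by (auto simp: eventually_at dist_norm)
  define \<Lambda>' where "\<Lambda>' = \<Lambda> \<inter> {t. norm t \<ge> \<delta>}"
  have in': "\<tau> \<in> \<Lambda>'" if "\<tau> \<in> \<Lambda>" "\<tau> \<noteq> 0" for \<tau>
  proof -
    have "f (0 + \<tau>) = f 0" using that unfolding \<Lambda>_def by blast
    hence "f \<tau> = f 0" by simp
    hence "\<not> norm \<tau> < \<delta>" using \<delta>(2)[of \<tau>] that by blast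
    thus ?thesis using that by (simp add: \<Lambda>'_def)
  qed
  have "closed \<Lambda>'" unfolding \<Lambda>'_def by (intro closed_Int cl closed_Collect_le continuous_intros)
  moreover have "t0 \<in> \<Lambda>'" using t by (intro in') (auto simp: \<Lambda>_def)
  ultimately obtain t1 where t1: "t1 \<in> \<Lambda>'" "\<And>\<tau>. \<tau> \<in> \<Lambda>' \<Longrightarrow> dist 0 t1 \<le> dist 0 \<tau>"
    using distance_attains_inf[of \<Lambda>' 0] by blast
  have t1p: "f (z + t1) = f z" for z using t1(1) by (auto simp: \<Lambda>'_def \<Lambda>_def)
  have t10: "t1 \<noteq> 0" using t1(1) \<delta>(1) by (auto simp: \<Lambda>'_def)
  show ?thesis
  proof (rule that[OF t10 t1p])
    fix \<tau> assume \<tau>: "\<And>z. f (z + \<tau>) = f z"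
    define \<omega> where "\<omega> = \<tau> / t1"
    have \<tau>\<omega>: "\<tau> = \<omega> * t1" using t10 by (simp add: \<omega>_def)
    have "Im \<omega> = 0"
    proof (rule ccontr)
      assume "Im \<omega> \<noteq> 0"
      from doubly_periodic_entire_constant[OF hol t1p _ t10 this] \<tau> nc show False
        unfolding \<tau>\<omega> by blast
    qed
    hence \<omega>: "\<omega> = of_real (Re \<omega>)" by (simp add: complex_eq_iff)
    define \<sigma> where "\<sigma> = of_real (frac (Re \<omega>)) * t1"
    have \<sigma>\<tau>: "\<tau> = \<sigma> + of_int \<lfloor>Re \<omega>\<rfloor> * t1"
      unfolding \<tau>\<omega> \<sigma>_def by (subst \<omega>) (simp add: frac_def algebra_simps)
    have "f (z + \<sigma>) = f z" for z
      using period_int_multiple[of f, OF t1p, of "z + \<sigma>" "\<lfloor>Re \<omega>\<rfloor>"] \<tau>[of z] unfolding \<sigma>\<tau> by (simp add: add.assoc)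
    hence "\<sigma> \<in> \<Lambda>" by (simp add: \<Lambda>_def)
    moreover have "norm \<sigma> < norm t1"
    proof -
      have "norm \<sigma> = frac (Re \<omega>) * norm t1" by (simp add: \<sigma>_def norm_mult frac_ge_0)
      also have "\<dots> < 1 * norm t1" using t10 frac_lt_1 by (intro mult_strict_right_mono) auto
      finally show ?thesis by simp
    qed
    ultimately have "\<sigma> = 0" using in'[of \<sigma>] t1(2)[of \<sigma>] by (cases "\<sigma> = 0") auto
    thus "\<exists>n::int. \<tau> = of_int n * t1" using \<sigma>\<tau> by auto
  qed
qed

text \<open>
  The jump of \<open>2 \<pi> \<i>\<close> of \<open>Ln\<close> across the negative real axis is a period of \<open>F\<close>.
\<close>

lemma periodic_factors_through_exp:
  fixes F :: "complex \<Rightarrow> complex"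
  assumes hol: "F holomorphic_on UNIV" and per: "\<And>w. F (w + 2 * of_real pi * \<i>) = F w"
  shows "(\<lambda>x. F (Ln x)) holomorphic_on - {0}" "F (Ln (exp w)) = F w"
proof -
  have eq: "F v = F w" if "exp v = exp w" for v w
  proof -
    obtain n :: int where "v = w + complex_of_real (2 * of_int n * pi) * \<i>"
      using \<open>exp v = exp w\<close> by (auto simp: exp_eq)
    hence "v = w + of_int n * (2 * of_real pi * \<i>)" by (simp add: algebra_simps)
    thus ?thesis using period_int_multiple[of F, OF per] by simp
  qed
  show "F (Ln (exp w)) = F w" by (rule eq) (simp add: exp_Ln)
  have h1: "(\<lambda>x. F (Ln x)) holomorphic_on - \<real>\<^sub>\<le>\<^sub>0"
    using holomorphic_on_compose_gen[OF _ hol, of Ln "- \<real>\<^sub>\<le>\<^sub>0"]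
    by (auto simp: o_def intro!: holomorphic_intros)
  have "(\<lambda>x. Ln (- x) + of_real pi * \<i>) holomorphic_on {x. - x \<notin> \<real>\<^sub>\<le>\<^sub>0}"
    by (intro holomorphic_intros) auto
  from holomorphic_on_compose_gen[OF this hol]
  have "(\<lambda>x. F (Ln (- x) + of_real pi * \<i>)) holomorphic_on {x. - x \<notin> \<real>\<^sub>\<le>\<^sub>0}"
    by (simp only: o_def) simp
  also have "?this \<longleftrightarrow> (\<lambda>x. F (Ln x)) holomorphic_on {x. - x \<notin> \<real>\<^sub>\<le>\<^sub>0}"
  proof (rule holomorphic_cong[OF refl])
    fix x :: complex assume "x \<in> {x. - x \<notin> \<real>\<^sub>\<le>\<^sub>0}"
    hence x: "x \<noteq> 0" by auto
    show "F (Ln (- x) + of_real pi * \<i>) = F (Ln x)"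
      by (rule eq) (use x in \<open>simp add: exp_add exp_Ln\<close>)
  qed
  finally have h2: "(\<lambda>x. F (Ln x)) holomorphic_on {x. - x \<notin> \<real>\<^sub>\<le>\<^sub>0}" .
  have "open {x::complex. - x \<notin> \<real>\<^sub>\<le>\<^sub>0}"
  proof -
    have "open (- \<real>\<^sub>\<le>\<^sub>0 :: complex set)" using closed_nonpos_Reals_complex by (simp add: open_Compl)
    hence "open (uminus -` (- \<real>\<^sub>\<le>\<^sub>0 :: complex set))" by (rule open_vimage) (intro continuous_intros)
    moreover have "uminus -` (- \<real>\<^sub>\<le>\<^sub>0) = {x::complex. - x \<notin> \<real>\<^sub>\<le>\<^sub>0}" by (simp only: vimage_def Compl_iff)
    ultimately show ?thesis by (simp only:)
  qed
  moreover have "open (- \<real>\<^sub>\<le>\<^sub>0 :: complex set)" using closed_nonpos_Reals_complex by (simp add: open_Compl)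
  ultimately have "(\<lambda>x. F (Ln x)) holomorphic_on (- \<real>\<^sub>\<le>\<^sub>0 \<union> {x. - x \<notin> \<real>\<^sub>\<le>\<^sub>0})"
    using h1 h2 by (intro holomorphic_on_Un)
  moreover have "- {0} \<subseteq> - \<real>\<^sub>\<le>\<^sub>0 \<union> {x::complex. - x \<notin> \<real>\<^sub>\<le>\<^sub>0}"
    by (auto simp: complex_nonpos_Reals_iff complex_eq_iff)
  ultimately show "(\<lambda>x. F (Ln x)) holomorphic_on - {0}" using holomorphic_on_subset by blast
qed

text \<open>
  The simple roots 1 and \<open>-1\<close> split off once each; what remains has only the root 0.
\<close>

lemma poly_with_roots_0_1_minus1:
  fixes D :: "complex poly"
  assumes r1: "poly D 1 = 0" "poly (pderiv D) 1 \<noteq> 0" and r2: "poly D (- 1) = 0" "poly (pderiv D) (- 1) \<noteq> 0"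
    and only: "\<And>x. poly D x = 0 \<Longrightarrow> x = 0 \<or> x = 1 \<or> x = - 1"
  obtains e c where "c \<noteq> 0" "\<And>x. poly D x = c * x ^ e * (x ^ 2 - 1)"
proof -
  have D0: "D \<noteq> 0" using r1 by auto
  obtain D1 where D1: "D = [:- 0, 1:] ^ order 0 D * D1" "\<not> [:- 0, 1:] dvd D1"
    using order_decomp[OF D0, of 0] by blast
  define e where "e = order 0 D"
  have D1': "poly D x = x ^ e * poly D1 x" for x
    by (subst D1(1)) (simp add: e_def poly_power)
  have D10: "poly D1 0 \<noteq> 0" using D1(2) by (simp add: poly_eq_0_iff_dvd)
  have "poly D1 1 = 0" using D1'[of 1] r1 by simp
  then obtain D2 where D2: "D1 = [:- 1, 1:] * D2" by (auto simp: poly_eq_0_iff_dvd dvd_def)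
  have "poly D1 (- 1) = 0" using D1'[of "- 1"] r2 by simp
  hence "poly D2 (- 1) = 0" by (simp add: D2)
  then obtain D3 where D3: "D2 = [:1, 1:] * D3" by (auto simp: poly_eq_0_iff_dvd dvd_def)
  have DD: "D = [:- 1, 1:] * ([:1, 1:] * ([:- 0, 1:] ^ e * D3))"
    by (subst D1(1)) (simp only: D2 D3 e_def mult_ac)
  have n1: "poly D3 1 \<noteq> 0"
  proof
    assume "poly D3 1 = 0"
    hence "poly (pderiv D) 1 = 0" unfolding DD by (simp only: pderiv_mult poly_add poly_mult) simp
    thus False using r1 by simp
  qed
  have n2: "poly D3 (- 1) \<noteq> 0"
  proof
    assume "poly D3 (- 1) = 0"
    hence "poly (pderiv D) (- 1) = 0" unfolding DD by (simp only: pderiv_mult poly_add poly_mult) simp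
    thus False using r2 by simp
  qed
  have nz: "poly D3 x \<noteq> 0" for x
  proof
    assume x: "poly D3 x = 0"
    hence "poly D x = 0" unfolding DD by simp
    hence "x = 0 \<or> x = 1 \<or> x = - 1" by (rule only)
    thus False using x n1 n2 D10 by (auto simp: D2 D3)
  qed
  have "degree D3 = 0"
  proof (rule ccontr)
    assume "degree D3 \<noteq> 0"
    then obtain z where "poly D3 z = 0" by (rule complex_poly_root_exists)
    thus False using nz by simp
  qed
  then obtain d where "D3 = [:d:]" by (rule degree_eq_zeroE)
  hence c: "poly D3 x = poly D3 0" for x by simp
  show ?thesis
  proof (rule that[of "poly D3 0" e])
    show "poly D3 0 \<noteq> 0" using c[of 1] n1 by simp
    show "poly D x = poly D3 0 * x ^ e * (x ^ 2 - 1)" for x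
      unfolding DD using c[of x] by (simp add: poly_power algebra_simps power2_eq_square)
  qed
qed

text \<open>
  The bound at infinity and the symmetry \<open>x \<mapsto> 1/x\<close> give the same bound at 0, so \<open>H\<close> is a Laurent polynomial.
  The symmetry makes 1 and \<open>-1\<close> critical, hence \<open>H' = c x^n (x\<^sup>2 - 1)\<close> for an integer \<open>n\<close>, and the symmetry once more
  forces \<open>n = -2\<close>.
\<close>

lemma symmetric_laurent_form:
  fixes H :: "complex \<Rightarrow> complex"
  assumes hol: "H holomorphic_on - {0}" and sym: "\<And>x. x \<noteq> 0 \<Longrightarrow> H (1 / x) = H x"
    and bd: "\<And>x. norm x \<ge> r \<Longrightarrow> norm (H x) \<le> C * norm x ^ L"
    and crit: "\<And>x. x \<noteq> 0 \<Longrightarrow> deriv H x = 0 \<Longrightarrow> x = 1 \<or> x = - 1"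
    and simple: "\<And>x. x \<noteq> 0 \<Longrightarrow> deriv H x = 0 \<Longrightarrow> deriv (deriv H) x \<noteq> 0"
  obtains A B where "A \<noteq> 0" "\<And>x. x \<noteq> 0 \<Longrightarrow> H x = A * (x + 1 / x) + B"
proof -
  have op: "open (- {0::complex})" by (simp add: open_Compl)
  have Han: "H analytic_on {x}" if "x \<noteq> 0" for x
    using hol op that by (simp add: analytic_at) blast
  define M where "M = Suc L"
  define r1 where "r1 = max r 1"
  have C0: "C \<ge> 0"
  proof -
    have "norm (complex_of_real r1) \<ge> r" by (simp add: r1_def)
    from order_trans[OF norm_ge_zero bd[OF this]] have "0 \<le> C * norm (complex_of_real r1) ^ L" .
    moreover have "norm (complex_of_real r1) ^ L > 0" by (simp add: r1_def)
    ultimately show ?thesis using zero_le_mult_iff not_le by blast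
  qed
  define G where "G = (\<lambda>x. if x = 0 then 0 else x ^ M * H x)"
  have Ghol0: "G holomorphic_on UNIV - {0}"
  proof -
    have "(\<lambda>x. x ^ M * H x) holomorphic_on UNIV - {0}"
      by (intro holomorphic_intros holomorphic_on_subset[OF hol]) auto
    thus ?thesis by (rule holomorphic_transform) (simp add: G_def)
  qed
  have small: "norm (G x) \<le> C * norm x" if "norm x \<le> 1 / r1" for x
  proof (cases "x = 0")
    case True thus ?thesis by (simp add: G_def)
  next
    case False
    have "norm (1 / x) \<ge> r"
    proof -
      have "norm x * r1 \<le> 1" using that by (simp add: r1_def field_simps)
      hence "r1 \<le> 1 / norm x" using False by (simp add: field_simps)
      thus ?thesis by (simp add: r1_def norm_divide)
    qed
    from bd[OF this] have "norm (H x) \<le> C * (1 / norm x) ^ L" using sym[OF False] by (simp add: norm_divide)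
    hence "norm x ^ M * norm (H x) \<le> norm x ^ M * (C * (1 / norm x) ^ L)" by (intro mult_left_mono) auto
    also have "\<dots> = C * norm x" using False by (simp add: M_def power_divide)
    finally show ?thesis using False by (simp add: G_def norm_mult norm_power)
  qed
  have G0: "(G \<longlongrightarrow> 0) (at 0)"
  proof (rule Lim_null_comparison)
    have "\<forall>\<^sub>F x in at 0. x \<in> ball (0::complex) (1 / r1)" by (intro eventually_at_in_open') (auto simp: r1_def)
    thus "\<forall>\<^sub>F x in at 0. norm (G x) \<le> C * norm x" by eventually_elim (use small in auto)
    have "((\<lambda>x::complex. C * norm x) \<longlongrightarrow> C * 0) (at 0)"
      by (intro tendsto_mult tendsto_const tendsto_norm_zero tendsto_ident_at)
    thus "((\<lambda>x::complex. C * norm x) \<longlongrightarrow> 0) (at 0)" by simp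
  qed
  have "continuous_on UNIV G"
  proof (rule continuous_at_imp_continuous_on, rule ballI)
    fix x :: complex
    show "isCont G x"
    proof (cases "x = 0")
      case True thus ?thesis using G0 by (simp add: isCont_def G_def)
    next
      case False
      thus ?thesis using Ghol0 holomorphic_on_imp_continuous_on[OF Ghol0] op
        by (simp add: continuous_on_eq_continuous_at Compl_eq_Diff_UNIV)
    qed
  qed
  hence Ghol: "G holomorphic_on UNIV"
    using no_isolated_singularity[of UNIV G "{0}"] Ghol0 by simp
  have Gb: "norm (G x) \<le> C * norm x ^ (M + L)" if "r1 \<le> norm x" for x
  proof -
    have x: "x \<noteq> 0" "norm x \<ge> r" using that by (auto simp: r1_def)
    have "norm (G x) = norm x ^ M * norm (H x)" using x by (simp add: G_def norm_mult norm_power)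
    also have "\<dots> \<le> norm x ^ M * (C * norm x ^ L)" using bd[OF x(2)] by (intro mult_left_mono) auto
    finally show ?thesis by (simp add: power_add mult_ac)
  qed
  define P where "P = (\<Sum>k\<le>M + L. monom ((deriv ^^ k) G 0 / fact k) k)"
  have GP: "G x = poly P x" for x
    using Liouville_polynomial[OF Ghol Gb] by (simp add: P_def poly_sum poly_monom)
  have HP: "x ^ M * H x = poly P x" if "x \<noteq> 0" for x using GP[of x] that by (simp add: G_def)
  \<comment> \<open>\<open>D\<close> is the polynomial \<open>x^(M + 1) H'(x)\<close>.\<close>
  define D where "D = pCons 0 (pderiv P) - smult (of_nat M) P"
  have evnz: "\<forall>\<^sub>F y in nhds x. y \<in> - {0}" if "x \<noteq> 0" for x :: complex
    using op that by (intro eventually_nhds_in_open) auto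
  have HD: "x ^ Suc M * deriv H x = poly D x" if "x \<noteq> 0" for x
  proof -
    have "\<forall>\<^sub>F y in nhds x. y ^ M * H y = poly P y"
      using evnz[OF that] by eventually_elim (use HP in auto)
    from eventually_nhds_x_imp_x[OF eventually_nhds_deriv_eq[OF this]]
    have "deriv (\<lambda>y. y ^ M * H y) x = poly (pderiv P) x" by (simp add: DERIV_imp_deriv[OF poly_DERIV])
    moreover have "((\<lambda>y. y ^ M * H y) has_field_derivative (of_nat M * x ^ (M - 1)) * H x + x ^ M * deriv H x) (at x)"
      using analytic_at_has_deriv[OF Han[OF that]] by (auto intro!: derivative_eq_intros)
    ultimately have "poly (pderiv P) x = (of_nat M * x ^ (M - 1)) * H x + x ^ M * deriv H x"
      using DERIV_imp_deriv by metis
    hence "x * poly (pderiv P) x = of_nat M * (x ^ M * H x) + x ^ Suc M * deriv H x"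
      by (simp add: M_def algebra_simps)
    thus ?thesis unfolding HP[OF that] by (simp add: D_def algebra_simps)
  qed
  have Hsym: "deriv H x = - deriv H (1 / x) / x ^ 2" if "x \<noteq> 0" for x
  proof -
    have "\<forall>\<^sub>F y in nhds x. H (1 / y) = H y" using evnz[OF that] by eventually_elim (use sym in auto)
    from eventually_nhds_x_imp_x[OF eventually_nhds_deriv_eq[OF this]]
    have "deriv (\<lambda>y. H (1 / y)) x = deriv H x" .
    moreover have "((\<lambda>y. H (1 / y)) has_field_derivative deriv H (1 / x) * (- (1 / x ^ 2))) (at x)"
    proof (rule DERIV_chain2[where f = H and g = "\<lambda>y. 1 / y"])
      show "(H has_field_derivative deriv H (1 / x)) (at (1 / x))"
        by (rule analytic_at_has_deriv[OF Han]) (use that in auto)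
      show "((\<lambda>y. 1 / y) has_field_derivative - (1 / x ^ 2)) (at x)"
        using that by (auto intro!: derivative_eq_intros simp: power2_eq_square)
    qed
    ultimately show ?thesis using DERIV_imp_deriv by (metis (no_types, lifting) minus_divide_left mult_minus_right times_divide_eq_right mult.right_neutral)
  qed
  have d1: "deriv H 1 = 0" "deriv H (- 1) = 0"
    using Hsym[of 1] Hsym[of "- 1"] by (simp_all add: eq_neg_iff_add_eq_0)
  have root: "poly D x0 = 0" "poly (pderiv D) x0 \<noteq> 0" if "x0 \<noteq> 0" "deriv H x0 = 0" "deriv (deriv H) x0 \<noteq> 0" for x0
  proof -
    show "poly D x0 = 0" using HD[OF that(1)] that by simp
    have "\<forall>\<^sub>F y in nhds x0. y ^ Suc M * deriv H y = poly D y"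
      using evnz[OF that(1)] by eventually_elim (use HD in auto)
    from eventually_nhds_x_imp_x[OF eventually_nhds_deriv_eq[OF this]]
    have "deriv (\<lambda>y. y ^ Suc M * deriv H y) x0 = poly (pderiv D) x0" by (simp only: DERIV_imp_deriv[OF poly_DERIV])
    moreover have "((\<lambda>y. y ^ Suc M * deriv H y) has_field_derivative
        (of_nat (Suc M) * x0 ^ (Suc M - 1)) * deriv H x0 + x0 ^ Suc M * deriv (deriv H) x0) (at x0)"
      using analytic_at_has_deriv[OF analytic_deriv[OF Han[OF that(1)]]]
      by (auto intro!: derivative_eq_intros simp del: power_Suc)
    ultimately have "poly (pderiv D) x0 = x0 ^ Suc M * deriv (deriv H) x0"
      using DERIV_imp_deriv that(2) by fastforce
    thus "poly (pderiv D) x0 \<noteq> 0" using that by simp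
  qed
  have only: "x = 0 \<or> x = 1 \<or> x = - 1" if "poly D x = 0" for x
    using HD[of x] crit[of x] that by (cases "x = 0") auto
  obtain e c where c: "c \<noteq> 0" "\<And>x. poly D x = c * x ^ e * (x ^ 2 - 1)"
    by (rule poly_with_roots_0_1_minus1[of D]) (use root[of 1] root[of "- 1"] d1 simple[of 1] simple[of "- 1"] only in auto)
  have H': "x ^ Suc M * deriv H x = c * x ^ e * (x ^ 2 - 1)" if "x \<noteq> 0" for x using HD[OF that] c(2) by simp
  \<comment> \<open>The relation \<open>H'(x) = - H'(1/x) / x\<^sup>2\<close> at the single point \<open>x = 2\<close> determines the exponent.\<close>
  have M: "M = Suc e"
  proof -
    have a: "2 ^ Suc M * deriv H 2 = c * 2 ^ e * 3" using H'[of 2] by simp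
    have b: "(1 / 2) ^ Suc M * deriv H (1 / 2) = c * (1 / 2) ^ e * (- (3 / 4))"
      using H'[of "1 / 2"] by (simp add: power2_eq_square)
    have s: "deriv H 2 = - deriv H (1 / 2) / 4" using Hsym[of 2] by simp
    have b': "deriv H (1 / 2) * 2 ^ e = c * 2 ^ Suc M * (- (3 / 4))"
      using b by (simp add: power_one_over field_simps)
    have "2 ^ Suc M * (deriv H 2 * 2 ^ e) = c * 2 ^ e * 3 * 2 ^ e" using a by (simp add: mult_ac)
    moreover have "deriv H 2 * 2 ^ e = c * 2 ^ Suc M * (3 / 16)" unfolding s using b' by (simp add: field_simps)
    ultimately have "2 ^ Suc M * (c * 2 ^ Suc M * (3 / 16)) = c * 2 ^ e * 3 * 2 ^ e" by (simp only:)
    hence "(2::complex) ^ Suc M * 2 ^ Suc M = 2 ^ e * 2 ^ e * 16" using c(1) by (simp add: field_simps)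
    hence "(2::complex) ^ (Suc M + Suc M) = 2 ^ (e + e + 4)" by (simp only: power_add) simp
    hence "of_nat (2 ^ (Suc M + Suc M)) = (of_nat (2 ^ (e + e + 4)) :: complex)" by (simp only: of_nat_power of_nat_numeral)
    hence "(2::nat) ^ (Suc M + Suc M) = 2 ^ (e + e + 4)" by (simp only: of_nat_eq_iff)
    hence "Suc M + Suc M = e + e + 4" by (simp only: power_inject_exp)
    thus ?thesis by simp
  qed
  have dH: "deriv H x = c * (1 - 1 / x ^ 2)" if "x \<noteq> 0" for x
  proof -
    have "x ^ e * (x ^ 2 * deriv H x) = x ^ e * (c * (x ^ 2 - 1))"
      using H'[OF that] by (simp add: M power2_eq_square mult_ac)
    hence "x ^ 2 * deriv H x = c * (x ^ 2 - 1)" using that by simp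
    thus ?thesis using that by (simp add: field_simps)
  qed
  have "\<exists>B. \<forall>x\<in>- {0}. H x - c * (x + 1 / x) = B"
  proof (rule DERIV_zero_connected_constant[of "- {0}" "{}"])
    show "connected (- {0::complex})" by (rule connected_punctured_universe) simp
    have "(\<lambda>x. H x - c * (x + 1 / x)) holomorphic_on - {0}"
      by (intro holomorphic_intros hol) auto
    thus "continuous_on (- {0}) (\<lambda>x. H x - c * (x + 1 / x))" by (rule holomorphic_on_imp_continuous_on)
    show "\<forall>x\<in>- {0} - {}. ((\<lambda>x. H x - c * (x + 1 / x)) has_field_derivative 0) (at x)"
    proof
      fix x :: complex assume "x \<in> - {0} - {}"
      hence x: "x \<noteq> 0" by simp
      have "((\<lambda>x. H x - c * (x + 1 / x)) has_field_derivative deriv H x - c * (1 - 1 / x ^ 2)) (at x)"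
        using analytic_at_has_deriv[OF Han[OF x]] x by (auto intro!: derivative_eq_intros simp: power2_eq_square)
      thus "((\<lambda>x. H x - c * (x + 1 / x)) has_field_derivative 0) (at x)" by (simp add: dH[OF x])
    qed
  qed (use op in auto)
  then obtain B where B: "\<And>x. x \<noteq> 0 \<Longrightarrow> H x - c * (x + 1 / x) = B" by auto
  show ?thesis
  proof (rule that[OF c(1)])
    show "H x = c * (x + 1 / x) + B" if "x \<noteq> 0" for x using B[OF that] by (simp add: algebra_simps)
  qed
qed

section \<open>Periodic solutions are cosines\<close>

lemma entire_analytic_at:
  fixes f :: "complex \<Rightarrow> complex"
  assumes "f holomorphic_on UNIV" shows "f analytic_on {z}"
  using assms by (simp add: analytic_at) blast

text \<open>
  At a critical point the Schwarzian derivative has a genuine double pole, so the right-hand side must become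
  infinite too.
\<close>

lemma critical_value_is_pole:
  assumes sol: "schwarz_solution p (\<lambda>w. poly P w / poly Q w) f" and p: "p \<ge> 1"
    and f: "f holomorphic_on UNIV" and crit: "deriv f z0 = 0"
  shows "poly Q (f z0) = 0"
proof (rule ccontr)
  assume Qb: "poly Q (f z0) \<noteq> 0"
  note S = schwarz_solutionD[OF sol]
  define F where "F = (\<lambda>z. f (1 * z + z0))"
  have "(f \<circ> (\<lambda>z. 1 * z + z0)) holomorphic_on UNIV"
    by (rule holomorphic_on_compose_gen[OF _ f]) (auto intro!: holomorphic_intros)
  hence Fh: "F holomorphic_on UNIV" by (simp add: F_def o_def)
  have Fa: "F analytic_on {0}" by (rule entire_analytic_at[OF Fh])
  have F0: "F 0 = f z0" by (simp add: F_def)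
  have nc: "\<not> (\<forall>\<^sub>F z in at 0. F z = F 0)"
    using nonconstant_germ[OF S(1,2), of z0] by (simp add: F_def)
  obtain m g where mg: "m \<ge> 1" "g analytic_on {0}" "g 0 \<noteq> 0" "\<forall>\<^sub>F z in nhds 0. F z = F 0 + z ^ m * g z"
    by (rule analytic_local_factor[OF Fa nc])
  define u where "u = (\<lambda>z. of_nat m * g z + z * deriv g z)"
  have u: "u analytic_on {0}" "u 0 \<noteq> 0"
    unfolding u_def using mg by (auto intro!: analytic_intros analytic_deriv)
  have d: "\<forall>\<^sub>F z in nhds 0. deriv F z = z ^ (m - 1) * u z"
    unfolding u_def by (rule deriv_local_form[OF mg(4,2,1)])
  have "((\<lambda>z. f (1 * z + z0)) has_field_derivative deriv f z0 * 1) (at 0)"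
  proof (rule DERIV_chain2[where f = f and g = "\<lambda>z. 1 * z + z0"])
    show "(f has_field_derivative deriv f z0) (at (1 * 0 + z0))"
      using analytic_at_has_deriv[OF entire_analytic_at[OF f]] by simp
  qed (auto intro!: derivative_eq_intros)
  hence "deriv F 0 = 0" unfolding F_def by (simp add: DERIV_imp_deriv crit)
  hence "(0::complex) ^ (m - 1) = 0" using eventually_nhds_x_imp_x[OF d] u by simp
  hence m2: "m \<ge> 2" by (cases "m = 1") (use mg in auto)
  define s0 :: complex where "s0 = - (of_nat (m - 1) * (of_nat (m - 1) + 2)) / 2"
  have s0nz: "s0 \<noteq> 0" unfolding s0_def by (rule ramified_leading_coefficient_nonzero[OF m2])
  have s0: "((\<lambda>z. (z ^ 2 * schwarzian F z) ^ p) \<longlongrightarrow> s0 ^ p) (at 0)"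
    unfolding s0_def by (intro tendsto_power schwarzian_leading_coefficient[OF d u])
  have "\<forall>\<^sub>F z in at 0. schwarzian F z ^ p = poly P (F z) / poly Q (F z)"
    unfolding F_def by (rule solution_affine_local[OF sol]) auto
  hence ev: "\<forall>\<^sub>F z in at 0. (z ^ 2 * schwarzian F z) ^ p = (z ^ 2) ^ p * (poly P (F z) / poly Q (F z))"
    by eventually_elim (simp only: power_mult_distrib)
  have pt: "((\<lambda>z. poly T (F z)) \<longlongrightarrow> poly T (f z0)) (at 0)" for T
    using tendsto_at_0_of_analytic[OF analytic_on_poly_compose[OF Fa, of T]] F0 by simp
  have "((\<lambda>z. (z ^ 2) ^ p * (poly P (F z) / poly Q (F z))) \<longlongrightarrow> (0 ^ 2) ^ p * (poly P (f z0) / poly Q (f z0))) (at 0)"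
    by (intro tendsto_intros pt Qb)
  from eventually_eq_limits_eq[OF ev s0 this] have "s0 ^ p = 0" using p by (simp add: power_0_left)
  thus False using s0nz by simp
qed

text \<open>
  If the multiplicity \<open>m\<close> were at least 3, then the rotation by \<open>2 \<pi>/m\<close> would carry the period to one that is
  independent of it over the reals, and \<open>f\<close> would be constant. So \<open>m = 2\<close>, and the rotation is the half-turn.
\<close>

lemma periodic_pole_point_even:
  assumes sol: "schwarz_solution p (\<lambda>w. poly P w / poly Q w) f" and p: "p \<ge> 1"
    and cop: "coprime P Q" and Q0: "Q \<noteq> 0" and f: "f holomorphic_on UNIV"
    and t: "t \<noteq> 0" "\<And>z. f (z + t) = f z" and z0: "poly Q (f z0) = 0"
  shows "f (z0 - z) = f (z0 + z)" "deriv (deriv f) z0 \<noteq> 0"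
proof -
  note S = schwarz_solutionD[OF sol]
  have sv: "sphere_val f z0 = Fin (f z0)"
    using analytic_at_imp_no_pole[OF entire_analytic_at[OF f]] by (simp add: sphere_val_def)
  obtain m g where mg: "m \<ge> 2" "g analytic_on {0}" "g 0 \<noteq> 0" "\<forall>\<^sub>F z in nhds 0. f (z + z0) = f z0 + z ^ m * g z"
    and rot: "\<And>\<alpha> z. \<alpha> ^ m = 1 \<Longrightarrow> f (\<alpha> * z + z0) = f (z + z0)"
    by (rule pole_point_rotation[OF sol p cop Q0 sv z0]) (rule that; (assumption | blast))
  have "m = 2"
  proof (rule ccontr)
    assume "m \<noteq> 2"
    hence m3: "m \<ge> 3" using mg by simp
    define \<omega> where "\<omega> = cis (2 * pi / m)"
    have \<omega>: "\<omega> ^ m = 1" using m3 unfolding \<omega>_def Complex.DeMoivre by simp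
    have \<omega>0: "\<omega> \<noteq> 0" by (simp add: \<omega>_def)
    have "sin (2 * pi / m) > 0"
    proof (rule sin_gt_zero)
      have "2 * pi / m \<le> 2 * pi / 3" using m3 by (intro divide_left_mono) auto
      also have "\<dots> < pi" by simp
      finally show "2 * pi / m < pi" .
    qed (use m3 in auto)
    hence im: "Im \<omega> \<noteq> 0" by (simp add: \<omega>_def)
    have "f (z + \<omega> * t) = f z" for z
    proof -
      define y where "y = (z - z0) / \<omega>"
      have z: "z = \<omega> * y + z0" using \<omega>0 by (simp add: y_def)
      have "f (z + \<omega> * t) = f (\<omega> * (y + t) + z0)" unfolding z by (simp add: algebra_simps)
      also have "\<dots> = f ((y + z0) + t)" unfolding rot[OF \<omega>] by (simp add: algebra_simps)
      also have "\<dots> = f z" unfolding t(2) z rot[OF \<omega>] ..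
      finally show ?thesis .
    qed
    from doubly_periodic_entire_constant[OF f t(2) this t(1) im] S(2) show False by simp
  qed
  have "f ((- 1) * z + z0) = f (z + z0)" by (rule rot) (simp add: \<open>m = 2\<close>)
  thus "f (z0 - z) = f (z0 + z)" by (simp add: add.commute)
  have d1: "deriv (\<lambda>z. f (z + z0)) w = deriv f (w + z0)" for w
  proof (rule DERIV_imp_deriv)
    show "((\<lambda>z. f (z + z0)) has_field_derivative deriv f (w + z0)) (at w)"
      using analytic_at_has_deriv[OF entire_analytic_at[OF f], of "w + z0"]
      by (simp only: DERIV_shift)
  qed
  have ev: "\<forall>\<^sub>F z in nhds 0. deriv f (z + z0) = z * (2 * g z + z * deriv g z)"
    using deriv_local_form[OF mg(4,2)] \<open>m = 2\<close> by (simp add: d1)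
  have "(deriv f has_field_derivative deriv (deriv f) z0) (at (0 + z0))"
    using analytic_at_has_deriv[OF analytic_deriv[OF entire_analytic_at[OF f]]] by simp
  hence "((\<lambda>z. deriv f (z + z0)) has_field_derivative deriv (deriv f) z0) (at 0)" by (simp only: DERIV_shift)
  hence "deriv (deriv f) z0 = deriv (\<lambda>z. z * (2 * g z + z * deriv g z)) 0"
    using DERIV_imp_deriv eventually_nhds_x_imp_x[OF eventually_nhds_deriv_eq[OF ev]] by metis
  also have "\<dots> = 2 * g 0"
  proof (rule DERIV_imp_deriv)
    define h where "h = (\<lambda>z. 2 * g z + z * deriv g z)"
    have "h analytic_on {0}" unfolding h_def by (intro analytic_intros analytic_deriv mg)
    from analytic_at_has_deriv[OF this]
    have "((\<lambda>z. z * h z) has_field_derivative h 0) (at 0)" by (auto intro!: derivative_eq_intros)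
    thus "((\<lambda>z. z * (2 * g z + z * deriv g z)) has_field_derivative 2 * g 0) (at 0)" by (simp add: h_def)
  qed
  finally show "deriv (deriv f) z0 \<noteq> 0" using mg by simp
qed

lemma rational_bounded_at_infinity:
  fixes P Q :: "complex poly"
  assumes deg: "degree P \<le> degree Q" and Q: "Q \<noteq> 0"
  obtains R0 B where "\<And>w. norm w \<ge> R0 \<Longrightarrow> poly Q w \<noteq> 0 \<and> norm (poly P w / poly Q w) \<le> B"
proof -
  define h where "h = (\<lambda>v. v ^ (degree Q - degree P) * (poly (reflect_poly P) v / poly (reflect_poly Q) v))"
  have q0: "poly (reflect_poly Q) 0 \<noteq> 0" using Q by simp
  have an: "(\<lambda>v. poly T (id v)) analytic_on {0}" for T :: "complex poly" by (intro analytic_intros)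
  have "h analytic_on {0}"
    unfolding h_def using an[of "reflect_poly P"] an[of "reflect_poly Q"] q0 by (auto intro!: analytic_intros)
  hence "((\<lambda>v. norm (h v)) \<longlongrightarrow> norm (h 0)) (nhds 0)" by (intro tendsto_norm analytic_at_tendsto_nhds)
  hence ev1: "\<forall>\<^sub>F v in nhds 0. norm (h v) < norm (h 0) + 1" by (rule order_tendstoD) auto
  have ev2: "\<forall>\<^sub>F v in nhds 0. poly (reflect_poly Q) v \<noteq> 0"
    using eventually_nhds_nonzero[OF an[of "reflect_poly Q"], of 0] q0 by simp
  from eventually_conj[OF ev1 ev2] obtain \<delta> where \<delta>: "\<delta> > 0"
    "\<And>v. norm v < \<delta> \<Longrightarrow> norm (h v) < norm (h 0) + 1 \<and> poly (reflect_poly Q) v \<noteq> 0"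
    by (auto simp: eventually_nhds_metric dist_norm)
  show ?thesis
  proof (rule that[of "max 1 (2 / \<delta>)" "norm (h 0) + 1"])
    fix w :: complex assume w: "norm w \<ge> max 1 (2 / \<delta>)"
    have w1: "norm w \<ge> 1" "w \<noteq> 0" using w by auto
    have "1 / norm w \<le> 1 / (2 / \<delta>)" using w \<delta>(1) w1 by (intro divide_left_mono) auto
    hence v: "norm (1 / w) < \<delta>" using \<delta>(1) by (simp add: norm_divide)
    have "w ^ degree Q = w ^ degree P * w ^ (degree Q - degree P)" using deg by (simp flip: power_add)
    hence "poly P w / poly Q w = h (1 / w)"
      unfolding h_def poly_eq_reflect[OF w1(2), of P] poly_eq_reflect[OF w1(2), of Q]
      using w1 by (simp add: power_one_over)
    moreover have "poly Q w \<noteq> 0" unfolding poly_eq_reflect[OF w1(2), of Q] using w1 \<delta>(2)[OF v] by simp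
    ultimately show "poly Q w \<noteq> 0 \<and> norm (poly P w / poly Q w) \<le> norm (h 0) + 1"
      using \<delta>(2)[OF v] by simp
  qed
qed

text \<open>
  Suppose that \<open>H\<close> grows faster than every power. At the points where \<open>H\<close> looks like an exponential function of
  its argument, the term \<open>x\<^sup>2 S(H,x)\<close>, which up to the constant \<open>-1/2\<close> is the Schwarzian derivative of
  \<open>w \<mapsto> f (\<beta> w + z0)\<close>, has modulus at least \<open>a\<^sup>2/4\<close>; but \<open>|H x|\<close> is large, and there the right-hand side is
  bounded.
\<close>

lemma laurent_function_polynomial_growth:
  assumes sol: "schwarz_solution p (\<lambda>w. poly P w / poly Q w) f" and p: "p \<ge> 1" and Q0: "Q \<noteq> 0"
    and deg: "degree P \<le> degree Q" and f: "f holomorphic_on UNIV"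
    and H: "H holomorphic_on - {0}" and Hf: "\<And>w. H (exp w) = f (\<beta> * w + z0)" and \<beta>: "\<beta> \<noteq> 0"
  obtains C L r where "\<And>x. norm x \<ge> r \<Longrightarrow> norm (H x) \<le> C * norm x ^ L"
proof (rule ccontr)
  assume "\<not> thesis"
  hence neg: "\<exists>x. norm x \<ge> r \<and> norm (H x) > C * norm x ^ L" for r C L
    using that[of r C L] by (meson not_le)
  have nopoly: "\<exists>x. norm x \<ge> r \<and> norm x > 1 \<and> norm (H x) > C * norm x ^ L" for r C L
    using neg[of "max r 2" C L] by auto
  obtain R0 B where RB: "\<And>w. norm w \<ge> R0 \<Longrightarrow> poly Q w \<noteq> 0 \<and> norm (poly P w / poly Q w) \<le> B"
    by (rule rational_bounded_at_infinity[OF deg Q0]) (rule that; blast)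
  \<comment> \<open>a bound, near infinity, for the right-hand side of the equation satisfied by \<open>w \<mapsto> f (\<beta> w + z0)\<close>\<close>
  define B' where "B' = max 1 (norm \<beta> ^ (2 * p) * B)"
  obtain N :: nat where N: "max R0 (4 * (B' + 1)) \<le> real N" using real_arch_simple by blast
  have N1: "real N \<ge> 4 * (B' + 1)" "real N \<ge> R0" using N by auto
  have B'1: "B' \<ge> 1" by (simp add: B'_def)
  have N0: "N \<ge> 1" using N1 B'1 by (cases N) auto
  have "H holomorphic_on {x. norm x > 1}" by (rule holomorphic_on_subset[OF H]) auto
  from exists_schwarzian_growth_point[OF zero_less_one this nopoly, of 1 N]
  obtain x a where x': "norm x \<ge> 1" "norm x > 1" "a \<ge> real N" "a \<ge> 1" "a ^ N \<le> norm (H x)"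
    "norm x ^ N \<le> norm (H x)" "deriv H x \<noteq> 0" "norm (schwarzian H x * (x / of_real a) ^ 2 + 1 / 2) < 1 / 4"
    by blast
  note x = x'(2-5,7,8)
  have x0: "x \<noteq> 0" using x(1) by auto
  define w where "w = Ln x"
  have ew: "exp w = x" using x0 by (simp add: w_def)
  define F where "F = (\<lambda>w. f (\<beta> * w + z0))"
  have FH: "F = (\<lambda>w. H (exp w))" by (simp add: F_def Hf)
  have an_f: "f analytic_on {z}" for z by (rule entire_analytic_at[OF f])
  have op: "open (- {0::complex})" by (simp add: open_Compl)
  have an_H: "H analytic_on {exp w}"
    using H op x0 unfolding ew by (simp add: analytic_at) blast
  have an_e: "exp analytic_on {w}" by (intro analytic_intros)
  have de: "deriv exp w = x" using DERIV_imp_deriv[OF DERIV_exp, of w] by (simp add: ew)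
  have S1: "schwarzian F w = schwarzian H x * x ^ 2 + schwarzian exp w"
    unfolding FH using schwarzian_compose[OF an_e an_H] de x(5) x0 by (simp add: ew)
  have Se: "schwarzian exp w = - 1 / 2" using schwarzian_exp[of 1 w] by simp
  have dF1: "deriv F w = deriv H x * x"
  proof (rule DERIV_imp_deriv)
    have "(H has_field_derivative deriv H x) (at (exp w))" using analytic_at_has_deriv[OF an_H] by (simp add: ew)
    from DERIV_chain2[OF this DERIV_exp] show "(F has_field_derivative deriv H x * x) (at w)" unfolding FH ew .
  qed
  have dF2: "deriv F w = deriv f (\<beta> * w + z0) * \<beta>"
  proof (rule DERIV_imp_deriv, unfold F_def, rule DERIV_chain2[where f = f and g = "\<lambda>w. \<beta> * w + z0"])
    show "(f has_field_derivative deriv f (\<beta> * w + z0)) (at (\<beta> * w + z0))" by (rule analytic_at_has_deriv[OF an_f])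
  qed (auto intro!: derivative_eq_intros)
  have df: "deriv f (\<beta> * w + z0) \<noteq> 0" using dF1 dF2 x(5) x0 by auto
  have S2: "schwarzian F w = \<beta> ^ 2 * schwarzian f (\<beta> * w + z0)"
    unfolding F_def by (rule schwarzian_affine_inner[OF an_f df \<beta>])
  have fH: "f (\<beta> * w + z0) = H x" using Hf[of w] by (simp add: ew)
  have "a ^ 1 \<le> a ^ N" using x(3) N0 by (intro power_increasing) auto
  hence big: "norm (H x) \<ge> R0" using x(2,4) N1 by simp
  have eq: "schwarzian f (\<beta> * w + z0) ^ p = poly P (H x) / poly Q (H x)"
    using schwarz_solution_pointwise[OF schwarz_solutionD(3)[OF sol] an_f df] RB[OF big] by (simp add: fH)
  have "schwarzian F w ^ p = \<beta> ^ (2 * p) * (poly P (H x) / poly Q (H x))"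
    unfolding S2 eq[symmetric] by (simp only: power_mult_distrib power_mult)
  hence "norm (schwarzian F w) ^ p = norm \<beta> ^ (2 * p) * norm (poly P (H x) / poly Q (H x))"
    by (metis norm_mult norm_power)
  also have "\<dots> \<le> norm \<beta> ^ (2 * p) * B" using RB[OF big] by (intro mult_left_mono) auto
  also have "\<dots> \<le> B'" by (simp add: B'_def)
  finally have up: "norm (schwarzian F w) ^ p \<le> B'" .
  have "norm (schwarzian H x * (x / of_real a) ^ 2) \<ge> 1 / 4"
    using x(6) norm_triangle_ineq2[of "1 / 2" "- (schwarzian H x * (x / of_real a) ^ 2)"] by (simp add: add.commute)
  hence "norm (schwarzian H x * x ^ 2) \<ge> a ^ 2 / 4"
    using x(3) by (simp add: norm_mult norm_power norm_divide power_divide field_simps)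
  moreover have "norm (schwarzian F w) \<ge> norm (schwarzian H x * x ^ 2) - 1 / 2"
    using norm_triangle_ineq2[of "schwarzian H x * x ^ 2" "1 / 2"] unfolding S1 Se by simp
  moreover have "a ^ 2 / 4 \<ge> B' + 1"
  proof -
    have "a \<le> a ^ 2" using x(3) by (simp add: power2_eq_square mult_le_cancel_left1)
    moreover have "real N \<ge> 4 * B' + 4" using N1 by simp
    ultimately show ?thesis using x(2) by linarith
  qed
  ultimately have low: "norm (schwarzian F w) > B'" by linarith
  hence "norm (schwarzian F w) ^ 1 \<le> norm (schwarzian F w) ^ p" using B'1 p by (intro power_increasing) auto
  thus False using up low by simp
qed

text \<open>
  With a minimal period \<open>t\<close>, the solution is a function \<open>H\<close> of \<open>x = exp (2 \<pi> \<i> (z - z0)/t)\<close>, and evenness about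
  \<open>z0\<close> becomes \<open>H (1/x) = H x\<close>. Every critical point is a centre of evenness; two half-turns compose to a translation
  by twice the distance of their centres, so by minimality critical points occur at \<open>x = 1\<close> and \<open>x = -1\<close> only.
  Therefore \<open>H x = A (x + 1/x) + B\<close>.
\<close>

theorem periodic_solution_is_cosine:
  assumes sol: "schwarz_solution p (\<lambda>w. poly P w / poly Q w) f" and p: "p \<ge> 1"
    and cop: "coprime P Q" and Q0: "Q \<noteq> 0" and deg: "degree P \<le> degree Q"
    and f: "f holomorphic_on UNIV" and t0: "t0 \<noteq> 0" "\<And>z. f (z + t0) = f z" and z0: "poly Q (f z0) = 0"
  obtains A B s where "A \<noteq> 0" "s \<noteq> 0" "\<And>z. f z = A * cos (s * (z - z0)) + B"
proof -
  note S = schwarz_solutionD[OF sol]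
  obtain t where t: "t \<noteq> 0" "\<And>z. f (z + t) = f z"
    and min: "\<And>\<tau>. (\<And>z. f (z + \<tau>) = f z) \<Longrightarrow> \<exists>n::int. \<tau> = of_int n * t"
    by (rule minimal_period_exists[OF f S(2) t0]) (rule that; blast)
  note even = periodic_pole_point_even[OF sol p cop Q0 f t]
  define \<beta> where "\<beta> = t / (2 * of_real pi * \<i>)"
  have \<beta>: "\<beta> \<noteq> 0" using t by (simp add: \<beta>_def)
  define F where "F = (\<lambda>w. f (\<beta> * w + z0))"
  have "(f \<circ> (\<lambda>w. \<beta> * w + z0)) holomorphic_on UNIV"
    by (rule holomorphic_on_compose_gen[OF _ f]) (auto intro!: holomorphic_intros)
  hence Fh: "F holomorphic_on UNIV" by (simp add: F_def o_def)
  have Fper: "F (w + 2 * of_real pi * \<i>) = F w" for w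
  proof -
    have "\<beta> * (w + 2 * of_real pi * \<i>) + z0 = (\<beta> * w + z0) + t"
      using \<beta> by (simp add: \<beta>_def field_simps)
    thus ?thesis unfolding F_def by (simp only: t(2))
  qed
  define H where "H = (\<lambda>x. F (Ln x))"
  have H: "H holomorphic_on - {0}" "\<And>w. H (exp w) = F w"
    unfolding H_def by (rule periodic_factors_through_exp[OF Fh Fper])+
  have Hf: "H (exp w) = f (\<beta> * w + z0)" for w using H(2)[of w] by (simp add: F_def)
  have op: "open (- {0::complex})" by (simp add: open_Compl)
  have Han: "H analytic_on {x}" if "x \<noteq> 0" for x
    using H(1) op that by (simp add: analytic_at) blast
  have dH: "deriv H (exp w) * exp w = deriv f (\<beta> * w + z0) * \<beta>" for w
  proof -
    have "((\<lambda>w. H (exp w)) has_field_derivative deriv H (exp w) * exp w) (at w)"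
      by (rule DERIV_chain2[OF analytic_at_has_deriv[OF Han] DERIV_exp]) simp
    moreover have "((\<lambda>w. f (\<beta> * w + z0)) has_field_derivative deriv f (\<beta> * w + z0) * \<beta>) (at w)"
      by (rule DERIV_chain2[where f = f and g = "\<lambda>w. \<beta> * w + z0", OF analytic_at_has_deriv[OF entire_analytic_at[OF f]]])
         (auto intro!: derivative_eq_intros)
    ultimately show ?thesis unfolding Hf using DERIV_unique by blast
  qed
  have dH2: "deriv (deriv H) (exp w) * exp w * exp w + deriv H (exp w) * exp w = deriv (deriv f) (\<beta> * w + z0) * \<beta> * \<beta>" for w
  proof -
    have "((\<lambda>w. deriv H (exp w)) has_field_derivative deriv (deriv H) (exp w) * exp w) (at w)"
      by (rule DERIV_chain2[OF analytic_at_has_deriv[OF analytic_deriv[OF Han]] DERIV_exp]) simp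
    hence "((\<lambda>w. deriv H (exp w) * exp w) has_field_derivative
        (deriv (deriv H) (exp w) * exp w) * exp w + deriv H (exp w) * exp w) (at w)"
      by (auto intro!: derivative_eq_intros)
    moreover have "((\<lambda>w. deriv f (\<beta> * w + z0)) has_field_derivative deriv (deriv f) (\<beta> * w + z0) * \<beta>) (at w)"
      by (rule DERIV_chain2[where f = "deriv f" and g = "\<lambda>w. \<beta> * w + z0",
            OF analytic_at_has_deriv[OF analytic_deriv[OF entire_analytic_at[OF f]]]])
         (auto intro!: derivative_eq_intros)
    hence "((\<lambda>w. deriv f (\<beta> * w + z0) * \<beta>) has_field_derivative deriv (deriv f) (\<beta> * w + z0) * \<beta> * \<beta>) (at w)"
      by (rule DERIV_cmult_right)
    ultimately show ?thesis unfolding dH using DERIV_unique by blast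
  qed
  have sym: "H (1 / x) = H x" if "x \<noteq> 0" for x
  proof -
    have x: "x = exp (Ln x)" using that by simp
    have "1 / x = exp (- Ln x)" using that by (simp add: exp_minus field_simps)
    hence "H (1 / x) = f (z0 - \<beta> * Ln x)" using Hf[of "- Ln x"] by simp
    also have "\<dots> = f (z0 + \<beta> * Ln x)" by (rule even(1)[OF z0])
    also have "\<dots> = H x" by (subst (2) x, subst Hf) (simp add: add.commute)
    finally show ?thesis .
  qed
  have dcrit: "deriv f (\<beta> * w + z0) = 0" if "deriv H (exp w) = 0" for w
    using dH[of w] that \<beta> by simp
  have crit: "x = 1 \<or> x = - 1" if "x \<noteq> 0" "deriv H x = 0" for x
  proof -
    define w where "w = Ln x"
    have x: "x = exp w" using that by (simp add: w_def)
    define z1 where "z1 = \<beta> * w + z0"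
    have "deriv f z1 = 0" using dcrit[of w] that x by (simp add: z1_def)
    hence Q1: "poly Q (f z1) = 0" by (rule critical_value_is_pole[OF sol p f])
    have "f (z + 2 * (z1 - z0)) = f z" for z
    proof -
      have "f (z + 2 * (z1 - z0)) = f (z1 + (z + z1 - 2 * z0))" by (simp add: algebra_simps)
      also have "\<dots> = f (z1 - (z + z1 - 2 * z0))" by (rule even(1)[OF Q1, symmetric])
      also have "z1 - (z + z1 - 2 * z0) = z0 - (z - z0)" by (simp add: algebra_simps)
      also have "f (z0 - (z - z0)) = f (z0 + (z - z0))" by (rule even(1)[OF z0])
      finally show ?thesis by simp
    qed
    from min[OF this] obtain n :: int where "2 * (z1 - z0) = of_int n * t" by blast
    hence "2 * \<beta> * w = of_int n * (2 * of_real pi * \<i> * \<beta>)"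
      using t by (simp add: z1_def \<beta>_def)
    hence "\<beta> * (2 * w) = \<beta> * (of_int n * (2 * of_real pi * \<i>))" by (simp add: mult_ac)
    hence "2 * w = of_int n * (2 * of_real pi * \<i>)" using \<beta> by (simp only: mult_cancel_left) simp
    hence "exp (2 * w) = exp (2 * of_int n * of_real pi * \<i>)" by (simp add: mult_ac)
    also have "\<dots> = 1" unfolding exp_eq_1 by (auto intro!: exI[of _ n])
    finally have "x ^ 2 = 1" unfolding x by (simp add: exp_double)
    thus ?thesis by (simp add: power2_eq_1_iff)
  qed
  have simple: "deriv (deriv H) x \<noteq> 0" if "x \<noteq> 0" "deriv H x = 0" for x
  proof -
    define w where "w = Ln x"
    have x: "x = exp w" using that by (simp add: w_def)
    have "deriv f (\<beta> * w + z0) = 0" using dcrit[of w] that x by simp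
    hence "poly Q (f (\<beta> * w + z0)) = 0" by (rule critical_value_is_pole[OF sol p f])
    hence "deriv (deriv f) (\<beta> * w + z0) \<noteq> 0" by (rule even(2))
    thus ?thesis using dH2[of w] that \<beta> unfolding x by auto
  qed
  obtain C L r where growth: "\<And>x. norm x \<ge> r \<Longrightarrow> norm (H x) \<le> C * norm x ^ L"
    by (rule laurent_function_polynomial_growth[OF sol p Q0 deg f H(1) Hf \<beta>]) (rule that; blast)
  obtain A B where AB: "A \<noteq> 0" "\<And>x. x \<noteq> 0 \<Longrightarrow> H x = A * (x + 1 / x) + B"
    by (rule symmetric_laurent_form[OF H(1) sym growth crit simple]) (assumption | (rule that; blast))+
  show ?thesis
  proof (rule that[of "2 * A" "2 * of_real pi / t" B])
    fix z
    define \<theta> where "\<theta> = 2 * of_real pi / t * (z - z0)"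
    have \<theta>: "\<beta> * (\<i> * \<theta>) + z0 = z" using t by (simp add: \<beta>_def \<theta>_def)
    have "f z = H (exp (\<i> * \<theta>))" unfolding Hf \<theta> ..
    also have "\<dots> = A * (exp (\<i> * \<theta>) + exp (- (\<i> * \<theta>))) + B"
      by (simp add: AB(2) exp_minus field_simps)
    also have "\<dots> = 2 * A * cos \<theta> + B" by (simp add: cos_exp_eq)
    finally show "f z = 2 * A * cos (2 * of_real pi / t * (z - z0)) + B" by (simp add: \<theta>_def)
  qed (use AB t in auto)
qed

text \<open>
  A period moves a pole to infinitely many others, so a periodic function with finitely many poles has none.
\<close>

theorem finite_poles_solution_is_cosine:
  assumes sol: "schwarz_solution p (\<lambda>w. poly P w / poly Q w) f" and p: "p \<ge> 1"
    and cop: "coprime P Q" and Q0: "Q \<noteq> 0" and nonconst: "degree P > 0 \<or> degree Q > 0"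
    and tr: "transcendental f" and fin: "finite {z. is_pole f z}"
  obtains A B s z0 where "A \<noteq> 0" "s \<noteq> 0" "\<And>z. f z = A * cos (s * (z - z0)) + B"
proof -
  note S = schwarz_solutionD[OF sol]
  have deg: "degree P \<le> degree Q" by (rule exceptional_infinity_degree_le[OF sol Q0 tr fin])
  hence dQ: "degree Q \<noteq> 0" using nonconst by auto
  obtain a where a: "poly Q a = 0" using complex_poly_root_exists[OF dQ] by blast
  have inf: "infinite {z. sphere_val f z = Fin a}"
    by (rule pole_value_attained_infinitely_often[OF sol Q0 a cop tr])
  obtain t where t: "t \<noteq> 0" "\<And>z. f (z + t) = f z"
    by (rule infinitely_attained_pole_imp_period[OF sol p cop Q0 a inf]) (rule that; blast)
  have "\<not> is_pole f z" for z
  proof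
    assume "is_pole f z"
    have step: "is_pole f (y + t)" if "is_pole f y" for y
    proof -
      have "is_pole f (1 * (y + t) + - t)" using that by simp
      hence p: "filterlim f at_infinity (at (1 * (y + t) + - t))" unfolding is_pole_def .
      have "filterlim (\<lambda>w. 1 * w + - t) (at (1 * (y + t) + - t)) (at (y + t))"
      proof (rule filterlim_atI)
        show "((\<lambda>w. 1 * w + - t) \<longlongrightarrow> 1 * (y + t) + - t) (at (y + t))" by (intro tendsto_intros)
        show "\<forall>\<^sub>F w in at (y + t). 1 * w + - t \<noteq> 1 * (y + t) + - t"
          using eventually_neq_at_within[of "y + t" "y + t" UNIV] by eventually_elim auto
      qed
      from filterlim_compose[OF p this] have "is_pole (\<lambda>w. f (1 * w + - t)) (y + t)"
        unfolding is_pole_def .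
      moreover have "f (1 * w + - t) = f w" for w using t(2)[of "w - t"] by simp
      ultimately show ?thesis by simp
    qed
    have "is_pole f (z + of_nat n * t)" for n
    proof (induction n)
      case (Suc n)
      from step[OF this] show ?case by (simp add: algebra_simps)
    qed (use \<open>is_pole f z\<close> in simp)
    hence "range (\<lambda>n::nat. z + of_nat n * t) \<subseteq> {z. is_pole f z}" by auto
    moreover have "inj (\<lambda>n::nat. z + of_nat n * t)" using t by (auto simp: inj_on_def)
    ultimately show False using fin finite_subset range_inj_infinite by blast
  qed
  hence "f analytic_on UNIV" using S(1) by (intro nicely_meromorphic_without_singularities) auto
  hence f: "f holomorphic_on UNIV" by (rule analytic_imp_holomorphic)
  obtain z0 where "sphere_val f z0 = Fin a" using inf by (metis (mono_tags, lifting) empty_Collect_eq finite.emptyI)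
  hence "poly Q (f z0) = 0" using a by (auto simp: sphere_val_def split: if_splits)
  show ?thesis
    by (rule periodic_solution_is_cosine[OF sol p cop Q0 deg f t \<open>poly Q (f z0) = 0\<close>])
       (assumption | (rule that; (assumption | blast)))+
qed

section \<open>Moebius changes of variable in the equation\<close>

lemma coprime_if_no_common_root:
  fixes P Q :: "complex poly"
  assumes Q: "Q \<noteq> 0" and no: "\<And>z. poly P z = 0 \<Longrightarrow> poly Q z \<noteq> 0"
  shows "coprime P Q"
proof (rule coprimeI)
  fix D assume D: "D dvd P" "D dvd Q"
  have D0: "D \<noteq> 0" using D Q by auto
  have "degree D = 0"
  proof (rule ccontr)
    assume "degree D \<noteq> 0"
    then obtain z where "poly D z = 0" by (rule complex_poly_root_exists)
    hence "poly P z = 0" "poly Q z = 0" using D by (auto simp: dvd_def)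
    thus False using no by blast
  qed
  thus "is_unit D" using D0 by (metis degree_eq_zeroE is_unit_const_poly_iff is_unit_triv pCons_0_0 dvd_field_iff)
qed

lemma rational_reduced_form:
  fixes P Q :: "complex poly"
  assumes "Q \<noteq> 0"
  shows "\<exists>P' Q'. coprime P' Q' \<and> Q' \<noteq> 0 \<and> (\<forall>w. poly Q w \<noteq> 0 \<longrightarrow> poly P w / poly Q w = poly P' w / poly Q' w)"
  using assms
proof (induction "degree Q" arbitrary: P Q rule: less_induct)
  case less
  show ?case
  proof (cases "\<exists>z. poly P z = 0 \<and> poly Q z = 0")
    case False
    hence "coprime P Q" using less.prems by (intro coprime_if_no_common_root) auto
    thus ?thesis using less.prems by blast
  next
    case True
    then obtain z where "poly P z = 0" "poly Q z = 0" by blast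
    then obtain P1 Q1 where PQ: "P = [:- z, 1:] * P1" "Q = [:- z, 1:] * Q1"
      unfolding poly_eq_0_iff_dvd dvd_def by blast
    have Q1: "Q1 \<noteq> 0" using PQ less.prems by auto
    have "degree Q = Suc (degree Q1)" unfolding PQ(2) using Q1 by (subst degree_mult_eq) auto
    hence lt: "degree Q1 < degree Q" by simp
    obtain P' Q' where *: "coprime P' Q'" "Q' \<noteq> 0"
      "\<And>w. poly Q1 w \<noteq> 0 \<Longrightarrow> poly P1 w / poly Q1 w = poly P' w / poly Q' w"
      using less.hyps[OF lt Q1, of P1] by blast
    have "poly P w / poly Q w = poly P' w / poly Q' w" if "poly Q w \<noteq> 0" for w
    proof -
      have nz: "w - z \<noteq> 0" "poly Q1 w \<noteq> 0" using that unfolding PQ(2) by auto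
      have "poly P w / poly Q w = ((w - z) * poly P1 w) / ((w - z) * poly Q1 w)"
        unfolding PQ poly_mult by (simp only: poly_pCons poly_0) simp
      also have "\<dots> = poly P1 w / poly Q1 w" using nz(1) by (rule mult_divide_mult_cancel_left)
      finally show ?thesis using *(3)[OF nz(2)] by simp
    qed
    thus ?thesis using * by blast
  qed
qed

lemma poly_homogenize_moebius:
  fixes P :: "complex poly"
  assumes "degree P \<le> D"
  obtains P1 where "\<And>w. c * w + d \<noteq> 0 \<Longrightarrow> poly P1 w = (c * w + d) ^ D * poly P ((a * w + b) / (c * w + d))"
proof -
  define P1 where "P1 = (\<Sum>i\<le>degree P. smult (coeff P i) ([:b, a:] ^ i * [:d, c:] ^ (D - i)))"
  show ?thesis
  proof (rule that[of P1])
    fix w assume nz: "c * w + d \<noteq> 0"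
    have "poly P1 w = (\<Sum>i\<le>degree P. coeff P i * ((a * w + b) ^ i * (c * w + d) ^ (D - i)))"
      by (simp add: P1_def poly_sum poly_power algebra_simps)
    also have "\<dots> = (\<Sum>i\<le>degree P. (c * w + d) ^ D * (coeff P i * ((a * w + b) / (c * w + d)) ^ i))"
    proof (intro sum.cong refl)
      fix i assume "i \<in> {..degree P}"
      hence "(c * w + d) ^ D = (c * w + d) ^ i * (c * w + d) ^ (D - i)" using assms by (simp flip: power_add)
      thus "coeff P i * ((a * w + b) ^ i * (c * w + d) ^ (D - i))
          = (c * w + d) ^ D * (coeff P i * ((a * w + b) / (c * w + d)) ^ i)"
        using nz by (simp add: power_divide)
    qed
    also have "\<dots> = (c * w + d) ^ D * poly P ((a * w + b) / (c * w + d))"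
      by (simp add: poly_altdef sum_distrib_left)
    finally show "poly P1 w = (c * w + d) ^ D * poly P ((a * w + b) / (c * w + d))" .
  qed
qed

text \<open>
  Clearing denominators by a common power of \<open>c w + d\<close> gives polynomials, and cancelling common roots makes
  them coprime; neither step matters off a finite set.
\<close>

lemma rational_moebius_pullback:
  fixes P Q :: "complex poly"
  assumes Q: "Q \<noteq> 0" and det: "a * d - b * c \<noteq> (0::complex)"
  obtains P' Q' where "coprime P' Q'" "Q' \<noteq> 0"
    "finite {w. c * w + d = 0 \<or> poly P ((a * w + b) / (c * w + d)) / poly Q ((a * w + b) / (c * w + d)) \<noteq> poly P' w / poly Q' w}"
proof -
  define D where "D = max (degree P) (degree Q)"
  have leP: "degree P \<le> D" and leQ: "degree Q \<le> D" by (simp_all add: D_def)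
  obtain P1 where P1: "\<And>w. c * w + d \<noteq> 0 \<Longrightarrow> poly P1 w = (c * w + d) ^ D * poly P ((a * w + b) / (c * w + d))"
    by (rule poly_homogenize_moebius[OF leP, of c d a b]) (rule that; blast)
  obtain Q1 where Q1: "\<And>w. c * w + d \<noteq> 0 \<Longrightarrow> poly Q1 w = (c * w + d) ^ D * poly Q ((a * w + b) / (c * w + d))"
    by (rule poly_homogenize_moebius[OF leQ, of c d a b]) (rule that; blast)
  have Q1nz: "Q1 \<noteq> 0"
  proof -
    have "finite {v. poly Q v = 0}" by (rule poly_roots_finite[OF Q])
    moreover have "[:a, - c:] \<noteq> 0" using det by auto
    hence "finite {v. poly [:a, - c:] v = 0}" by (rule poly_roots_finite)
    ultimately have "finite ({v. poly Q v = 0} \<union> {v. poly [:a, - c:] v = 0})" by blast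
    from ex_new_if_finite[OF infinite_UNIV_char_0 this]
    obtain v where v: "poly Q v \<noteq> 0" "a - v * c \<noteq> 0" by auto
    \<comment> \<open>\<open>w\<close> is the preimage of \<open>v\<close> under the Moebius transformation.\<close>
    define w where "w = (d * v - b) / (a - v * c)"
    have cw: "c * w + d = (a * d - b * c) / (a - v * c)" using v by (simp add: w_def field_simps)
    have aw: "a * w + b = v * (a * d - b * c) / (a - v * c)" using v by (simp add: w_def field_simps)
    have "c * w + d \<noteq> 0" using cw det v by simp
    moreover have "(a * w + b) / (c * w + d) = v" unfolding cw aw using det v by simp
    ultimately have "poly Q1 w \<noteq> 0" using Q1[of w] v by simp
    thus ?thesis by auto
  qed
  obtain P' Q' where PQ: "coprime P' Q'" "Q' \<noteq> 0"
    "\<And>w. poly Q1 w \<noteq> 0 \<Longrightarrow> poly P1 w / poly Q1 w = poly P' w / poly Q' w"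
    using rational_reduced_form[OF Q1nz] by blast
  show ?thesis
  proof (rule that[OF PQ(1,2)])
    have "[:d, c:] \<noteq> 0" using det by auto
    hence fin: "finite ({w. poly [:d, c:] w = 0} \<union> {w. poly Q1 w = 0})"
      using poly_roots_finite Q1nz by blast
    show "finite {w. c * w + d = 0 \<or> poly P ((a * w + b) / (c * w + d)) / poly Q ((a * w + b) / (c * w + d)) \<noteq> poly P' w / poly Q' w}"
    proof (rule finite_subset[OF _ fin], rule subsetI, rule ccontr)
      fix w assume w: "w \<in> {w. c * w + d = 0 \<or> poly P ((a * w + b) / (c * w + d)) / poly Q ((a * w + b) / (c * w + d)) \<noteq> poly P' w / poly Q' w}"
        and nw: "w \<notin> {w. poly [:d, c:] w = 0} \<union> {w. poly Q1 w = 0}"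
      have nz: "c * w + d \<noteq> 0" "poly Q1 w \<noteq> 0" using nw by (auto simp: algebra_simps)
      have "poly P ((a * w + b) / (c * w + d)) / poly Q ((a * w + b) / (c * w + d)) = poly P1 w / poly Q1 w"
        using P1[OF nz(1)] Q1[OF nz(1)] nz by simp
      thus False using w nz PQ(3)[OF nz(2)] by simp
    qed
  qed
qed

lemma nicely_meromorphic_avoid_finite:
  assumes "f nicely_meromorphic_on UNIV" "\<not> f constant_on UNIV" "finite E"
  shows "\<forall>\<^sub>\<approx>z. f z \<notin> E"
proof -
  have "\<forall>\<^sub>\<approx>z. \<forall>e\<in>E. f z \<noteq> e"
    using nicely_meromorphic_avoid[OF assms(1,2)] by (simp add: eventually_ball_finite_distrib assms(3))
  thus ?thesis by eventually_elim auto
qed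

text \<open>
  There are only finitely many \<open>p\<close>-th roots of \<open>K\<close>, and a meromorphic function takes a value almost everywhere
  or almost nowhere.
\<close>

lemma meromorphic_root_constant:
  assumes h: "h meromorphic_on UNIV" and p: "p > 0" and eq: "\<forall>\<^sub>\<approx>z. h z ^ p = K"
  obtains C where "C ^ p = K" "\<forall>\<^sub>\<approx>z. h z = C"
proof (rule ccontr)
  assume "\<not> thesis"
  hence no: "C ^ p = K \<Longrightarrow> \<not> (\<forall>\<^sub>\<approx>z. h z = C)" for C using that by blast
  have "\<forall>\<^sub>\<approx>z. h z \<noteq> C" if "C \<in> {C. C ^ p = K}" for C
    using meromorphic_imp_constant_or_avoid[OF h open_UNIV connected_UNIV, of C] no[of C] that by blast
  hence "\<forall>\<^sub>\<approx>z. \<forall>C\<in>{C. C ^ p = K}. h z \<noteq> C"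
    by (subst eventually_ball_finite_distrib[OF finite_complex_roots[OF p]]) blast
  from cosparse_ex[OF eventually_conj[OF eq this]] show False by auto
qed

text \<open>
  Extraction of the \<open>p\<close>-th root: the quotient of the Schwarzian derivative by \<open>T(u)\<close> is a meromorphic
  function whose \<open>p\<close>-th power is 1, hence a constant root of unity.
\<close>

lemma reduces_toI:
  fixes a b c d :: complex
  assumes det: "a * d - b * c \<noteq> 0" and p: "p > 0" and E: "finite E"
    and R: "\<And>w. w \<notin> E \<Longrightarrow> c * w + d \<noteq> 0 \<Longrightarrow> R ((a * w + b) / (c * w + d)) = T w ^ p"
    and Tm: "\<And>u. u meromorphic_on UNIV \<Longrightarrow> (\<lambda>z. T (u z)) meromorphic_on UNIV"
    and T0: "\<And>w. w \<notin> E \<Longrightarrow> T w \<noteq> 0"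
  shows "reduces_to p R (moebius a b c d) T"
  unfolding reduces_to_def
proof (intro conjI allI impI)
  show "\<forall>\<^sub>\<approx>w. \<forall>v. moebius a b c d (Fin w) = Fin v \<longrightarrow> R v = T w ^ p"
    using cosparse_not_in_finite[OF E] by eventually_elim (use R in \<open>auto split: if_splits\<close>)
next
  fix f u assume "f nicely_meromorphic_on UNIV \<and> u nicely_meromorphic_on UNIV \<and> moebius_related f (moebius a b c d) u"
  hence f: "f nicely_meromorphic_on UNIV" and u: "u nicely_meromorphic_on UNIV"
    and rel: "moebius_related f (moebius a b c d) u" by auto
  have const: "f constant_on UNIV \<longleftrightarrow> u constant_on UNIV" by (rule moebius_related_constant_iff[OF rel det f u])
  show "schwarz_solution p R f \<longleftrightarrow> (\<exists>\<omega>. \<omega> ^ p = 1 \<and> schwarz_solution 1 (\<lambda>w. \<omega> * T w) u)"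
  proof (cases "u constant_on UNIV")
    case True
    thus ?thesis using const by (simp add: schwarz_solution_def)
  next
    case False
    have key: "\<forall>\<^sub>\<approx>z. schwarzian f z = schwarzian u z \<and> R (f z) = T (u z) ^ p \<and> T (u z) \<noteq> 0"
      using moebius_related_schwarzian[OF rel det u False] moebius_related_formula[OF rel det u False]
        nicely_meromorphic_avoid_finite[OF u False E]
      by eventually_elim (use R T0 in auto)
    show ?thesis
    proof
      assume "schwarz_solution p R f"
      hence "\<forall>\<^sub>\<approx>z. schwarzian f z ^ p = R (f z)" by (simp add: schwarz_solution_def)
      hence "\<forall>\<^sub>\<approx>z. (schwarzian u z / T (u z)) ^ p = 1"
        using key by eventually_elim (simp add: power_divide)
      moreover have "(\<lambda>z. schwarzian u z / T (u z)) meromorphic_on UNIV"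
        by (intro meromorphic_intros Tm nicely_meromorphic_imp_meromorphic[OF u])
      ultimately obtain \<omega> where \<omega>: "\<omega> ^ p = 1" "\<forall>\<^sub>\<approx>z. schwarzian u z / T (u z) = \<omega>"
        using meromorphic_root_constant[OF _ p] by blast
      have "\<forall>\<^sub>\<approx>z. schwarzian u z ^ 1 = \<omega> * T (u z)"
        using \<omega>(2) key by eventually_elim (auto simp: field_simps)
      thus "\<exists>\<omega>. \<omega> ^ p = 1 \<and> schwarz_solution 1 (\<lambda>w. \<omega> * T w) u"
        using \<omega>(1) u False by (auto simp: schwarz_solution_def)
    next
      assume "\<exists>\<omega>. \<omega> ^ p = 1 \<and> schwarz_solution 1 (\<lambda>w. \<omega> * T w) u"
      then obtain \<omega> where \<omega>: "\<omega> ^ p = 1" "\<forall>\<^sub>\<approx>z. schwarzian u z ^ 1 = \<omega> * T (u z)"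
        by (auto simp: schwarz_solution_def)
      have "\<forall>\<^sub>\<approx>z. schwarzian f z ^ p = R (f z)"
        using \<omega>(2) key by eventually_elim (simp add: power_mult_distrib \<omega>(1))
      thus "schwarz_solution p R f" using f False const by (simp add: schwarz_solution_def)
    qed
  qed
qed

section \<open>Functions with equal Schwarzian derivatives\<close>

text \<open>
  The coefficient has a primitive on the disc, and this provides an integrating factor.
\<close>

lemma linear_ode_unique_zero:
  fixes \<delta> \<phi> :: "complex \<Rightarrow> complex"
  assumes "\<phi> holomorphic_on ball z0 r" and r: "r > 0"
    and d: "\<And>z. z \<in> ball z0 r \<Longrightarrow> (\<delta> has_field_derivative \<phi> z * \<delta> z) (at z)" and 0: "\<delta> z0 = 0"
    and z: "z \<in> ball z0 r"
  shows "\<delta> z = 0"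
proof -
  obtain \<Phi> where \<Phi>: "\<And>x. x \<in> ball z0 r \<Longrightarrow> (\<Phi> has_field_derivative \<phi> x) (at x within ball z0 r)"
    by (rule holomorphic_convex_primitive'[OF convex_ball open_ball assms(1)]) (rule that; blast)
  have "\<exists>c. \<forall>x\<in>ball z0 r. \<delta> x * exp (- \<Phi> x) = c"
  proof (rule has_field_derivative_zero_constant[OF convex_ball])
    fix x assume x: "x \<in> ball z0 r"
    have "(\<delta> has_field_derivative \<phi> x * \<delta> x) (at x within ball z0 r)"
      using d[OF x] has_field_derivative_at_within by blast
    with \<Phi>[OF x] show "((\<lambda>x. \<delta> x * exp (- \<Phi> x)) has_field_derivative 0) (at x within ball z0 r)"
      by (auto intro!: derivative_eq_intros simp: algebra_simps)
  qed
  then obtain c where c: "\<And>x. x \<in> ball z0 r \<Longrightarrow> \<delta> x * exp (- \<Phi> x) = c" by blast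
  have "c = 0" using c[of z0] r 0 by simp
  thus ?thesis using c[OF z] by simp
qed

text \<open>
  The equation \<open>N' = S + N\<^sup>2/2\<close> makes the difference of the two functions \<open>f''/f'\<close> and \<open>g''/g'\<close> a solution
  of a homogeneous linear equation of first order. It vanishes at \<open>z0\<close>, hence identically; then the same happens to
  \<open>f' - g'\<close> and to \<open>f - g\<close>.
\<close>

lemma schwarzian_determines_germ:
  assumes r: "r > 0" and f: "f holomorphic_on ball z0 r" "\<And>z. z \<in> ball z0 r \<Longrightarrow> deriv f z \<noteq> 0"
    and g: "g holomorphic_on ball z0 r" "\<And>z. z \<in> ball z0 r \<Longrightarrow> deriv g z \<noteq> 0"
    and S: "\<And>z. z \<in> ball z0 r \<Longrightarrow> schwarzian f z = schwarzian g z"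
    and jet: "f z0 = g z0" "deriv f z0 = deriv g z0" "(deriv ^^ 2) f z0 = (deriv ^^ 2) g z0"
    and z: "z \<in> ball z0 r"
  shows "f z = g z"
proof -
  have an: "f analytic_on {z}" "g analytic_on {z}" if "z \<in> ball z0 r" for z
    using f(1) g(1) that by (auto simp: analytic_at intro!: exI[of _ "ball z0 r"])
  note pa = preschwarzian_analytic[OF an(1) f(2)] preschwarzian_analytic[OF an(2) g(2)]
  define \<phi> where "\<phi> = (\<lambda>z. 1 / 2 * (preschwarzian f z + preschwarzian g z))"
  have \<phi>: "\<phi> holomorphic_on ball z0 r"
  proof (rule analytic_imp_holomorphic, subst analytic_on_analytic_at, rule ballI)
    fix z assume "z \<in> ball z0 r"
    thus "\<phi> analytic_on {z}" unfolding \<phi>_def by (intro analytic_intros pa)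
  qed
  have N: "preschwarzian f z - preschwarzian g z = 0" if "z \<in> ball z0 r" for z
  proof (rule linear_ode_unique_zero[OF \<phi> r _ _ that])
    show "preschwarzian f z0 - preschwarzian g z0 = 0" using jet by (simp add: preschwarzian_def)
    fix z assume z: "z \<in> ball z0 r"
    have "deriv (preschwarzian f) z - deriv (preschwarzian g) z = \<phi> z * (preschwarzian f z - preschwarzian g z)"
    proof -
      have "fa - ga = 1 / 2 * (A + B) * (A - B)" if "fa - 1 / 2 * A ^ 2 = ga - 1 / 2 * B ^ 2" for fa ga A B :: complex
      proof -
        have "fa - ga = 1 / 2 * A ^ 2 - 1 / 2 * B ^ 2" using that by (simp add: algebra_simps)
        thus ?thesis by (simp add: power2_eq_square field_simps)
      qed
      from this[OF S[OF z, unfolded schwarzian_altdef]] show ?thesis unfolding \<phi>_def .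
    qed
    moreover have "((\<lambda>z. preschwarzian f z - preschwarzian g z) has_field_derivative
        deriv (preschwarzian f) z - deriv (preschwarzian g) z) (at z)"
      using z by (intro DERIV_diff analytic_at_has_deriv pa)
    ultimately show "((\<lambda>z. preschwarzian f z - preschwarzian g z) has_field_derivative
        \<phi> z * (preschwarzian f z - preschwarzian g z)) (at z)" by simp
  qed
  have ps: "preschwarzian f holomorphic_on ball z0 r"
    by (rule analytic_imp_holomorphic, subst analytic_on_analytic_at) (use pa in blast)
  have D: "deriv f z - deriv g z = 0" if "z \<in> ball z0 r" for z
  proof (rule linear_ode_unique_zero[OF ps r _ _ that])
    show "deriv f z0 - deriv g z0 = 0" using jet by simp
    fix z assume z: "z \<in> ball z0 r"
    have "(deriv ^^ 2) f z = preschwarzian f z * deriv f z" using f(2)[OF z] by (simp add: preschwarzian_def)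
    moreover have "(deriv ^^ 2) g z = preschwarzian f z * deriv g z"
      using g(2)[OF z] N[OF z] by (simp add: preschwarzian_def)
    moreover have "((\<lambda>z. deriv f z - deriv g z) has_field_derivative (deriv ^^ 2) f z - (deriv ^^ 2) g z) (at z)"
      using analytic_at_has_deriv[OF analytic_deriv[OF an(1)[OF z]]] analytic_at_has_deriv[OF analytic_deriv[OF an(2)[OF z]]]
      by (simp add: numeral_2_eq_2 DERIV_diff)
    ultimately show "((\<lambda>z. deriv f z - deriv g z) has_field_derivative
        preschwarzian f z * (deriv f z - deriv g z)) (at z)" by (simp add: algebra_simps)
  qed
  have "f z - g z = 0"
  proof (rule linear_ode_unique_zero[of "\<lambda>_. 0", OF _ r _ _ z])
    fix z assume z: "z \<in> ball z0 r"
    have "((\<lambda>z. f z - g z) has_field_derivative deriv f z - deriv g z) (at z)"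
      by (intro DERIV_diff analytic_at_has_deriv an z)
    thus "((\<lambda>z. f z - g z) has_field_derivative 0 * (f z - g z)) (at z)" using D[OF z] by simp
  qed (use jet in auto)
  thus ?thesis by simp
qed

text \<open>
  A suitable Moebius transformation of \<open>h\<close> has the same value and the same first two derivatives as \<open>f\<close> at a
  given regular point, and these data determine a function with prescribed Schwarzian derivative.
\<close>

lemma schwarzian_eq_imp_moebius_related:
  assumes f: "f nicely_meromorphic_on UNIV" "\<not> f constant_on UNIV"
    and h: "h nicely_meromorphic_on UNIV" "\<not> h constant_on UNIV"
    and S: "\<forall>\<^sub>\<approx>z. schwarzian f z = schwarzian h z"
  obtains a b c d where "a * d - b * c \<noteq> 0" "moebius_related f (moebius a b c d) h"
proof -
  have "\<forall>\<^sub>\<approx>z. (f analytic_on {z} \<and> deriv f z \<noteq> 0) \<and> (h analytic_on {z} \<and> deriv h z \<noteq> 0) \<and> schwarzian f z = schwarzian h z"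
    using nonconst_deriv_nonzero[OF f] nonconst_deriv_nonzero[OF h] S by eventually_elim blast
  from cosparse_ex[OF cosparse_eventually_nhds[OF this]] obtain z0 where
    ev0: "\<forall>\<^sub>F z in nhds z0. (f analytic_on {z} \<and> deriv f z \<noteq> 0) \<and> (h analytic_on {z} \<and> deriv h z \<noteq> 0) \<and> schwarzian f z = schwarzian h z"
    by blast
  note z0 = eventually_nhds_x_imp_x[OF ev0]
  \<comment> \<open>The map \<open>w \<mapsto> f z0 + x (w - h z0) / (1 + y (w - h z0))\<close> has derivatives \<open>x\<close> and \<open>-2 x y\<close> at \<open>h z0\<close>.\<close>
  define x where "x = deriv f z0 / deriv h z0"
  define y where "y = (x * (deriv ^^ 2) h z0 - (deriv ^^ 2) f z0) / (2 * x * deriv h z0 ^ 2)"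
  define a where "a = f z0 * y + x"
  define b where "b = f z0 - (f z0 * y + x) * h z0"
  define c where "c = y"
  define d where "d = 1 - y * h z0"
  have x0: "x \<noteq> 0" using z0 by (simp add: x_def)
  have detx: "a * d - b * c = x" by (simp add: a_def b_def c_def d_def algebra_simps)
  hence det: "a * d - b * c \<noteq> 0" using x0 by simp
  define G where "G = (\<lambda>z. (a * h z + b) / (c * h z + d))"
  have cd: "c * h z0 + d = 1" by (simp add: c_def d_def)
  have cha: "(\<lambda>z. c * h z + d) analytic_on {z0}" using z0 by (intro analytic_intros) auto
  have "\<forall>\<^sub>F z in nhds z0. c * h z + d \<noteq> 0" by (rule eventually_nhds_nonzero[OF cha]) (simp add: cd)
  with ev0 have ev: "\<forall>\<^sub>F z in nhds z0. (f analytic_on {z} \<and> deriv f z \<noteq> 0) \<and> (h analytic_on {z} \<and> deriv h z \<noteq> 0)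
      \<and> schwarzian f z = schwarzian h z \<and> c * h z + d \<noteq> 0"
    by eventually_elim blast
  then obtain r where r: "r > 0" and B: "\<And>z. z \<in> ball z0 r \<Longrightarrow> (f analytic_on {z} \<and> deriv f z \<noteq> 0) \<and>
      (h analytic_on {z} \<and> deriv h z \<noteq> 0) \<and> schwarzian f z = schwarzian h z \<and> c * h z + d \<noteq> 0"
    by (auto simp: eventually_nhds_metric dist_commute)
  have Ga: "G analytic_on {z}" if "z \<in> ball z0 r" for z
    unfolding G_def using B[OF that] by (intro analytic_intros) auto
  have dG: "(G has_field_derivative x * deriv h z / (c * h z + d) ^ 2) (at z)" if "z \<in> ball z0 r" for z
  proof -
    have hd: "(h has_field_derivative deriv h z) (at z)" using B[OF that] by (simp add: analytic_at_has_deriv)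
    have nz: "c * h z + d \<noteq> 0" using B[OF that] by simp
    from DERIV_chain2[OF deriv_moebius[OF nz, of a b] hd]
    show ?thesis unfolding G_def detx by simp
  qed
  have dG': "deriv G z = x * deriv h z / (c * h z + d) ^ 2" if "z \<in> ball z0 r" for z
    by (rule DERIV_imp_deriv[OF dG[OF that]])
  have inb: "z0 \<in> ball z0 r" using r by simp
  have "(deriv h has_field_derivative (deriv ^^ 2) h z0) (at z0)"
    using analytic_at_has_deriv[OF analytic_deriv, of h z0] z0 by (simp add: numeral_2_eq_2)
  moreover have "(h has_field_derivative deriv h z0) (at z0)" using z0 by (simp add: analytic_at_has_deriv)
  ultimately have d2': "((\<lambda>z. x * deriv h z / (c * h z + d) ^ 2) has_field_derivative
      x * (deriv ^^ 2) h z0 - 2 * x * y * deriv h z0 ^ 2) (at z0)"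
    by (auto intro!: derivative_eq_intros simp: cd) (simp add: c_def power2_eq_square algebra_simps)
  have "\<forall>\<^sub>F z in nhds z0. deriv G z = x * deriv h z / (c * h z + d) ^ 2"
    using eventually_nhds_in_open[OF open_ball inb] by eventually_elim (rule dG')
  hence d2G: "(deriv ^^ 2) G z0 = x * (deriv ^^ 2) h z0 - 2 * x * y * deriv h z0 ^ 2"
  proof -
    note ev' = \<open>\<forall>\<^sub>F z in nhds z0. deriv G z = x * deriv h z / (c * h z + d) ^ 2\<close>
    have "deriv (deriv G) z0 = deriv (\<lambda>z. x * deriv h z / (c * h z + d) ^ 2) z0"
      by (rule deriv_cong_ev[OF ev' refl])
    also have "\<dots> = x * (deriv ^^ 2) h z0 - 2 * x * y * deriv h z0 ^ 2"
      by (rule DERIV_imp_deriv[OF d2'])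
    finally show ?thesis by (simp add: numeral_2_eq_2)
  qed
  define g where "g = moebius_image a b c d h"
  have gn: "g nicely_meromorphic_on UNIV" unfolding g_def by (rule moebius_image_nicely_meromorphic[OF h(1)])
  have rel: "moebius_related g (moebius a b c d) h" unfolding g_def by (rule moebius_image_related[OF h det])
  have fG: "f z = G z" if "z \<in> ball z0 r" for z
  proof (rule schwarzian_determines_germ[OF r _ _ _ _ _ _ _ _ that])
    show "f holomorphic_on ball z0 r"
      by (rule analytic_imp_holomorphic, subst analytic_on_analytic_at) (use B in blast)
    show "G holomorphic_on ball z0 r"
      by (rule analytic_imp_holomorphic, subst analytic_on_analytic_at) (use Ga in blast)
    show "deriv f z \<noteq> 0" if "z \<in> ball z0 r" for z using B[OF that] by simp
    show "deriv G z \<noteq> 0" if "z \<in> ball z0 r" for z using B[OF that] dG'[OF that] x0 by simp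
    show "schwarzian f z = schwarzian G z" if "z \<in> ball z0 r" for z
      unfolding G_def using B[OF that] schwarzian_moebius_compose[OF _ _ det, of h z] by simp
    show "f z0 = G z0" unfolding G_def cd by (simp add: a_def b_def algebra_simps)
    show "deriv f z0 = deriv G z0" using dG'[OF inb] z0 by (simp add: cd x_def)
    show "(deriv ^^ 2) f z0 = (deriv ^^ 2) G z0"
      unfolding d2G using z0 x0 by (simp add: y_def)
  qed
  have "\<forall>\<^sub>F z in at z0. z \<in> ball z0 r" using r by (intro eventually_at_in_open') auto
  hence "\<forall>\<^sub>F z in at z0. f z = g z"
  proof eventually_elim
    case (elim z)
    have "g z = G z" unfolding g_def moebius_image_def using Ga[OF elim] by (simp add: G_def)
    thus ?case using fG[OF elim] by simp
  qed
  hence "\<exists>\<^sub>F z in at z0. f z = g z" by (intro eventually_frequently) auto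
  from meromorphic_eq_cosparse[OF _ _ this] have "\<forall>\<^sub>\<approx>z. f z = g z"
    using f gn nicely_meromorphic_imp_meromorphic by blast
  hence "f = g" by (rule nicely_meromorphic_eqI[OF f(1) gn])
  thus ?thesis using that[OF det] rel by simp
qed

section \<open>The two reduced equations\<close>

lemma sphere_val_entire:
  fixes f :: "complex \<Rightarrow> complex"
  assumes "f holomorphic_on UNIV" shows "sphere_val f z = Fin (f z)"
  using analytic_at_imp_no_pole[OF entire_analytic_at[OF assms]] by (simp add: sphere_val_def)

lemma entire_nicely_meromorphic:
  fixes f :: "complex \<Rightarrow> complex"
  assumes "f holomorphic_on UNIV" shows "f nicely_meromorphic_on UNIV"
  using assms by (intro analytic_on_imp_nicely_meromorphic_on) (simp add: analytic_on_open)

text \<open>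
  The identity has Schwarzian derivative 0, so a function with this property is a Moebius transformation
  of the identity, which is rational.
\<close>

lemma transcendental_imp_schwarzian_nonzero:
  assumes f: "f nicely_meromorphic_on UNIV" and tr: "transcendental f"
  shows "\<not> (\<forall>\<^sub>\<approx>z. schwarzian f z = 0)"
proof
  assume S: "\<forall>\<^sub>\<approx>z. schwarzian f z = 0"
  have id: "(\<lambda>z. z) nicely_meromorphic_on UNIV" by (intro entire_nicely_meromorphic holomorphic_intros)
  have idn: "\<not> (\<lambda>z::complex. z) constant_on UNIV"
    by (auto simp: constant_on_def) (metis one_neq_zero)
  have "schwarzian (\<lambda>z. (1 * z + 0) / (0 * z + 1)) z = 0" for z by (rule schwarzian_moebius) auto
  hence "schwarzian (\<lambda>z. z) z = 0" for z by simp
  hence "\<forall>\<^sub>\<approx>z. schwarzian f z = schwarzian (\<lambda>z. z) z" using S by simp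
  then obtain a b c d where det: "a * d - b * c \<noteq> 0" and rel: "moebius_related f (moebius a b c d) (\<lambda>z. z)"
    by (rule schwarzian_eq_imp_moebius_related[OF f transcendental_nonconstant[OF tr] id idn])
  have "\<forall>\<^sub>\<approx>z. c * z + d \<noteq> 0 \<and> f z = (a * z + b) / (c * z + d)"
    by (rule moebius_related_formula[OF rel det id idn])
  hence "\<forall>\<^sub>\<approx>z. f z = poly [:b, a:] z / poly [:d, c:] z"
    by eventually_elim (simp add: algebra_simps)
  moreover have "[:d, c:] \<noteq> 0" using det by auto
  ultimately show False using tr unfolding transcendental_def by blast
qed

lemma moebius_identity: "moebius 1 0 0 1 w = w"
  by (cases w) auto

text \<open>
  A solution has a constant Schwarzian derivative \<open>\<kappa>\<close> with \<open>\<kappa>^p = K\<close>, which is also the Schwarzian derivative of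
  \<open>exp (\<alpha> z)\<close> if \<open>\<alpha>\<^sup>2 = - 2 \<kappa>\<close>.
\<close>

theorem constant_rhs_case:
  assumes p: "p > 0" and R: "\<And>w. R w = K" and sol: "schwarz_solution p R f" and tr: "transcendental f"
  shows "\<exists>\<gamma>1 c u. is_moebius \<gamma>1 \<and> reduces_to p R \<gamma>1 (\<lambda>_. c) \<and>
        moebius_related f \<gamma>1 u \<and> schwarz_solution 1 (\<lambda>_. c) u \<and>
        (\<forall>g. g nicely_meromorphic_on UNIV \<longrightarrow>
           (schwarz_solution p R g \<longleftrightarrow>
              (\<exists>\<omega> \<alpha> \<gamma>2. \<omega> ^ p = 1 \<and> \<alpha> = csqrt (- 2 * (\<omega> * c)) \<and> is_moebius \<gamma>2 \<and>
                 (\<forall>z. sphere_val g z = \<gamma>2 (Fin (exp (\<alpha> * z)))))))"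
proof -
  note S = schwarz_solutionD[OF sol]
  have Kroot: "\<exists>C. C ^ p = K \<and> (\<forall>\<^sub>\<approx>z. schwarzian g z = C)" if "schwarz_solution p R g" for g
  proof -
    have "schwarzian g meromorphic_on UNIV"
      using that by (intro meromorphic_intros nicely_meromorphic_imp_meromorphic) (simp add: schwarz_solution_def)
    moreover have "\<forall>\<^sub>\<approx>z. schwarzian g z ^ p = K" using that by (simp add: schwarz_solution_def R)
    ultimately show ?thesis using meromorphic_root_constant[OF _ p] by metis
  qed
  obtain c where c: "c ^ p = K" "\<forall>\<^sub>\<approx>z. schwarzian f z = c" using Kroot[OF sol] by blast
  have c0: "c \<noteq> 0" using transcendental_imp_schwarzian_nonzero[OF S(1) tr] c(2) by auto
  have red: "reduces_to p R (moebius 1 0 0 1) (\<lambda>_. c)"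
    by (rule reduces_toI[of 1 1 0 0 p "{}"]) (use p c c0 in \<open>auto simp: R\<close>)
  have iff: "schwarz_solution p R g \<longleftrightarrow>
      (\<exists>\<omega> \<alpha> \<gamma>2. \<omega> ^ p = 1 \<and> \<alpha> = csqrt (- 2 * (\<omega> * c)) \<and> is_moebius \<gamma>2 \<and>
         (\<forall>z. sphere_val g z = \<gamma>2 (Fin (exp (\<alpha> * z)))))" if g: "g nicely_meromorphic_on UNIV" for g
  proof -
    have exph: "(\<lambda>z. exp (\<alpha> * z)) holomorphic_on UNIV" for \<alpha> :: complex by (intro holomorphic_intros)
    have expn: "\<not> (\<lambda>z. exp (\<alpha> * z)) constant_on UNIV" if "\<alpha> \<noteq> 0" for \<alpha> :: complex
    proof
      assume "(\<lambda>z. exp (\<alpha> * z)) constant_on UNIV"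
      then obtain k where k: "\<And>z. exp (\<alpha> * z) = k" unfolding constant_on_def by blast
      have "exp (\<alpha> * 0) = exp (\<alpha> * (of_real pi * \<i> / \<alpha>))" unfolding k ..
      thus False using that by (simp add: exp_pi_i)
    qed
    show ?thesis
    proof
      assume gs: "schwarz_solution p R g"
      obtain C where C: "C ^ p = K" "\<forall>\<^sub>\<approx>z. schwarzian g z = C" using Kroot[OF gs] by blast
      define \<omega> where "\<omega> = C / c"
      have \<omega>: "\<omega> ^ p = 1" "\<omega> * c = C" using C c c0 p by (auto simp: \<omega>_def power_divide)
      define \<alpha> where "\<alpha> = csqrt (- 2 * (\<omega> * c))"
      have \<alpha>2: "\<alpha> ^ 2 = - 2 * C" by (simp add: \<alpha>_def \<omega>)
      have "C \<noteq> 0" using C(1) c(1) c0 p by (metis power_eq_0_iff)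
      hence \<alpha>0: "\<alpha> \<noteq> 0" using \<alpha>2 by auto
      have "schwarzian (\<lambda>z. exp (\<alpha> * z)) z = C" for z using schwarzian_exp[OF \<alpha>0] \<alpha>2 by simp
      hence "\<forall>\<^sub>\<approx>z. schwarzian g z = schwarzian (\<lambda>z. exp (\<alpha> * z)) z" using C(2) by simp
      then obtain a b c' d where det: "a * d - b * c' \<noteq> 0"
        and rel: "moebius_related g (moebius a b c' d) (\<lambda>z. exp (\<alpha> * z))"
        by (rule schwarzian_eq_imp_moebius_related[OF g schwarz_solutionD(2)[OF gs]
              entire_nicely_meromorphic[OF exph] expn[OF \<alpha>0]])
      have "sphere_val g z = moebius a b c' d (Fin (exp (\<alpha> * z)))" for z
        using rel sphere_val_entire[OF exph] by (simp add: moebius_related_def)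
      thus "\<exists>\<omega> \<alpha> \<gamma>2. \<omega> ^ p = 1 \<and> \<alpha> = csqrt (- 2 * (\<omega> * c)) \<and> is_moebius \<gamma>2 \<and>
         (\<forall>z. sphere_val g z = \<gamma>2 (Fin (exp (\<alpha> * z))))"
        using \<omega>(1) \<alpha>_def det unfolding is_moebius_def by blast
    next
      assume "\<exists>\<omega> \<alpha> \<gamma>2. \<omega> ^ p = 1 \<and> \<alpha> = csqrt (- 2 * (\<omega> * c)) \<and> is_moebius \<gamma>2 \<and>
         (\<forall>z. sphere_val g z = \<gamma>2 (Fin (exp (\<alpha> * z))))"
      then obtain \<omega> \<alpha> a b c' d where \<omega>: "\<omega> ^ p = 1" and \<alpha>: "\<alpha> = csqrt (- 2 * (\<omega> * c))"
        and det: "a * d - b * c' \<noteq> 0" and sv: "\<And>z. sphere_val g z = moebius a b c' d (Fin (exp (\<alpha> * z)))"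
        unfolding is_moebius_def by blast
      have \<alpha>2: "\<alpha> ^ 2 = - 2 * (\<omega> * c)" by (simp add: \<alpha>)
      have "\<omega> \<noteq> 0" using \<omega> p by (auto simp: power_0_left)
      hence \<alpha>0: "\<alpha> \<noteq> 0" using \<alpha>2 c0 by auto
      define h where "h = (\<lambda>z. exp (\<alpha> * z))"
      have h: "h nicely_meromorphic_on UNIV" "\<not> h constant_on UNIV"
        unfolding h_def using expn[OF \<alpha>0] entire_nicely_meromorphic[OF exph] by auto
      have rel: "moebius_related g (moebius a b c' d) h"
        unfolding moebius_related_def h_def using sv sphere_val_entire[OF exph] by simp
      have Sh: "schwarzian h z = \<omega> * c" for z unfolding h_def using schwarzian_exp[OF \<alpha>0] \<alpha>2 by simp
      have "\<forall>\<^sub>\<approx>z. schwarzian g z ^ p = R (g z)"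
        using moebius_related_schwarzian[OF rel det h]
        by eventually_elim (simp add: Sh R power_mult_distrib \<omega> c)
      thus "schwarz_solution p R g"
        using g moebius_related_constant_iff[OF rel det g h(1)] h(2) by (simp add: schwarz_solution_def)
    qed
  qed
  have "is_moebius (moebius 1 0 0 1)" unfolding is_moebius_def by (intro exI[of _ 1] exI[of _ 0]) auto
  moreover have "moebius_related f (moebius 1 0 0 1) f"
    by (simp add: moebius_related_def moebius_identity del: moebius.simps)
  moreover have "schwarz_solution 1 (\<lambda>_. c) f" using S c by (simp add: schwarz_solution_def)
  ultimately show ?thesis using red iff by blast
qed

lemma sin_affine_holomorphic: "(\<lambda>z. sin (\<alpha> * z + \<beta>)) holomorphic_on UNIV"
  by (intro holomorphic_intros)

lemma sin_affine_nonconstant: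
  assumes "\<alpha> \<noteq> (0::complex)" shows "\<not> (\<lambda>z. sin (\<alpha> * z + \<beta>)) constant_on UNIV"
proof
  assume "(\<lambda>z. sin (\<alpha> * z + \<beta>)) constant_on UNIV"
  then obtain k where k: "\<And>z. sin (\<alpha> * z + \<beta>) = k" unfolding constant_on_def by blast
  have "sin (\<alpha> * (- \<beta> / \<alpha>) + \<beta>) = sin (\<alpha> * ((of_real (pi / 2) - \<beta>) / \<alpha>) + \<beta>)" unfolding k ..
  hence "sin 0 = sin (complex_of_real (pi / 2))" using assms by (simp del: of_real_divide)
  thus False by (simp only: sin_of_real) simp
qed

lemma sin_affine_transcendental:
  assumes \<alpha>: "\<alpha> \<noteq> (0::complex)" shows "transcendental (\<lambda>z. sin (\<alpha> * z + \<beta>))"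
  unfolding transcendental_def
proof
  assume "\<exists>A B. B \<noteq> 0 \<and> (\<forall>\<^sub>\<approx>z. sin (\<alpha> * z + \<beta>) = poly A z / poly B z)"
  then obtain A B where B: "B \<noteq> 0" and eq: "\<forall>\<^sub>\<approx>z. sin (\<alpha> * z + \<beta>) = poly A z / poly B z" by blast
  have ev: "\<forall>\<^sub>\<approx>z. poly A z - poly B z * sin (\<alpha> * z + \<beta>) = 0"
    using eq poly_roots_cosparse[OF B] by eventually_elim simp
  have all: "poly A z = poly B z * sin (\<alpha> * z + \<beta>)" for z
  proof -
    have "(\<lambda>z. poly A z - poly B z * sin (\<alpha> * z + \<beta>)) analytic_on {z}"
      by (rule entire_analytic_at) (intro holomorphic_intros)
    from analytic_eventually_at_eq_0[OF this] ev show ?thesis by (simp add: cosparse_UNIV_iff)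
  qed
  \<comment> \<open>infinitely many zeros of the sine function\<close>
  define x where "x = (\<lambda>n::nat. (of_nat n * of_real pi - \<beta>) / \<alpha>)"
  have "poly A (x n) = 0" for n
  proof -
    have "\<alpha> * x n + \<beta> = of_real (of_nat n * pi)" using \<alpha> by (simp add: x_def)
    hence "sin (\<alpha> * x n + \<beta>) = of_real (sin (of_nat n * pi))" by (simp only: sin_of_real)
    hence "sin (\<alpha> * x n + \<beta>) = 0" by simp
    thus ?thesis using all[of "x n"] by simp
  qed
  hence "range x \<subseteq> {z. poly A z = 0}" by auto
  moreover have "inj x" using \<alpha> by (auto simp: inj_on_def x_def)
  ultimately have "infinite {z. poly A z = 0}" using range_inj_infinite finite_subset by blast
  hence "A = 0" using poly_roots_finite by blast
  hence "\<forall>\<^sub>\<approx>z. sin (\<alpha> * z + \<beta>) = 0" using eq by simp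
  moreover have "\<forall>\<^sub>\<approx>z. sin (\<alpha> * z + \<beta>) \<noteq> 0"
    by (rule nicely_meromorphic_avoid[OF entire_nicely_meromorphic[OF sin_affine_holomorphic] sin_affine_nonconstant[OF \<alpha>]])
  ultimately have "\<forall>\<^sub>\<approx>z. sin (\<alpha> * z + \<beta>) = 0 \<and> sin (\<alpha> * z + \<beta>) \<noteq> 0" by (rule eventually_conj)
  from cosparse_ex[OF this] show False by blast
qed

lemma sin_affine_schwarz_solution:
  assumes \<alpha>: "\<alpha> \<noteq> 0"
  shows "schwarz_solution 1 (sine_rhs (\<alpha> ^ 2 / 2)) (\<lambda>z. sin (\<alpha> * z + \<beta>))"
proof -
  define u where "u = (\<lambda>z. sin (\<alpha> * z + \<beta>))"
  have u: "u nicely_meromorphic_on UNIV" "\<not> u constant_on UNIV"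
    unfolding u_def using entire_nicely_meromorphic[OF sin_affine_holomorphic] sin_affine_nonconstant[OF \<alpha>] by auto
  have "\<forall>\<^sub>\<approx>z. schwarzian u z ^ 1 = sine_rhs (\<alpha> ^ 2 / 2) (u z)"
    using nonconst_deriv_nonzero[OF u]
  proof eventually_elim
    case (elim z)
    have "deriv u z = \<alpha> * cos (\<alpha> * z + \<beta>)"
      unfolding u_def by (rule DERIV_imp_deriv) (auto intro!: derivative_eq_intros)
    hence "cos (\<alpha> * z + \<beta>) \<noteq> 0" using elim by auto
    thus ?case unfolding u_def using schwarzian_sin[OF \<alpha>] by simp
  qed
  thus ?thesis using u by (simp add: schwarz_solution_def u_def)
qed

lemma sine_rhs_poly: "sine_rhs c w = poly (smult c [:2, 0, 1:]) w / poly [:- 1, 0, 1:] w"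
  unfolding sine_rhs_eq by (simp add: power2_eq_square algebra_simps)

text \<open>
  The right-hand side has a simple pole at 1, so a transcendental solution takes the value 1 somewhere. There
  the multiplicity is 2 and, the pole being simple, the leading coefficient is determined by the equation; the
  rigidity of the germ leaves only the sine function that takes the value 1 at the same point.
\<close>

lemma sine_equation_solutions:
  assumes C: "C \<noteq> 0" and sol: "schwarz_solution 1 (sine_rhs C) v" and tr: "transcendental v"
  shows "\<exists>\<beta>. v = (\<lambda>z. sin (csqrt (2 * C) * z + \<beta>))"
proof -
  define P where "P = smult C [:2, 0, 1:]"
  define Q :: "complex poly" where "Q = [:- 1, 0, 1:]"
  have sol': "schwarz_solution 1 (\<lambda>w. poly P w / poly Q w) v"
    using sol by (simp only: P_def Q_def sine_rhs_poly[symmetric])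
  note S = schwarz_solutionD[OF sol']
  have Q0: "Q \<noteq> 0" by (simp add: Q_def)
  have Q1: "poly Q 1 = 0" by (simp add: Q_def)
  have P1: "poly P 1 \<noteq> 0" using C by (simp add: P_def)
  have cop: "coprime P Q"
  proof (rule coprime_if_no_common_root[OF Q0])
    fix z assume "poly P z = 0"
    hence "C * (2 + z * z) = 0" by (simp add: P_def algebra_simps)
    hence "z * z = - 2" using C by (simp add: add_eq_0_iff)
    thus "poly Q z \<noteq> 0" by (simp add: Q_def)
  qed
  have Qf: "Q = [:- 1, 1:] ^ 1 * [:1, 1:]" by (simp add: Q_def)
  have q1: "poly [:1, 1:] (1::complex) \<noteq> 0" by simp
  have "infinite {z. sphere_val v z = Fin 1}"
    by (rule pole_value_attained_infinitely_often[OF sol' Q0 Q1 cop tr])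
  then obtain z0 where z0: "sphere_val v z0 = Fin 1"
    by (metis (mono_tags, lifting) empty_Collect_eq finite.emptyI)
  define \<alpha> where "\<alpha> = csqrt (2 * C)"
  have \<alpha>2: "\<alpha> ^ 2 / 2 = C" by (simp add: \<alpha>_def)
  have \<alpha>0: "\<alpha> \<noteq> 0" using C by (auto simp: \<alpha>_def)
  \<comment> \<open>chosen such that the sine function takes the value 1 at \<open>z0\<close>\<close>
  define \<beta> where "\<beta> = of_real (pi / 2) - \<alpha> * z0"
  define s where "s = (\<lambda>z. sin (\<alpha> * z + \<beta>))"
  have shol: "s holomorphic_on UNIV" unfolding s_def by (rule sin_affine_holomorphic)
  have "schwarz_solution 1 (sine_rhs C) s"
    using sin_affine_schwarz_solution[OF \<alpha>0, of \<beta>] unfolding \<alpha>2 s_def .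
  hence sols: "schwarz_solution 1 (\<lambda>w. poly P w / poly Q w) s"
    by (simp only: P_def Q_def sine_rhs_poly[symmetric])
  have "s z0 = 1"
  proof -
    have "\<alpha> * z0 + \<beta> = of_real (pi / 2)" by (simp add: \<beta>_def)
    hence "s z0 = of_real (sin (pi / 2))" unfolding s_def by (simp only: sin_of_real)
    thus ?thesis by simp
  qed
  hence s0: "sphere_val s z0 = Fin 1" using sphere_val_entire[OF shol] by simp
  obtain m g where g: "m * 1 = 2 * 1" "m \<ge> 2" "g analytic_on {0}" "g 0 \<noteq> 0"
    "\<forall>\<^sub>F z in nhds 0. v (z + z0) = 1 + z ^ m * g z"
    "g 0 ^ 1 * poly [:1, 1:] 1 * (- (of_nat (m - 1) * (of_nat (m - 1) + 2)) / 2) ^ 1 = poly P 1"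
    by (rule pole_point_germ[OF sol' _ Qf q1 _ P1 z0]) simp_all
  obtain m' g' where g': "m' * 1 = 2 * 1" "m' \<ge> 2" "g' analytic_on {0}" "g' 0 \<noteq> 0"
    "\<forall>\<^sub>F z in nhds 0. s (z + z0) = 1 + z ^ m' * g' z"
    "g' 0 ^ 1 * poly [:1, 1:] 1 * (- (of_nat (m' - 1) * (of_nat (m' - 1) + 2)) / 2) ^ 1 = poly P 1"
    by (rule pole_point_germ[OF sols _ Qf q1 _ P1 s0]) simp_all
  have m: "m = 2" "m' = 2" using g(1) g'(1) by auto
  have "- (3 * g 0) = poly P 1" "- (3 * g' 0) = poly P 1" using g(6) g'(6) unfolding m by simp_all
  hence "- (3 * g' 0) = - (3 * g 0)" by (simp only:)
  hence gg: "g' 0 = g 0" by simp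
  have sv: "\<forall>\<^sub>F z in at 0. schwarzian (\<lambda>z. v (z + z0)) z ^ 1 = poly P (v (z + z0)) / poly Q (v (z + z0))"
    using solution_affine_local[OF sol', of 1 z0] by simp
  have ss: "\<forall>\<^sub>F z in at 0. schwarzian (\<lambda>z. s (z + z0)) z ^ 1 = poly P (s (z + z0)) / poly Q (s (z + z0))"
    using solution_affine_local[OF sols, of 1 z0] by simp
  have "\<forall>\<^sub>F z in nhds 0. v (z + z0) = s (z + z0)"
    by (rule pole_germ_unique[OF Qf q1 P1 _ _ g(5)[unfolded m] g(3) g'(5)[unfolded m] g'(3) refl gg g(4) _ sv ss]) auto
  hence "\<forall>\<^sub>F z in at 0. v (1 * z + z0) = s (1 * z + z0)" using eventually_nhds_imp_at by simp
  hence fr: "\<exists>\<^sub>F z in at 0. v (1 * z + z0) = s (1 * z + z0)" by (intro eventually_frequently) auto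
  have nm: "(\<lambda>z. v (1 * z + z0)) nicely_meromorphic_on UNIV" "(\<lambda>z. s (1 * z + z0)) nicely_meromorphic_on UNIV"
    by (rule nicely_meromorphic_affine[OF S(1)], simp,
        rule nicely_meromorphic_affine[OF entire_nicely_meromorphic[OF shol]], simp)
  have eq: "(\<lambda>z. v (1 * z + z0)) = (\<lambda>z. s (1 * z + z0))"
    by (rule nicely_meromorphic_eqI[OF nm meromorphic_eq_cosparse[OF nm[THEN nicely_meromorphic_imp_meromorphic] fr]])
  have "v z = s z" for z using fun_cong[OF eq, of "z - z0"] by simp
  hence "v = s" by auto
  thus ?thesis unfolding s_def \<alpha>_def by blast
qed

text \<open>
  The right-hand sides \<open>R \<circ> \<gamma>\<close> and \<open>sine_rhs C ^ p\<close> agree on the values of a sine function, so they agree as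
  rational functions; everything else follows from the classification of the solutions of the reduced equation.
\<close>

theorem sine_case:
  assumes p: "p > 0" and Q0: "Q \<noteq> 0" and R: "R = (\<lambda>w. poly P w / poly Q w)"
    and sol: "schwarz_solution p R f" and det: "a * d - b * c \<noteq> 0" and \<alpha>: "\<alpha> \<noteq> 0"
    and f: "\<And>z. sphere_val f z = moebius a b c d (Fin (sin (\<alpha> * z + \<beta>)))"
  shows "\<exists>\<gamma>1 c u. is_moebius \<gamma>1 \<and> reduces_to p R \<gamma>1 (sine_rhs c) \<and>
        moebius_related f \<gamma>1 u \<and> schwarz_solution 1 (sine_rhs c) u \<and>
        (\<forall>g. g nicely_meromorphic_on UNIV \<longrightarrow>
           (schwarz_solution p R g \<and> transcendental g \<longleftrightarrow>
              (\<exists>\<omega> \<alpha> \<beta>. \<omega> ^ p = 1 \<and> \<alpha> = csqrt (2 * (\<omega> * c)) \<and>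
                 (\<forall>z. sphere_val g z = \<gamma>1 (Fin (sin (\<alpha> * z + \<beta>)))))))"
proof -
  define C where "C = \<alpha> ^ 2 / 2"
  have C0: "C \<noteq> 0" using \<alpha> by (simp add: C_def)
  define \<gamma> where "\<gamma> = moebius a b c d"
  define u where "u = (\<lambda>z. sin (\<alpha> * z + \<beta>))"
  have u: "u nicely_meromorphic_on UNIV" "\<not> u constant_on UNIV"
    unfolding u_def using entire_nicely_meromorphic[OF sin_affine_holomorphic] sin_affine_nonconstant[OF \<alpha>] by auto
  have usol: "schwarz_solution 1 (sine_rhs C) u" unfolding u_def C_def by (rule sin_affine_schwarz_solution[OF \<alpha>])
  have rel: "moebius_related f \<gamma> u"
    unfolding moebius_related_def \<gamma>_def u_def using f sphere_val_entire[OF sin_affine_holomorphic] by simp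
  note rel' = rel[unfolded \<gamma>_def]
  have mob: "is_moebius \<gamma>" unfolding is_moebius_def \<gamma>_def using det by blast
  obtain P1 Q1 where PQ': "coprime P1 Q1" and PQ: "Q1 \<noteq> 0"
    "finite {w. c * w + d = 0 \<or> poly P ((a * w + b) / (c * w + d)) / poly Q ((a * w + b) / (c * w + d)) \<noteq> poly P1 w / poly Q1 w}"
    by (rule rational_moebius_pullback[OF Q0 det, of P]) (rule that; assumption)
  define E0 where "E0 = {w. c * w + d = 0 \<or> poly P ((a * w + b) / (c * w + d)) / poly Q ((a * w + b) / (c * w + d)) \<noteq> poly P1 w / poly Q1 w}"
  have E0: "finite E0" "\<And>w. w \<notin> E0 \<Longrightarrow> c * w + d \<noteq> 0 \<and> R ((a * w + b) / (c * w + d)) = poly P1 w / poly Q1 w"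
    using PQ(2) unfolding E0_def R by auto
  define U :: "complex poly" where "U = smult C [:2, 0, 1:]"
  define V :: "complex poly" where "V = [:- 1, 0, 1:]"
  have U0: "U \<noteq> 0" "V \<noteq> 0" using C0 by (auto simp: U_def V_def)
  have UV: "sine_rhs C w = poly U w / poly V w" for w unfolding U_def V_def by (rule sine_rhs_poly)
  define E where "E = E0 \<union> {w. poly Q1 w = 0} \<union> {w. poly U w = 0} \<union> {w. poly V w = 0}"
  have E: "finite E" unfolding E_def using E0 poly_roots_finite PQ U0 by blast
  \<comment> \<open>The identity \<open>R \<circ> \<gamma> = sine_rhs C ^ p\<close> means that this polynomial vanishes.\<close>
  define Z where "Z = P1 * V ^ p - U ^ p * Q1"
  have "\<forall>\<^sub>\<approx>z. schwarzian f z ^ p = R (f z)" using sol by (simp add: schwarz_solution_def)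
  moreover have "\<forall>\<^sub>\<approx>z. schwarzian u z ^ 1 = sine_rhs C (u z)" using usol by (simp add: schwarz_solution_def)
  ultimately have Zu: "\<forall>\<^sub>\<approx>z. poly Z (u z) = 0"
    using moebius_related_schwarzian[OF rel' det u] moebius_related_formula[OF rel' det u]
      nicely_meromorphic_avoid_finite[OF u E]
  proof eventually_elim
    case (elim z)
    have nz: "poly Q1 (u z) \<noteq> 0" "poly V (u z) \<noteq> 0" "u z \<notin> E0" using elim(5) by (auto simp: E_def)
    have "poly P1 (u z) / poly Q1 (u z) = (poly U (u z) / poly V (u z)) ^ p"
      using E0(2)[OF nz(3)] elim(1-4) UV by simp
    thus ?case using nz by (simp add: Z_def power_divide field_simps)
  qed
  have "Z = 0"
  proof (rule ccontr)
    assume "Z \<noteq> 0"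
    from nicely_meromorphic_avoid_finite[OF u poly_roots_finite[OF this]]
    have "\<forall>\<^sub>\<approx>z. poly Z (u z) \<noteq> 0" by simp
    from cosparse_ex[OF eventually_conj[OF this Zu]] show False by blast
  qed
  hence PV: "P1 * V ^ p = U ^ p * Q1" by (simp add: Z_def)
  have RT: "R ((a * w + b) / (c * w + d)) = sine_rhs C w ^ p" if "w \<notin> E" for w
  proof -
    have nz: "poly Q1 w \<noteq> 0" "poly V w \<noteq> 0" "w \<notin> E0" using that by (auto simp: E_def)
    have "poly P1 w * poly V w ^ p = poly U w ^ p * poly Q1 w"
      using arg_cong[OF PV, of "\<lambda>p. poly p w"] by (simp add: poly_power)
    hence "poly P1 w / poly Q1 w = (poly U w / poly V w) ^ p" using nz by (simp add: power_divide field_simps)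
    thus ?thesis using E0(2)[OF nz(3)] UV by simp
  qed
  have red: "reduces_to p R \<gamma> (sine_rhs C)"
    unfolding \<gamma>_def
  proof (rule reduces_toI[OF det p E])
    show "R ((a * w + b) / (c * w + d)) = sine_rhs C w ^ p" if "w \<notin> E" for w by (rule RT[OF that])
    show "(\<lambda>z. sine_rhs C (u z)) meromorphic_on UNIV" if "u meromorphic_on UNIV" for u
      unfolding UV by (intro meromorphic_intros that)
    show "sine_rhs C w \<noteq> 0" if "w \<notin> E" for w using that unfolding UV by (auto simp: E_def)
  qed
  have iff: "schwarz_solution p R g \<and> transcendental g \<longleftrightarrow>
      (\<exists>\<omega> \<alpha> \<beta>. \<omega> ^ p = 1 \<and> \<alpha> = csqrt (2 * (\<omega> * C)) \<and>
         (\<forall>z. sphere_val g z = \<gamma> (Fin (sin (\<alpha> * z + \<beta>)))))" if g: "g nicely_meromorphic_on UNIV" for g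
  proof
    assume "schwarz_solution p R g \<and> transcendental g"
    hence gs: "schwarz_solution p R g" and gt: "transcendental g" by auto
    define v where "v = moebius_image d (- b) (- c) a g"
    have det': "d * a - (- b) * (- c) \<noteq> 0" using det by (simp add: mult.commute)
    have v: "v nicely_meromorphic_on UNIV" unfolding v_def by (rule moebius_image_nicely_meromorphic[OF g])
    have vr: "moebius_related v (moebius d (- b) (- c) a) g"
      unfolding v_def by (rule moebius_image_related[OF g schwarz_solutionD(2)[OF gs] det'])
    have gr: "moebius_related g \<gamma> v" unfolding \<gamma>_def using moebius_related_sym[OF vr det'] by simp
    have vt: "transcendental v" by (rule moebius_related_transcendental[OF vr det' g v gt])
    obtain \<omega> where \<omega>: "\<omega> ^ p = 1" "schwarz_solution 1 (\<lambda>w. \<omega> * sine_rhs C w) v"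
      using red gs g v gr unfolding reduces_to_def by blast
    have "\<omega> \<noteq> 0" using \<omega>(1) p by (auto simp: power_0_left)
    hence \<omega>C: "\<omega> * C \<noteq> 0" using C0 by simp
    have "(\<lambda>w. \<omega> * sine_rhs C w) = sine_rhs (\<omega> * C)" by (auto simp: sine_rhs_def)
    then obtain \<beta>' where \<beta>': "v = (\<lambda>z. sin (csqrt (2 * (\<omega> * C)) * z + \<beta>'))"
      using sine_equation_solutions[OF \<omega>C _ vt] \<omega>(2) by auto
    have "sphere_val g z = \<gamma> (Fin (sin (csqrt (2 * (\<omega> * C)) * z + \<beta>')))" for z
      using gr sphere_val_entire[OF sin_affine_holomorphic] unfolding \<beta>' by (simp add: moebius_related_def)
    thus "\<exists>\<omega> \<alpha> \<beta>. \<omega> ^ p = 1 \<and> \<alpha> = csqrt (2 * (\<omega> * C)) \<and>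
         (\<forall>z. sphere_val g z = \<gamma> (Fin (sin (\<alpha> * z + \<beta>))))" using \<omega>(1) by blast
  next
    assume "\<exists>\<omega> \<alpha> \<beta>. \<omega> ^ p = 1 \<and> \<alpha> = csqrt (2 * (\<omega> * C)) \<and>
         (\<forall>z. sphere_val g z = \<gamma> (Fin (sin (\<alpha> * z + \<beta>))))"
    then obtain \<omega> \<alpha>' \<beta>' where \<omega>: "\<omega> ^ p = 1" and \<alpha>': "\<alpha>' = csqrt (2 * (\<omega> * C))"
      and sv: "\<And>z. sphere_val g z = \<gamma> (Fin (sin (\<alpha>' * z + \<beta>')))" by blast
    have "\<omega> \<noteq> 0" using \<omega> p by (auto simp: power_0_left)
    hence \<alpha>0: "\<alpha>' \<noteq> 0" using C0 by (simp add: \<alpha>')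
    have \<alpha>2: "\<alpha>' ^ 2 / 2 = \<omega> * C" by (simp add: \<alpha>')
    define v where "v = (\<lambda>z. sin (\<alpha>' * z + \<beta>'))"
    have v: "v nicely_meromorphic_on UNIV" unfolding v_def by (rule entire_nicely_meromorphic[OF sin_affine_holomorphic])
    have gr: "moebius_related g \<gamma> v"
      unfolding moebius_related_def v_def using sv sphere_val_entire[OF sin_affine_holomorphic] by simp
    have "(\<lambda>w. \<omega> * sine_rhs C w) = sine_rhs (\<omega> * C)" by (auto simp: sine_rhs_def)
    hence "schwarz_solution 1 (\<lambda>w. \<omega> * sine_rhs C w) v"
      using sin_affine_schwarz_solution[OF \<alpha>0, of \<beta>'] unfolding \<alpha>2 v_def by simp
    hence "schwarz_solution p R g" using red \<omega> g v gr unfolding reduces_to_def by blast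
    moreover have "transcendental g"
      by (rule moebius_related_transcendental[OF gr[unfolded \<gamma>_def] det v g])
         (unfold v_def, rule sin_affine_transcendental[OF \<alpha>0])
    ultimately show "schwarz_solution p R g \<and> transcendental g" by simp
  qed
  show ?thesis using mob red rel usol iff by blast
qed

text \<open>
  A Moebius transformation takes the exceptional value to infinity and leaves a solution with finitely many
  poles of an equation of the same kind, which is a cosine up to an affine map.
\<close>

theorem nonconstant_rhs_case:
  assumes p: "p > 0" and cop: "coprime P Q" and Q0: "Q \<noteq> 0" and nonconst: "degree P > 0 \<or> degree Q > 0"
    and sol: "schwarz_solution p (\<lambda>w. poly P w / poly Q w) f" and tr: "transcendental f"
    and pic: "picard_exceptional f \<xi>"
  obtains a b c d \<alpha> \<beta> where "a * d - b * c \<noteq> 0" "\<alpha> \<noteq> 0"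
    "\<And>z. sphere_val f z = moebius a b c d (Fin (sin (\<alpha> * z + \<beta>)))"
proof -
  note S = schwarz_solutionD[OF sol]
  obtain a b c d where det: "a * d - b * c \<noteq> (0::complex)"
    and \<xi>: "\<And>w. moebius a b c d w = Infty \<Longrightarrow> w = \<xi>"
  proof (cases \<xi>)
    case Infty
    show ?thesis
      by (rule that[of 1 1 0 0]) (use Infty moebius_identity in auto)
  next
    case (Fin x)
    have "w = Fin x" if "moebius 0 1 1 (- x) w = Infty" for w
      using that by (cases w) (auto split: if_splits simp: add_eq_0_iff)
    thus ?thesis using that[of 0 "- x" 1 1] Fin by simp
  qed
  define h where "h = moebius_image a b c d f"
  have h: "h nicely_meromorphic_on UNIV" unfolding h_def by (rule moebius_image_nicely_meromorphic[OF S(1)])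
  have rel: "moebius_related h (moebius a b c d) f" unfolding h_def by (rule moebius_image_related[OF S(1,2) det])
  have ht: "transcendental h" by (rule moebius_related_transcendental[OF rel det S(1) h tr])
  have hn: "\<not> h constant_on UNIV" by (rule transcendental_nonconstant[OF ht])
  have "{z. is_pole h z} \<subseteq> {z. sphere_val f z = \<xi>}"
  proof
    fix z assume "z \<in> {z. is_pole h z}"
    hence "sphere_val h z = Infty" by (simp add: sphere_val_def)
    hence "moebius a b c d (sphere_val f z) = Infty" using rel by (simp add: moebius_related_def)
    thus "z \<in> {z. sphere_val f z = \<xi>}" using \<xi> by simp
  qed
  hence fin: "finite {z. is_pole h z}" using pic finite_subset by (auto simp: picard_exceptional_def)
  have det': "d * a - (- b) * (- c) \<noteq> 0" using det by (simp add: mult.commute)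
  have rel': "moebius_related f (moebius d (- b) (- c) a) h" by (rule moebius_related_sym[OF rel det])
  obtain P' Q' where PQ: "coprime P' Q'" "Q' \<noteq> 0"
    "finite {w. (- c) * w + a = 0 \<or> poly P ((d * w + (- b)) / ((- c) * w + a)) / poly Q ((d * w + (- b)) / ((- c) * w + a)) \<noteq> poly P' w / poly Q' w}"
    by (rule rational_moebius_pullback[OF Q0 det', of P]) (rule that; assumption)
  have "\<forall>\<^sub>\<approx>z. schwarzian f z ^ p = poly P (f z) / poly Q (f z)" using sol by (simp add: schwarz_solution_def)
  hence hS: "\<forall>\<^sub>\<approx>z. schwarzian h z ^ p = poly P' (h z) / poly Q' (h z)
      \<and> poly P (f z) / poly Q (f z) = poly P' (h z) / poly Q' (h z)"
    using moebius_related_schwarzian[OF rel' det' h hn] moebius_related_formula[OF rel' det' h hn]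
      nicely_meromorphic_avoid_finite[OF h hn PQ(3)]
    by eventually_elim auto
  have hsol: "schwarz_solution p (\<lambda>w. poly P' w / poly Q' w) h"
    unfolding schwarz_solution_def using h hn hS by (auto elim: eventually_mono)
  have nc': "degree P' > 0 \<or> degree Q' > 0"
  proof (rule ccontr)
    assume "\<not> ?thesis"
    then obtain x y where xy: "P' = [:x:]" "Q' = [:y:]" by (metis degree_eq_zeroE not_gr_zero)
    \<comment> \<open>If the transformed right-hand side were a constant \<open>k\<close>, then \<open>P - k Q\<close> would vanish on the values of \<open>f\<close>.\<close>
    define k where "k = x / y"
    have "\<forall>\<^sub>\<approx>z. poly (P - smult k Q) (f z) = 0"
      using hS nicely_meromorphic_avoid_finite[OF S(1,2) poly_roots_finite[OF Q0]]
      by eventually_elim (simp add: xy k_def field_simps)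
    note zero = this
    have "P - smult k Q = 0"
    proof (rule ccontr)
      assume "P - smult k Q \<noteq> 0"
      from nicely_meromorphic_avoid_finite[OF S(1,2) poly_roots_finite[OF this]]
      have "\<forall>\<^sub>\<approx>z. poly (P - smult k Q) (f z) \<noteq> 0" by simp
      from cosparse_ex[OF eventually_conj[OF this zero]] show False by blast
    qed
    hence PQk: "P = smult k Q" by simp
    hence "Q dvd P" by (simp add: dvd_smult)
    hence "is_unit Q" using cop by (meson coprime_common_divisor dvd_refl)
    hence dQ: "degree Q = 0" using Q0 by (simp add: is_unit_iff_degree)
    hence "degree P = 0" unfolding PQk by simp
    thus False using dQ nonconst by simp
  qed
  have p1: "p \<ge> 1" using p by simp
  obtain A B s z0 where AB: "A \<noteq> 0" "s \<noteq> 0" "\<And>z. h z = A * cos (s * (z - z0)) + B"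
    by (rule finite_poles_solution_is_cosine[OF hsol p1 PQ(1,2) nc' ht fin]) (rule that; (assumption | blast))
  define \<beta> where "\<beta> = of_real (pi / 2) - s * z0"
  have hsin: "h z = A * sin (s * z + \<beta>) + B" for z
  proof -
    have "cos (s * (z - z0)) = cos (- (s * (z - z0)))" by simp
    also have "\<dots> = sin (of_real pi / 2 - (- (s * (z - z0))))" by (rule cos_sin_eq)
    also have "\<dots> = sin (s * z + \<beta>)" by (simp add: \<beta>_def algebra_simps)
    finally show ?thesis using AB(3) by simp
  qed
  hence "h = (\<lambda>z. A * sin (s * z + \<beta>) + B)" by auto
  hence hh: "h holomorphic_on UNIV" by (simp only:) (intro holomorphic_intros)
  have "sphere_val f z = moebius (d * A) (d * B - b) (- c * A) (- c * B + a) (Fin (sin (s * z + \<beta>)))" for z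
  proof -
    have "sphere_val f z = moebius d (- b) (- c) a (Fin (A * sin (s * z + \<beta>) + B))"
      using rel' sphere_val_entire[OF hh] hsin by (simp add: moebius_related_def del: moebius.simps)
    thus ?thesis by (simp add: algebra_simps)
  qed
  moreover have "d * A * (- c * B + a) - (d * B - b) * (- c * A) = A * (a * d - b * c)" by (simp add: algebra_simps)
  hence "d * A * (- c * B + a) - (d * B - b) * (- c * A) \<noteq> 0" using AB(1) det by simp
  ultimately show ?thesis using that AB(2) by blast
qed

theorem theorem1:
  fixes p :: nat and P Q :: "complex poly" and R f :: "complex \<Rightarrow> complex"
    and \<xi> :: riemann_sphere
  assumes "p > 0" and "coprime P Q" and "Q \<noteq> 0"
    and "R = (\<lambda>w. poly P w / poly Q w)"
    and "schwarz_solution p R f" and "transcendental f" and "picard_exceptional f \<xi>"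
  shows
    "(\<exists>\<gamma>1 c u. is_moebius \<gamma>1 \<and> reduces_to p R \<gamma>1 (sine_rhs c) \<and>
        moebius_related f \<gamma>1 u \<and> schwarz_solution 1 (sine_rhs c) u \<and>
        (\<forall>g. g nicely_meromorphic_on UNIV \<longrightarrow>
           (schwarz_solution p R g \<and> transcendental g \<longleftrightarrow>
              (\<exists>\<omega> \<alpha> \<beta>. \<omega> ^ p = 1 \<and> \<alpha> = csqrt (2 * (\<omega> * c)) \<and>
                 (\<forall>z. sphere_val g z = \<gamma>1 (Fin (sin (\<alpha> * z + \<beta>))))))))
     \<or>
     (\<exists>\<gamma>1 c u. is_moebius \<gamma>1 \<and> reduces_to p R \<gamma>1 (\<lambda>_. c) \<and>
        moebius_related f \<gamma>1 u \<and> schwarz_solution 1 (\<lambda>_. c) u \<and>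
        (\<forall>g. g nicely_meromorphic_on UNIV \<longrightarrow>
           (schwarz_solution p R g \<longleftrightarrow>
              (\<exists>\<omega> \<alpha> \<gamma>2. \<omega> ^ p = 1 \<and> \<alpha> = csqrt (- 2 * (\<omega> * c)) \<and> is_moebius \<gamma>2 \<and>
                 (\<forall>z. sphere_val g z = \<gamma>2 (Fin (exp (\<alpha> * z))))))))"
proof (cases "degree P > 0 \<or> degree Q > 0")
  case True
  obtain a b c d \<alpha> \<beta> where *: "a * d - b * c \<noteq> 0" "\<alpha> \<noteq> 0"
    "\<And>z. sphere_val f z = moebius a b c d (Fin (sin (\<alpha> * z + \<beta>)))"
    by (rule nonconstant_rhs_case[OF assms(1-3) True assms(5)[unfolded assms(4)] assms(6,7)])
       (rule that; (assumption | blast))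
  show ?thesis
    by (rule disjI1, rule sine_case[OF assms(1,3,4,5) *])
next
  case False
  then obtain x y where xy: "P = [:x:]" "Q = [:y:]" by (metis degree_eq_zeroE not_gr_zero)
  have "R w = x / y" for w by (simp add: assms(4) xy)
  from constant_rhs_case[OF assms(1) this assms(5,6)] show ?thesis by (rule disjI2)
qed

end
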